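(* Let $(X,T)$ be a minimal Cantor system given by a proper Bratteli-Vershik representation $B=(V,E,\preceq)$. There exists a minimal Cantor system $(\tilde X,\tilde T)$ obtained by contractions (telescopings) and modifications of the local orders of $B$ (so it is strong orbit equivalent with $(X,T)$) such that (1) $(\tilde X,\tilde T)$ has no irrational continuous eigenvalues; (2) for every ergodic probability measure $\mu$ of $(X,T)$, the systems $(X,T,\mu)$ and $(\tilde X,\tilde T,\tilde\mu)$ have the same measure theoretical eigenvalues. In particular, if $(X,T)$ has no roots of unity other than $1$ as continuous eigenvalues, then $(\tilde X,\tilde T)$ is topologically weakly mixing.
   Context: Systems. A minimal Cantor system $(X,T)$ is a homeomorphism $T$ of a Cantor set $X$ all of whose orbits are dense. $\lambda\in\mathbb{C}$ is a continuous eigenvalue if there is a continuous $f:X\to\mathbb{C}$, $f\ne0$, with $f\circ T=\lambda f$; for an invariant Borel probability measure $\mu$, $\lambda$ is a (measure theoretical) eigenvalue for $\mu$ if there is $f\in L^2(X,\mu)$, $f\neq 0$, with $f\circ T=\lambda f$. An eigenvalue $\exp(2i\pi\alpha)$ is irrational if $\alpha$ is irrational. $(X,T)$ is topologically weakly mixing if it has no non-constant continuous eigenfunction. Strong orbit equivalence. $(X,T)$ and $(\tilde X,\tilde T)$ are orbit equivalent if there is a homeomorphism $\phi:X\to\tilde X$ sending $T$-orbits onto $\tilde T$-orbits; then there are $\vartheta,\kappa:X\to\mathbb{Z}$ with $\phi(Tx)=\tilde T^{\vartheta(x)}\phi(x)$ and $\phi(T^{\kappa(x)}x)=\tilde T\phi(x)$.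 They are strong orbit equivalent if $\phi$ can be chosen so that $\vartheta$ and $\kappa$ each have at most one discontinuity. The orbit equivalence induces an affine isomorphism $\mu\mapsto\tilde\mu$ between the sets of invariant probability measures. When the second system arises from a telescoping and modification of local orders of the diagram $B$, infinite paths of both diagrams are naturally identified and $\tilde\mu$ gives to cylinder sets the same mass as $\mu$ under this identification. Bratteli diagrams. A Bratteli diagram $(V,E)$ is an infinite graph with finite pairwise disjoint vertex levels $V_0=\{v_0\},V_1,V_2,\dots$ and finite edge levels $E_1,E_2,\dots$; each $e\in E_n$ goes from a source $\mathsf{s}(e)\in V_{n-1}$ to a range $\mathsf{r}(e)\in V_n$; every vertex is the source of some edge and every vertex other than $v_0$ is the range of some edge. Write $V_n=\{1,\dots,d_n\}$. $M_n$ is the $V_{n-1}\times V_n$ matrix whose $(u,v)$ entry is the number of edges from $u$ to $v$; $P_{m,n}=M_{m+1}\cdots M_n$; $h_n$ is the row vector with $h_n(u)$ the number of paths from $v_0$ to $u\in V_n$. $E_{m,n}$ is the set of paths from $V_m$ to $V_n$. The diagram is simple if for every $m\ge1$ there is $n>m$ with all entries of $P_{m,n}$ positive. Orders. An ordered Bratteli diagram $B=(V,E,\preceq)$ carries a partial order on $E$ in which two edges are comparable iff they have the same range (the local orders). It induces a partial order on each $E_{m,n}$: two distinct paths with the same range vertex are compared by the last edge at which they differ. The contraction (telescoping) of $B$ along a strictly increasing sequence $0=n_0<n_1<\cdots$ is the ordered diagram with vertex levels $V_{n_k}$, edge levels $E_{n_k,n_{k+1}}$ and the induced order. A modification of the local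 orders keeps $(V,E)$ and changes only the order $\preceq$. $X_B$ is the space of infinite paths $(x_1,x_2,\dots)$ starting at $v_0$, with the cylinder topology. $B$ is properly ordered if there is a unique $x_{\max}\in X_B$ with all edges maximal and a unique $x_{\min}\in X_B$ with all edges minimal. The Vershik map $V_B$ sends $x_{\max}$ to $x_{\min}$, and sends $x\ne x_{\max}$ to the path obtained by taking the smallest $n$ with $x_n$ not maximal, replacing $x_n$ by its successor $y_n$, replacing $(x_1,\dots,x_{n-1})$ by the minimal path from $v_0$ to $\mathsf{s}(y_n)$, and leaving the rest unchanged. $B$ is a Bratteli-Vershik representation of $(X,T)$ if $B$ is properly ordered, $(V,E)$ is simple and $(X,T)$ is topologically conjugate to $(X_B,V_B)$; one identifies $(X,T)=(X_B,V_B)$. It is proper if moreover: all entries of $h_1$ equal $1$; for all $n\ge2$ all entries of $M_n$ are positive; for all $n\ge2$ all maximal edges of $E_n$ start at the same vertex of $V_{n-1}$, namely $d_{n-1}$. *)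

theory Defs
  imports "HOL-Probability.Probability"
begin

section \<open>Minimal Cantor systems\<close>

definition cantor_space :: "'x topology \<Rightarrow> bool" where
  "cantor_space X \<longleftrightarrow>
     X homeomorphic_space
       product_topology (\<lambda>_::nat. discrete_topology (UNIV :: bool set)) UNIV"

definition int_iterate :: "'x topology \<Rightarrow> ('x \<Rightarrow> 'x) \<Rightarrow> int \<Rightarrow> 'x \<Rightarrow> 'x" where
  "int_iterate X T k x =
     (if k \<ge> 0 then (T ^^ nat k) x else (inv_into (topspace X) T ^^ nat (- k)) x)"

definition system_orbit :: "'x topology \<Rightarrow> ('x \<Rightarrow> 'x) \<Rightarrow> 'x \<Rightarrow> 'x set" where
  "system_orbit X T x = range (\<lambda>k. int_iterate X T k x)"

definition minimal_cantor_system :: "'x topology \<Rightarrow> ('x \<Rightarrow> 'x) \<Rightarrow> bool" where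
  "minimal_cantor_system X T \<longleftrightarrow>
     cantor_space X \<and> homeomorphic_map X X T \<and>
     (\<forall>x\<in>topspace X. X closure_of system_orbit X T x = topspace X)"

definition conjugacy ::
    "'x topology \<Rightarrow> ('x \<Rightarrow> 'x) \<Rightarrow> 'y topology \<Rightarrow> ('y \<Rightarrow> 'y) \<Rightarrow> ('x \<Rightarrow> 'y) \<Rightarrow> bool" where
  "conjugacy X T Y S h \<longleftrightarrow>
     homeomorphic_map X Y h \<and> (\<forall>x\<in>topspace X. h (T x) = S (h x))"

definition at_most_one_discontinuity :: "'x topology \<Rightarrow> ('x \<Rightarrow> int) \<Rightarrow> bool" where
  "at_most_one_discontinuity X c \<longleftrightarrow>
     (\<exists>p. {x \<in> topspace X. \<not> topcontinuous_at X (discrete_topology UNIV) c x} \<subseteq> {p})"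

definition orbit_equivalence ::
    "'x topology \<Rightarrow> ('x \<Rightarrow> 'x) \<Rightarrow> 'y topology \<Rightarrow> ('y \<Rightarrow> 'y) \<Rightarrow> ('x \<Rightarrow> 'y) \<Rightarrow> bool" where
  "orbit_equivalence X T Y S \<phi> \<longleftrightarrow>
     homeomorphic_map X Y \<phi> \<and>
     (\<forall>x\<in>topspace X. \<phi> ` system_orbit X T x = system_orbit Y S (\<phi> x))"

definition strong_orbit_equivalence ::
    "'x topology \<Rightarrow> ('x \<Rightarrow> 'x) \<Rightarrow> 'y topology \<Rightarrow> ('y \<Rightarrow> 'y) \<Rightarrow> ('x \<Rightarrow> 'y) \<Rightarrow> bool" where
  "strong_orbit_equivalence X T Y S \<phi> \<longleftrightarrow>
     orbit_equivalence X T Y S \<phi> \<and>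
     (\<exists>\<theta> \<kappa>.
        (\<forall>x\<in>topspace X. \<phi> (T x) = int_iterate Y S (\<theta> x) (\<phi> x)) \<and>
        (\<forall>x\<in>topspace X. \<phi> (int_iterate X T (\<kappa> x) x) = S (\<phi> x)) \<and>
        at_most_one_discontinuity X \<theta> \<and> at_most_one_discontinuity X \<kappa>)"

section \<open>Eigenvalues\<close>

definition continuous_eigenfunction ::
    "'x topology \<Rightarrow> ('x \<Rightarrow> 'x) \<Rightarrow> complex \<Rightarrow> ('x \<Rightarrow> complex) \<Rightarrow> bool" where
  "continuous_eigenfunction X T z f \<longleftrightarrow>
     continuous_map X euclidean f \<and> (\<exists>x\<in>topspace X. f x \<noteq> 0) \<and>
     (\<forall>x\<in>topspace X. f (T x) = z * f x)"

definition continuous_eigenvalue :: "'x topology \<Rightarrow> ('x \<Rightarrow> 'x) \<Rightarrow> complex \<Rightarrow> bool" where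
  "continuous_eigenvalue X T z \<longleftrightarrow> (\<exists>f. continuous_eigenfunction X T z f)"

definition topologically_weakly_mixing :: "'x topology \<Rightarrow> ('x \<Rightarrow> 'x) \<Rightarrow> bool" where
  "topologically_weakly_mixing X T \<longleftrightarrow>
     (\<forall>z f. continuous_eigenfunction X T z f \<longrightarrow> (\<exists>c. \<forall>x\<in>topspace X. f x = c))"

definition irrational_phase :: "complex \<Rightarrow> bool" where
  "irrational_phase z \<longleftrightarrow>
     (\<exists>\<alpha>::real. \<alpha> \<notin> \<rat> \<and> z = exp (2 * \<i> * of_real pi * of_real \<alpha>))"

definition borel_on :: "'x topology \<Rightarrow> 'x measure" where
  "borel_on X = sigma (topspace X) {U. openin X U}"

definition invariant_probability ::
    "'x topology \<Rightarrow> ('x \<Rightarrow> 'x) \<Rightarrow> 'x measure \<Rightarrow> bool" where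
  "invariant_probability X T \<mu> \<longleftrightarrow>
     prob_space \<mu> \<and> space \<mu> = topspace X \<and> sets \<mu> = sets (borel_on X) \<and>
     T \<in> measurable \<mu> \<mu> \<and> distr \<mu> \<mu> T = \<mu>"

definition ergodic_probability ::
    "'x topology \<Rightarrow> ('x \<Rightarrow> 'x) \<Rightarrow> 'x measure \<Rightarrow> bool" where
  "ergodic_probability X T \<mu> \<longleftrightarrow>
     invariant_probability X T \<mu> \<and>
     (\<forall>A\<in>sets \<mu>. T -` A \<inter> space \<mu> = A \<longrightarrow> measure \<mu> A = 0 \<or> measure \<mu> A = 1)"

definition measure_eigenvalue :: "('x \<Rightarrow> 'x) \<Rightarrow> 'x measure \<Rightarrow> complex \<Rightarrow> bool" where
  "measure_eigenvalue T \<mu> z \<longleftrightarrow>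
     (\<exists>f. f \<in> borel_measurable \<mu> \<and> integrable \<mu> (\<lambda>x. (cmod (f x))\<^sup>2) \<and>
          \<not> (AE x in \<mu>. f x = 0) \<and> (AE x in \<mu>. f (T x) = z * f x))"

section \<open>Bratteli diagrams\<close>

text \<open>
  Level \<open>n\<close> has the vertices \<open>1, \<dots>, width D n\<close>, and \<open>edges D n\<close> is the set of edges
  from level \<open>n\<close> to level \<open>n + 1\<close>, usually written \<open>E\<^sub>n\<^sub>+\<^sub>1\<close>; \<open>src D n\<close> and \<open>rng D n\<close>
  are meaningful on \<open>edges D n\<close> only. All data carry their level explicitly, so levels are
  disjoint by tagging: the names in \<open>edges D m\<close> and \<open>edges D n\<close> may coincide.
\<close>

record 'e bratteli =
  width :: "nat \<Rightarrow> nat"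
  edges :: "nat \<Rightarrow> 'e set"
  src :: "nat \<Rightarrow> 'e \<Rightarrow> nat"
  rng :: "nat \<Rightarrow> 'e \<Rightarrow> nat"

record 'e ordered_bratteli = "'e bratteli" +
  edge_order :: "nat \<Rightarrow> 'e rel"

definition vertices :: "('e, 'z) bratteli_scheme \<Rightarrow> nat \<Rightarrow> nat set" where
  "vertices D n = {1..width D n}"

definition bratteli_diagram :: "('e, 'z) bratteli_scheme \<Rightarrow> bool" where
  "bratteli_diagram D \<longleftrightarrow>
     width D 0 = 1 \<and>
     (\<forall>n. finite (edges D n)) \<and>
     (\<forall>n. \<forall>e\<in>edges D n. src D n e \<in> vertices D n \<and> rng D n e \<in> vertices D (Suc n)) \<and>
     (\<forall>n. \<forall>v\<in>vertices D n. \<exists>e\<in>edges D n. src D n e = v) \<and>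
     (\<forall>n. \<forall>v\<in>vertices D (Suc n). \<exists>e\<in>edges D n. rng D n e = v)"

text \<open>\<open>incidence D n\<close> is the matrix \<open>M\<^sub>n\<^sub>+\<^sub>1\<close>, and \<open>incidence_prod D m k\<close> is
  \<open>P\<^sub>m\<^sub>,\<^sub>m\<^sub>+\<^sub>k\<close>.\<close>

definition incidence :: "('e, 'z) bratteli_scheme \<Rightarrow> nat \<Rightarrow> nat \<Rightarrow> nat \<Rightarrow> nat" where
  "incidence D n u v = card {e \<in> edges D n. src D n e = u \<and> rng D n e = v}"

primrec incidence_prod ::
    "('e, 'z) bratteli_scheme \<Rightarrow> nat \<Rightarrow> nat \<Rightarrow> nat \<Rightarrow> nat \<Rightarrow> nat" where
  "incidence_prod D m 0 u v = (if u = v then 1 else 0)"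
| "incidence_prod D m (Suc k) u v =
     (\<Sum>w\<in>vertices D (m + k). incidence_prod D m k u w * incidence D (m + k) w v)"

definition simple_diagram :: "('e, 'z) bratteli_scheme \<Rightarrow> bool" where
  "simple_diagram D \<longleftrightarrow>
     (\<forall>m\<ge>1. \<exists>n>m. \<forall>u\<in>vertices D m. \<forall>v\<in>vertices D n. incidence_prod D m (n - m) u v > 0)"

text \<open>Paths from level \<open>m\<close> to level \<open>n\<close>; the \<open>i\<close>-th entry goes from level \<open>m + i\<close> to
  level \<open>m + i + 1\<close>. The range \<open>fin_rng\<close> is meaningful for nonempty paths.\<close>

definition fin_paths :: "('e, 'z) bratteli_scheme \<Rightarrow> nat \<Rightarrow> nat \<Rightarrow> 'e list set" where
  "fin_paths D m n =
     {p. length p = n - m \<and> (\<forall>i<n - m. p ! i \<in> edges D (m + i)) \<and>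
         (\<forall>i. Suc i < n - m \<longrightarrow> rng D (m + i) (p ! i) = src D (Suc (m + i)) (p ! Suc i))}"

definition fin_rng :: "('e, 'z) bratteli_scheme \<Rightarrow> nat \<Rightarrow> 'e list \<Rightarrow> nat" where
  "fin_rng D n p = rng D (n - 1) (last p)"

definition height :: "('e, 'z) bratteli_scheme \<Rightarrow> nat \<Rightarrow> nat \<Rightarrow> nat" where
  "height D n u = card {p \<in> fin_paths D 0 n. fin_rng D n p = u}"

definition inf_paths :: "('e, 'z) bratteli_scheme \<Rightarrow> (nat \<Rightarrow> 'e) set" where
  "inf_paths D =
     {x. \<forall>n. x n \<in> edges D n \<and> rng D n (x n) = src D (Suc n) (x (Suc n))}"

definition path_space :: "('e, 'z) bratteli_scheme \<Rightarrow> (nat \<Rightarrow> 'e) topology" where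
  "path_space D =
     subtopology (product_topology (\<lambda>n. discrete_topology (edges D n)) UNIV) (inf_paths D)"

section \<open>Ordered Bratteli diagrams and the Vershik map\<close>

definition ordered_bratteli_diagram :: "'e ordered_bratteli \<Rightarrow> bool" where
  "ordered_bratteli_diagram B \<longleftrightarrow>
     bratteli_diagram B \<and>
     (\<forall>n. partial_order_on (edges B n) (edge_order B n)) \<and>
     (\<forall>n. \<forall>e\<in>edges B n. \<forall>f\<in>edges B n.
        (e, f) \<in> edge_order B n \<or> (f, e) \<in> edge_order B n \<longleftrightarrow> rng B n e = rng B n f)"

definition path_order :: "'e ordered_bratteli \<Rightarrow> nat \<Rightarrow> nat \<Rightarrow> 'e list rel" where
  "path_order B m n =
     {(p, q). p \<in> fin_paths B m n \<and> q \<in> fin_paths B m n \<and> fin_rng B n p = fin_rng B n q \<and>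
        (p = q \<or>
         (\<exists>i<n - m. p ! i \<noteq> q ! i \<and> (p ! i, q ! i) \<in> edge_order B (m + i) \<and>
            (\<forall>j. i < j \<and> j < n - m \<longrightarrow> p ! j = q ! j)))}"

definition max_edge :: "'e ordered_bratteli \<Rightarrow> nat \<Rightarrow> 'e \<Rightarrow> bool" where
  "max_edge B n e \<longleftrightarrow>
     e \<in> edges B n \<and> (\<forall>f\<in>edges B n. (e, f) \<in> edge_order B n \<longrightarrow> f = e)"

definition min_edge :: "'e ordered_bratteli \<Rightarrow> nat \<Rightarrow> 'e \<Rightarrow> bool" where
  "min_edge B n e \<longleftrightarrow>
     e \<in> edges B n \<and> (\<forall>f\<in>edges B n. (f, e) \<in> edge_order B n \<longrightarrow> f = e)"

definition max_path :: "'e ordered_bratteli \<Rightarrow> (nat \<Rightarrow> 'e) \<Rightarrow> bool" where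
  "max_path B x \<longleftrightarrow> x \<in> inf_paths B \<and> (\<forall>n. max_edge B n (x n))"

definition min_path :: "'e ordered_bratteli \<Rightarrow> (nat \<Rightarrow> 'e) \<Rightarrow> bool" where
  "min_path B x \<longleftrightarrow> x \<in> inf_paths B \<and> (\<forall>n. min_edge B n (x n))"

definition properly_ordered :: "'e ordered_bratteli \<Rightarrow> bool" where
  "properly_ordered B \<longleftrightarrow> (\<exists>!x. max_path B x) \<and> (\<exists>!x. min_path B x)"

definition edge_succ :: "'e ordered_bratteli \<Rightarrow> nat \<Rightarrow> 'e \<Rightarrow> 'e" where
  "edge_succ B n e =
     (THE f. (e, f) \<in> edge_order B n \<and> f \<noteq> e \<and>
        (\<forall>g. (e, g) \<in> edge_order B n \<and> g \<noteq> e \<longrightarrow> (f, g) \<in> edge_order B n))"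

definition min_fin_path :: "'e ordered_bratteli \<Rightarrow> nat \<Rightarrow> 'e list \<Rightarrow> bool" where
  "min_fin_path B n p \<longleftrightarrow>
     p \<in> fin_paths B 0 n \<and>
     (\<forall>q\<in>fin_paths B 0 n. fin_rng B n q = fin_rng B n p \<longrightarrow> (p, q) \<in> path_order B 0 n)"

text \<open>In the second case the requirement \<open>y \<in> inf_paths B\<close> forces the minimal initial
  segment of \<open>y\<close> to end at the source of the successor edge.\<close>

definition vershik :: "'e ordered_bratteli \<Rightarrow> (nat \<Rightarrow> 'e) \<Rightarrow> (nat \<Rightarrow> 'e)" where
  "vershik B x =
     (if max_path B x then (THE y. min_path B y)
      else (let n = (LEAST n. \<not> max_edge B n (x n)) in
        (THE y. y \<in> inf_paths B \<and> min_fin_path B n (map y [0..<n]) \<and>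
           y n = edge_succ B n (x n) \<and> (\<forall>k>n. y k = x k))))"

definition BV_representation ::
    "'e ordered_bratteli \<Rightarrow> 'x topology \<Rightarrow> ('x \<Rightarrow> 'x) \<Rightarrow> bool" where
  "BV_representation B X T \<longleftrightarrow>
     ordered_bratteli_diagram B \<and> properly_ordered B \<and> simple_diagram B \<and>
     (\<exists>h. conjugacy X T (path_space B) (vershik B) h)"

definition proper_BV_representation ::
    "'e ordered_bratteli \<Rightarrow> 'x topology \<Rightarrow> ('x \<Rightarrow> 'x) \<Rightarrow> bool" where
  "proper_BV_representation B X T \<longleftrightarrow>
     BV_representation B X T \<and>
     (\<forall>u\<in>vertices B 1. height B 1 u = 1) \<and>
     (\<forall>n\<ge>1. \<forall>u\<in>vertices B n. \<forall>v\<in>vertices B (Suc n). incidence B n u v > 0) \<and>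
     (\<forall>n\<ge>1. \<forall>e. max_edge B n e \<longrightarrow> src B n e = width B n)"

section \<open>Contractions and modifications of the local orders\<close>

definition contraction :: "'e ordered_bratteli \<Rightarrow> (nat \<Rightarrow> nat) \<Rightarrow> 'e list ordered_bratteli" where
  "contraction B l =
     \<lparr>width = (\<lambda>k. width B (l k)),
      edges = (\<lambda>k. fin_paths B (l k) (l (Suc k))),
      src = (\<lambda>k p. src B (l k) (hd p)),
      rng = (\<lambda>k p. fin_rng B (l (Suc k)) p),
      edge_order = (\<lambda>k. path_order B (l k) (l (Suc k)))\<rparr>"

definition order_modification :: "'e ordered_bratteli \<Rightarrow> 'e ordered_bratteli \<Rightarrow> bool" where
  "order_modification B C \<longleftrightarrow>
     ordered_bratteli_diagram C \<and> (\<exists>R. C = B\<lparr>edge_order := R\<rparr>)"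

text \<open>A contraction of a modification is a modification of a contraction, and, up to
  concatenation of paths, a contraction of a contraction is a contraction. So any finite
  succession of contractions and modifications amounts to one contraction followed by one
  modification.\<close>

definition contraction_modification ::
    "'e ordered_bratteli \<Rightarrow> (nat \<Rightarrow> nat) \<Rightarrow> 'e list ordered_bratteli \<Rightarrow> bool" where
  "contraction_modification B l C \<longleftrightarrow>
     strict_mono l \<and> l 0 = 0 \<and> order_modification (contraction B l) C"

text \<open>The natural identification of the infinite paths of a diagram with those of its
  contraction along \<open>l\<close>.\<close>

definition path_identification :: "(nat \<Rightarrow> nat) \<Rightarrow> (nat \<Rightarrow> 'e) \<Rightarrow> (nat \<Rightarrow> 'e list)" where
  "path_identification l x = (\<lambda>k. map x [l k..<l (Suc k)])"

text \<open>The measure on the path space of \<open>C\<close> giving to each cylinder the mass of the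
  corresponding cylinder, where \<open>h\<close> identifies the underlying space of \<open>\<mu>\<close> with the path
  space of the diagram contracted along \<open>l\<close>.\<close>

definition transported_measure ::
    "(nat \<Rightarrow> nat) \<Rightarrow> 'e list ordered_bratteli \<Rightarrow> ('x \<Rightarrow> nat \<Rightarrow> 'e) \<Rightarrow> 'x measure
       \<Rightarrow> (nat \<Rightarrow> 'e list) measure" where
  "transported_measure l C h \<mu> =
     distr \<mu> (borel_on (path_space C)) (\<lambda>x. path_identification l (h x))"

end

theory Submission
  imports Defs
begin

text \<open>
  Contract the diagram along a rapidly growing sequence and, at each level \<open>k\<close>, reorder
  the new edges with a given range only in an initial stretch of the tower, whose length depends
  on level \<open>k\<close> alone: there, the edges are sorted by their source. Extreme edges stay
  extreme, so the path spaces are identified by a strong orbit equivalence. The stretches have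
  summable measure for every invariant measure, so by Borel-Cantelli almost every point
  eventually avoids them; hence the difference of its levels in the old and the new towers is
  eventually constant and provides a transfer function between the two eigenvalue equations.
  A continuous eigenvalue \<open>exp (2 * \<i> * pi * \<alpha>)\<close> must send the return times of a small
  cylinder close to \<open>1\<close>. The sorted stretch contains long runs of equal sources, which
  force \<open>\<alpha>\<close> to be extremely close to one fraction \<open>\<beta>\<close> with all products of
  \<open>\<beta>\<close> and the tower heights integral; outside the stretch every source recurs with
  small gaps, so that the fraction found at the next level is again \<open>\<beta>\<close>. In the limit
  \<open>\<alpha> = \<beta>\<close> is rational.
\<close>

text \<open>The obstacle is that the reordering must be invisible to every invariant measure and yet
  felt by every continuous eigenfunction. Both are possible because a stretch of given length
  becomes negligible in a tower whose height is chosen afterwards, whereas a continuous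
  eigenfunction constrains every pair of edges with equal ends, however small the measure of the
  points using them. The length needed depends only on \<open>gap n\<close>, which bounds the
  distance from any time to a copy of a given tower of level \<open>n\<close>. At least
  \<open>2 * gap n + 1\<close> copies of each tower fit into the stretch; placed side by side, they
  leave \<open>\<alpha> * hgt B n u\<close> an error below \<open>1 / (16 * gap n)\<close>. As the
  heights are at most \<open>gap n\<close>, the nearest integers of any two vertices are then
  proportional to the heights, which is where the single fraction comes from. Carrying it to the
  next level needs no further sorting: steps of at most \<open>3 * gap n\<close> are too short to
  jump from one integer to another. The stretch leaves out time 0, so that the minimal edge stays
  first.\<close>

section \<open>Towers over an ordered Bratteli diagram\<close>

lemma key_prefix_sum_mono:
  fixes key :: "'p \<Rightarrow> nat" and w :: "'p \<Rightarrow> nat"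
  assumes "finite P" "q \<in> P" "p \<in> P" "key q < key p"
  shows "(\<Sum>g\<in>{g\<in>P. key g < key q}. w g) + w q \<le> (\<Sum>g\<in>{g\<in>P. key g < key p}. w g)"
proof -
  have "(\<Sum>g\<in>{g\<in>P. key g < key q}. w g) + w q = (\<Sum>g\<in>insert q {g\<in>P. key g < key q}. w g)"
    using assms(1) by (subst sum.insert) auto
  also have "\<dots> \<le> (\<Sum>g\<in>{g\<in>P. key g < key p}. w g)"
    using assms by (intro sum_mono2) auto
  finally show ?thesis .
qed

lemma key_prefix_sum_le:
  fixes key :: "'p \<Rightarrow> nat" and w :: "'p \<Rightarrow> nat"
  assumes "finite P" "p \<in> P"
  shows "(\<Sum>g\<in>{g\<in>P. key g < key p}. w g) + w p \<le> (\<Sum>g\<in>P. w g)"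
proof -
  have "(\<Sum>g\<in>{g\<in>P. key g < key p}. w g) + w p = (\<Sum>g\<in>insert p {g\<in>P. key g < key p}. w g)"
    using assms(1) by (subst sum.insert) auto
  also have "\<dots> \<le> (\<Sum>g\<in>P. w g)"
    using assms by (intro sum_mono2) auto
  finally show ?thesis .
qed

text \<open>Induction that adds the element with the largest key: a time is either below the old
  total or in the interval of the new element.\<close>

lemma key_prefix_sum_cover:
  fixes key :: "'p \<Rightarrow> nat" and w :: "'p \<Rightarrow> nat"
  assumes "finite P" "inj_on key P" "t < (\<Sum>g\<in>P. w g)"
  shows "\<exists>p\<in>P. (\<Sum>g\<in>{g\<in>P. key g < key p}. w g) \<le> t \<and>
           t < (\<Sum>g\<in>{g\<in>P. key g < key p}. w g) + w p"
  using assms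
proof (induction P rule: finite_ranking_induct[where f=key])
  case empty
  then show ?case by simp
next
  case (insert x S)
  show ?case
  \<comment> \<open>The induction rule does not exclude that \<open>x\<close> already belongs to
    \<open>S\<close>.\<close>
  proof (cases "x \<in> S")
    case True
    then have S: "insert x S = S" by auto
    show ?thesis using insert.IH insert.prems unfolding S by blast
  next
    case False
    have lt: "key y < key x" if "y \<in> S" for y
      using insert.hyps(2)[OF that] insert.prems(1) that False
      by (metis inj_onD insertCI le_neq_implies_less)
    have eq1: "{g \<in> insert x S. key g < key p} = {g \<in> S. key g < key p}" if "p \<in> S" for p
      using lt[OF that] by auto
    have eq2: "{g \<in> insert x S. key g < key x} = S"
      using lt by auto
    show ?thesis
    proof (cases "t < (\<Sum>g\<in>S. w g)")
      case True
      moreover have "inj_on key S" using insert.prems(1) by simp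
      ultimately obtain p where "p \<in> S" "(\<Sum>g\<in>{g\<in>S. key g < key p}. w g) \<le> t"
           "t < (\<Sum>g\<in>{g\<in>S. key g < key p}. w g) + w p" using insert.IH by blast
      then show ?thesis using eq1[of p] by (intro bexI[of _ p]) simp_all
    next
      case f: False
      then show ?thesis
        using insert.prems(2) insert.hyps(1) False
        by (intro bexI[of _ x], unfold eq2) (simp_all add: add.commute)
    qed
  qed
qed

text \<open>\<open>hgt D n v\<close> counts the paths from the root to \<open>v\<close>; \<open>off D n e\<close> is the first time at which
  the tower over the range of \<open>e\<close> passes through \<open>e\<close>, and \<open>pos D n x\<close> is the level of \<open>x\<close>
  in its tower at level \<open>n\<close>.\<close>

primrec hgt :: "('e, 'z) bratteli_scheme \<Rightarrow> nat \<Rightarrow> nat \<Rightarrow> nat" where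
  "hgt D 0 v = 1"
| "hgt D (Suc n) v = (\<Sum>e\<in>{e\<in>edges D n. rng D n e = v}. hgt D n (src D n e))"

definition off :: "'e ordered_bratteli \<Rightarrow> nat \<Rightarrow> 'e \<Rightarrow> nat" where
  "off D n e = (\<Sum>g\<in>{g\<in>edges D n. (g, e) \<in> edge_order D n \<and> g \<noteq> e}. hgt D n (src D n g))"

definition pos :: "'e ordered_bratteli \<Rightarrow> nat \<Rightarrow> (nat \<Rightarrow> 'e) \<Rightarrow> nat" where
  "pos D n x = (\<Sum>i<n. off D i (x i))"

text \<open>Entries below \<open>n\<close> are left free, so that a path is extended downwards by a
  function update and no index is ever shifted.\<close>

definition tail_path :: "('e, 'z) bratteli_scheme \<Rightarrow> nat \<Rightarrow> (nat \<Rightarrow> 'e) \<Rightarrow> bool" where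
  "tail_path D n y \<longleftrightarrow>
     (\<forall>i\<ge>n. y i \<in> edges D i \<and> rng D i (y i) = src D (Suc i) (y (Suc i)))"

lemma pos_Suc [simp]: "pos D (Suc n) x = pos D n x + off D n (x n)"
  and pos_0 [simp]: "pos D 0 x = 0"
  by (simp_all add: pos_def)

lemma pos_cong: "(\<And>i. i < n \<Longrightarrow> x i = y i) \<Longrightarrow> pos D n x = pos D n y"
  by (simp add: pos_def)

lemma pos_split:
  "m \<le> n \<Longrightarrow> pos D n x = pos D m x + (\<Sum>i=m..<n. off D i (x i))"
  unfolding pos_def lessThan_atLeast0 by (simp add: sum.atLeastLessThan_concat)

text \<open>Common entries contribute equally to both levels. Hence the time between two cofinal
  paths can be read off at any level beyond which they agree.\<close>

lemma pos_add_tail: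
  assumes "m \<le> n" "\<And>i. m \<le> i \<Longrightarrow> i < n \<Longrightarrow> x i = y i"
  shows "int (pos D n x) - int (pos D n y) = int (pos D m x) - int (pos D m y)"
proof -
  have "(\<Sum>i=m..<n. off D i (x i)) = (\<Sum>i=m..<n. off D i (y i))"
    using assms(2) by (intro sum.cong) auto
  then show ?thesis using pos_split[OF assms(1), of D x] pos_split[OF assms(1), of D y] by simp
qed

lemma inf_paths_iff_tail_path: "x \<in> inf_paths D \<longleftrightarrow> tail_path D 0 x"
  by (simp add: inf_paths_def tail_path_def)

lemma inf_paths_tail: "x \<in> inf_paths D \<Longrightarrow> tail_path D n x"
  by (simp add: inf_paths_def tail_path_def)

lemma tail_path_extend:
  assumes "tail_path D (Suc n) y" "e \<in> edges D n" "rng D n e = src D (Suc n) (y (Suc n))"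
  shows "tail_path D n (y(n := e))"
  using assms unfolding tail_path_def
  by (metis Suc_n_not_le_n fun_upd_apply le_Suc_eq le_antisym not_less_eq_eq)

section \<open>Edges into a vertex as intervals of time in its tower\<close>

locale obd =
  fixes D :: "'e ordered_bratteli"
  assumes obd: "ordered_bratteli_diagram D"
begin

lemma finite_edges [simp]: "finite (edges D n)"
  and src_vertex: "e \<in> edges D n \<Longrightarrow> src D n e \<in> vertices D n"
  and rng_vertex: "e \<in> edges D n \<Longrightarrow> rng D n e \<in> vertices D (Suc n)"
  and out_edge: "v \<in> vertices D n \<Longrightarrow> \<exists>e\<in>edges D n. src D n e = v"
  and in_edge: "v \<in> vertices D (Suc n) \<Longrightarrow> \<exists>e\<in>edges D n. rng D n e = v"
  and width_0: "width D 0 = 1"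
  using obd by (simp_all add: ordered_bratteli_diagram_def bratteli_diagram_def)

lemma ord_edges: "(e, f) \<in> edge_order D n \<Longrightarrow> e \<in> edges D n \<and> f \<in> edges D n"
  and ord_antisym: "(e, f) \<in> edge_order D n \<Longrightarrow> (f, e) \<in> edge_order D n \<Longrightarrow> e = f"
  and ord_trans: "(e, f) \<in> edge_order D n \<Longrightarrow> (f, g) \<in> edge_order D n \<Longrightarrow> (e, g) \<in> edge_order D n"
  and ord_refl: "e \<in> edges D n \<Longrightarrow> (e, e) \<in> edge_order D n"
  and ord_total: "e \<in> edges D n \<Longrightarrow> f \<in> edges D n \<Longrightarrow>
    ((e, f) \<in> edge_order D n \<or> (f, e) \<in> edge_order D n) = (rng D n e = rng D n f)"
proof -
  have p: "partial_order_on (edges D n) (edge_order D n)"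
    using obd by (simp add: ordered_bratteli_diagram_def)
  have sub: "edge_order D n \<subseteq> edges D n \<times> edges D n"
    and an: "antisym (edge_order D n)" and tr: "trans (edge_order D n)"
    and re: "refl_on (edges D n) (edge_order D n)"
    using p by (auto simp: partial_order_on_def preorder_on_def)
  show "(e, f) \<in> edge_order D n \<Longrightarrow> e \<in> edges D n \<and> f \<in> edges D n" using sub by auto
  show "(e, f) \<in> edge_order D n \<Longrightarrow> (f, e) \<in> edge_order D n \<Longrightarrow> e = f" using an by (meson antisymD)
  show "(e, f) \<in> edge_order D n \<Longrightarrow> (f, g) \<in> edge_order D n \<Longrightarrow> (e, g) \<in> edge_order D n"
    using tr by (meson transD)
  show "e \<in> edges D n \<Longrightarrow> (e, e) \<in> edge_order D n" using re by (meson refl_onD)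
  show "e \<in> edges D n \<Longrightarrow> f \<in> edges D n \<Longrightarrow>
    ((e, f) \<in> edge_order D n \<or> (f, e) \<in> edge_order D n) = (rng D n e = rng D n f)"
    using obd by (simp add: ordered_bratteli_diagram_def)
qed

lemma ord_rng: "(e, f) \<in> edge_order D n \<Longrightarrow> rng D n e = rng D n f"
  using ord_edges ord_total by blast

lemma vertices_nonempty: "vertices D n \<noteq> {}"
proof (induction n)
  case 0 show ?case by (simp add: vertices_def width_0)
next
  case (Suc n) then show ?case using out_edge rng_vertex by fast
qed

text \<open>Counting predecessors turns the local order into a numerical key, which makes
  \<open>off\<close> a prefix sum.\<close>

definition rank :: "nat \<Rightarrow> 'e \<Rightarrow> nat" where
  "rank n e = card {g\<in>edges D n. (g, e) \<in> edge_order D n \<and> g \<noteq> e}"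

lemma rank_less:
  assumes "(g, e) \<in> edge_order D n" "g \<noteq> e"
  shows "rank n g < rank n e"
proof -
  have "{h\<in>edges D n. (h, g) \<in> edge_order D n \<and> h \<noteq> g} \<subset> {h\<in>edges D n. (h, e) \<in> edge_order D n \<and> h \<noteq> e}"
  proof (intro psubsetI subsetI)
    show "h \<in> {h\<in>edges D n. (h, e) \<in> edge_order D n \<and> h \<noteq> e}"
      if "h \<in> {h\<in>edges D n. (h, g) \<in> edge_order D n \<and> h \<noteq> g}" for h
      using that assms ord_trans[of h g n e] ord_antisym[of g e n] by blast
    show "{h\<in>edges D n. (h, g) \<in> edge_order D n \<and> h \<noteq> g} \<noteq>
        {h\<in>edges D n. (h, e) \<in> edge_order D n \<and> h \<noteq> e}"
      using assms ord_edges[OF assms(1)] by blast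
  qed
  then show ?thesis unfolding rank_def by (intro psubset_card_mono) auto
qed

lemma rank_less_iff:
  assumes "g \<in> edges D n" "e \<in> edges D n" "rng D n g = rng D n e"
  shows "rank n g < rank n e \<longleftrightarrow> (g, e) \<in> edge_order D n \<and> g \<noteq> e"
  using rank_less ord_total[OF assms(1,2)] assms(3)
  by (metis less_asym less_irrefl)

lemma rank_inj: "inj_on (rank n) {e\<in>edges D n. rng D n e = v}"
  by (intro inj_onI) (metis (mono_tags, lifting) mem_Collect_eq less_irrefl ord_total rank_less)

lemma off_eq:
  assumes "e \<in> edges D n" "rng D n e = v"
  shows "off D n e = (\<Sum>g\<in>{g\<in>{g\<in>edges D n. rng D n g = v}. rank n g < rank n e}. hgt D n (src D n g))"
proof -
  have "{g\<in>edges D n. (g, e) \<in> edge_order D n \<and> g \<noteq> e} =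
    {g\<in>{g\<in>edges D n. rng D n g = v}. rank n g < rank n e}"
    (is "?L = ?R")
  proof (intro set_eqI)
    fix g
    show "g \<in> ?L \<longleftrightarrow> g \<in> ?R"
      using rank_less_iff[of g n e] ord_rng[of g e n] assms by (cases "rng D n g = v") auto
  qed
  then show ?thesis by (simp only: off_def)
qed

lemma off_less:
  assumes "(g, e) \<in> edge_order D n" "g \<noteq> e"
  shows "off D n g + hgt D n (src D n g) \<le> off D n e"
  using key_prefix_sum_mono[of "{h\<in>edges D n. rng D n h = rng D n e}" g e "rank n" "\<lambda>g. hgt D n (src D n g)"]
    ord_edges[OF assms(1)] ord_rng[OF assms(1)] rank_less[OF assms]
  by (simp add: off_eq)

lemma off_top:
  assumes "e \<in> edges D n"
  shows "off D n e + hgt D n (src D n e) \<le> hgt D (Suc n) (rng D n e)"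
  using key_prefix_sum_le[of "{h\<in>edges D n. rng D n h = rng D n e}" e "\<lambda>g. hgt D n (src D n g)" "rank n"] assms
  by (simp add: off_eq)

lemma off_cover:
  assumes "t < hgt D (Suc n) v"
  shows "\<exists>e\<in>edges D n. rng D n e = v \<and> off D n e \<le> t \<and> t < off D n e + hgt D n (src D n e)"
  using key_prefix_sum_cover[OF _ rank_inj, of n v t "\<lambda>g. hgt D n (src D n g)"] assms
  by (auto simp: off_eq)

lemma hgt_pos: "v \<in> vertices D n \<Longrightarrow> 0 < hgt D n v"
proof (induction n arbitrary: v)
  case (Suc n)
  then obtain e where e: "e \<in> edges D n" "rng D n e = v" using in_edge by blast
  then have "0 < hgt D n (src D n e)" using Suc.IH src_vertex by blast
  then show ?case using e off_top[OF e(1)] by simp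
qed simp

lemma off_unique:
  assumes "e \<in> edges D n" "f \<in> edges D n" "rng D n e = rng D n f"
    "off D n e \<le> t" "t < off D n e + hgt D n (src D n e)"
    "off D n f \<le> t" "t < off D n f + hgt D n (src D n f)"
  shows "e = f"
proof (rule ccontr)
  assume "e \<noteq> f"
  moreover have "(e, f) \<in> edge_order D n \<or> (f, e) \<in> edge_order D n"
    using ord_total[OF assms(1,2)] assms(3) by simp
  ultimately show False
    using off_less[of e f n] off_less[of f e n] assms(4-) by auto
qed

text \<open>Heights are positive, so distinct edges with the same range have distinct offsets and
  the order can be recovered from them.\<close>

lemma ord_iff_off:
  assumes "e \<in> edges D n" "f \<in> edges D n" "rng D n e = rng D n f"
  shows "(e, f) \<in> edge_order D n \<longleftrightarrow> off D n e \<le> off D n f"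
proof (cases "e = f")
  case False
  have "0 < hgt D n (src D n e)" "0 < hgt D n (src D n f)"
    using assms hgt_pos src_vertex by blast+
  moreover have "(e, f) \<in> edge_order D n \<or> (f, e) \<in> edge_order D n"
    using ord_total[OF assms(1,2)] assms(3) by simp
  ultimately show ?thesis
    using False off_less[of e f n] off_less[of f e n] ord_antisym[of e f n] by auto
qed (use assms ord_refl in auto)

lemma min_edge_iff: "min_edge D n e \<longleftrightarrow> e \<in> edges D n \<and> off D n e = 0"
proof (intro iffI conjI)
  assume m: "min_edge D n e"
  then show e: "e \<in> edges D n" by (simp add: min_edge_def)
  have "{g\<in>edges D n. (g, e) \<in> edge_order D n \<and> g \<noteq> e} = {}"
    using m by (auto simp: min_edge_def)
  then show "off D n e = 0" unfolding off_def by (metis sum.empty)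
next
  assume e: "e \<in> edges D n \<and> off D n e = 0"
  show "min_edge D n e"
    unfolding min_edge_def
  proof (intro conjI ballI impI)
    fix f assume f: "f \<in> edges D n" "(f, e) \<in> edge_order D n"
    then show "f = e" using off_less[OF f(2)] hgt_pos[OF src_vertex[OF f(1)]] e by auto
  qed (use e in simp)
qed

text \<open>If the interval of \<open>e\<close> ended below the top of the tower, the time at its
  end would be covered by a larger edge.\<close>

lemma max_edge_iff:
  "max_edge D n e \<longleftrightarrow> e \<in> edges D n \<and> off D n e + hgt D n (src D n e) = hgt D (Suc n) (rng D n e)"
proof (intro iffI conjI)
  assume m: "max_edge D n e"
  then show e: "e \<in> edges D n" by (simp add: max_edge_def)
  show "off D n e + hgt D n (src D n e) = hgt D (Suc n) (rng D n e)"
  proof (rule ccontr)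
    assume "\<not> ?thesis"
    then have "off D n e + hgt D n (src D n e) < hgt D (Suc n) (rng D n e)"
      using off_top[OF e] by simp
    then obtain f where f: "f \<in> edges D n" "rng D n f = rng D n e"
      "off D n f \<le> off D n e + hgt D n (src D n e)"
      "off D n e + hgt D n (src D n e) < off D n f + hgt D n (src D n f)"
      using off_cover by metis
    then have "(e, f) \<in> edge_order D n"
      using ord_iff_off[OF f(1) e] off_less[of f e n] ord_total[OF e f(1)] ord_refl[OF e] by auto
    then have "f = e" using m f by (auto simp: max_edge_def)
    then show False using f(4) by simp
  qed
next
  assume e: "e \<in> edges D n \<and> off D n e + hgt D n (src D n e) = hgt D (Suc n) (rng D n e)"
  show "max_edge D n e"
    unfolding max_edge_def
  proof (intro conjI ballI impI)
    fix f assume f: "f \<in> edges D n" "(e, f) \<in> edge_order D n"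
    have "0 < hgt D n (src D n f)" using f hgt_pos src_vertex by blast
    then show "f = e" using off_less[OF f(2)] off_top[OF f(1)] ord_rng[OF f(2)] e by auto
  qed (use e in simp)
qed

text \<open>The successor is found as the edge \<open>f\<close> whose interval covers the end of the
  interval of \<open>e\<close>; as the intervals are disjoint, it begins exactly there.\<close>

lemma edge_succ:
  assumes "e \<in> edges D n" "\<not> max_edge D n e"
  shows "edge_succ D n e \<in> edges D n \<and> rng D n (edge_succ D n e) = rng D n e \<and>
    off D n (edge_succ D n e) = off D n e + hgt D n (src D n e)"
proof -
  let ?t = "off D n e + hgt D n (src D n e)"
  have "?t < hgt D (Suc n) (rng D n e)"
    using assms max_edge_iff off_top[OF assms(1)] by (metis le_neq_implies_less)
  then obtain f where f: "f \<in> edges D n" "rng D n f = rng D n e" "off D n f \<le> ?t"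
      "?t < off D n f + hgt D n (src D n f)"
    using off_cover by metis
  have fe: "f \<noteq> e" using f(4) by auto
  have ef: "(e, f) \<in> edge_order D n"
    using f off_less[of f e n] fe ord_total[OF assms(1) f(1)] by auto
  have offf: "off D n f = ?t" using off_less[OF ef] fe f by auto
  have least: "(f, g) \<in> edge_order D n" if "(e, g) \<in> edge_order D n" "g \<noteq> e" for g
    using that off_less[OF that(1)] ord_edges[OF that(1)] ord_rng[OF that(1)] f offf ord_iff_off[of f n g] by auto
  have "edge_succ D n e = f"
    unfolding edge_succ_def
    by (rule the_equality) (use ef fe least ord_antisym in blast)+
  then show ?thesis using f offf by simp
qed

lemma pos_less: "x \<in> inf_paths D \<Longrightarrow> pos D n x < hgt D n (src D n (x n))"
proof (induction n)
  case (Suc n)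
  have "x n \<in> edges D n" "rng D n (x n) = src D (Suc n) (x (Suc n))"
    using Suc.prems by (auto simp: inf_paths_def)
  then show ?case using Suc off_top[of "x n" n] by simp
qed simp

text \<open>The intervals over a vertex are disjoint, so the time in a tower determines the last
  edge and, going down, the whole initial segment.\<close>

lemma pos_inj:
  assumes "x \<in> inf_paths D" "y \<in> inf_paths D" "src D n (x n) = src D n (y n)" "pos D n x = pos D n y"
  shows "\<forall>i<n. x i = y i"
  using assms(3,4)
proof (induction n)
  case (Suc n)
  have e: "x n \<in> edges D n" "y n \<in> edges D n" "rng D n (x n) = rng D n (y n)"
    using assms(1,2) Suc.prems by (auto simp: inf_paths_def)
  have "x n = y n"
    by (rule off_unique[OF e, of "pos D (Suc n) x"])
      (use Suc.prems pos_less[OF assms(1), of n] pos_less[OF assms(2), of n] in simp_all)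
  then show ?case using Suc by (auto simp: less_Suc_eq)
qed simp

lemma pos_inj_tail:
  assumes "x \<in> inf_paths D" "y \<in> inf_paths D" "\<And>i. i \<ge> n \<Longrightarrow> x i = y i" "pos D n x = pos D n y"
  shows "x = y"
  using pos_inj[OF assms(1,2), of n] assms(3,4) by (metis ext not_less order_refl)

text \<open>The edge whose interval covers \<open>t\<close> is put in front of the tail, and the
  remainder of \<open>t\<close> is a time in the tower over its source. Together with
  \<open>pos_inj\<close>, initial segments ending at a fixed vertex are coded by the times in its
  tower.\<close>

lemma pos_surj:
  assumes "tail_path D n y" "t < hgt D n (src D n (y n))"
  shows "\<exists>x\<in>inf_paths D. (\<forall>i\<ge>n. x i = y i) \<and> pos D n x = t"
  using assms
proof (induction n arbitrary: y t)
  case 0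
  then show ?case by (auto simp: inf_paths_iff_tail_path)
next
  case (Suc n)
  obtain e where e: "e \<in> edges D n" "rng D n e = src D (Suc n) (y (Suc n))"
     "off D n e \<le> t" "t < off D n e + hgt D n (src D n e)"
    using off_cover[OF Suc.prems(2)] by blast
  have tp: "tail_path D n (y(n := e))" using tail_path_extend[OF Suc.prems(1)] e by blast
  have "t - off D n e < hgt D n (src D n ((y(n := e)) n))" using e by simp
  from Suc.IH[OF tp this] obtain x where
    x: "x \<in> inf_paths D" "\<forall>i\<ge>n. x i = (y(n := e)) i" "pos D n x = t - off D n e"
    by blast
  then have "x n = e" by simp
  then show ?case using x e by (intro bexI[of _ x]) auto
qed

lemma pos_eq_0_iff:
  assumes "x \<in> inf_paths D"
  shows "pos D n x = 0 \<longleftrightarrow> (\<forall>i<n. min_edge D i (x i))"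
  using assms by (auto simp: pos_def min_edge_iff inf_paths_def)

lemma pos_max_iff:
  assumes "x \<in> inf_paths D"
  shows "Suc (pos D n x) = hgt D n (src D n (x n)) \<longleftrightarrow> (\<forall>i<n. max_edge D i (x i))"
proof (induction n)
  case (Suc n)
  have e: "x n \<in> edges D n" "rng D n (x n) = src D (Suc n) (x (Suc n))"
    using assms by (auto simp: inf_paths_def)
  have l: "pos D n x < hgt D n (src D n (x n))" using pos_less[OF assms] .
  show ?case
  proof
    assume a: "Suc (pos D (Suc n) x) = hgt D (Suc n) (src D (Suc n) (x (Suc n)))"
    then have "off D n (x n) + hgt D n (src D n (x n)) = hgt D (Suc n) (rng D n (x n))"
      "Suc (pos D n x) = hgt D n (src D n (x n))"
      using off_top[OF e(1)] l e(2) by auto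
    then show "\<forall>i<Suc n. max_edge D i (x i)" using Suc.IH e max_edge_iff by (auto simp: less_Suc_eq)
  next
    assume a: "\<forall>i<Suc n. max_edge D i (x i)"
    then have "off D n (x n) + hgt D n (src D n (x n)) = hgt D (Suc n) (rng D n (x n))"
      using max_edge_iff by blast
    then show "Suc (pos D (Suc n) x) = hgt D (Suc n) (src D (Suc n) (x (Suc n)))"
      using a Suc.IH e by auto
  qed
qed simp

lemma ex_tail_path:
  assumes "v \<in> vertices D n"
  shows "\<exists>y. tail_path D n y \<and> src D n (y n) = v"
proof -
  define step where "step i u = (SOME e. e \<in> edges D i \<and> src D i e = u)" for i u
  have step: "step i u \<in> edges D i \<and> src D i (step i u) = u" if "u \<in> vertices D i" for i u
    unfolding step_def using out_edge[OF that] by (rule_tac someI_ex) blast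
  \<comment> \<open>\<open>u k\<close> is the vertex at level \<open>n + k\<close> reached by always
    leaving along the chosen edge.\<close>
  define u where "u = rec_nat v (\<lambda>k w. rng D (n + k) (step (n + k) w))"
  have u: "u k \<in> vertices D (n + k)" for k
    by (induction k) (use assms step rng_vertex in \<open>auto simp: u_def\<close>)
  have uS: "u (Suc k) = rng D (n + k) (step (n + k) (u k))" for k by (simp add: u_def)
  define y where "y i = step i (u (i - n))" for i
  have "tail_path D n y"
    unfolding tail_path_def
  proof (intro allI impI)
    fix i assume "n \<le> i"
    then obtain k where i: "i = n + k" using le_Suc_ex by blast
    show "y i \<in> edges D i \<and> rng D i (y i) = src D (Suc i) (y (Suc i))"
      using step[OF u[of k]] step[OF u[of "Suc k"]] uS[of k] by (simp add: y_def i Suc_diff_le)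
  qed
  moreover have "src D n (y n) = v" using step[OF u[of 0]] by (simp add: y_def u_def)
  ultimately show ?thesis by blast
qed

end

section \<open>The Vershik map and its orbits\<close>

text \<open>Trades integer iterates, which involve the inverse map, for equations between forward
  iterates; orbits and cocycles are handled in that form from here on.\<close>

lemma int_iterate_diff_eq_iff:
  assumes T: "bij_betw T (topspace X) (topspace X)" and x: "x \<in> topspace X" and y: "y \<in> topspace X"
  shows "int_iterate X T (int a - int b) x = y \<longleftrightarrow> (T ^^ a) x = (T ^^ b) y"
proof -
  let ?S = "topspace X" and ?I = "inv_into (topspace X) T"
  have in1: "(T ^^ n) z \<in> ?S" if "z \<in> ?S" for n z
    using that bij_betwE[OF T] by (induction n) auto
  have in2: "(?I ^^ n) z \<in> ?S" if "z \<in> ?S" for n z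
    using that bij_betwE[OF bij_betw_inv_into[OF T]] by (induction n) auto
  have inj: "(T ^^ n) z = (T ^^ n) w \<longleftrightarrow> z = w" if "z \<in> ?S" "w \<in> ?S" for n z w
    by (induction n) (use that in1 in \<open>auto dest: inj_onD[OF bij_betw_imp_inj_on[OF T]]\<close>)
  have TI: "(T ^^ n) ((?I ^^ n) z) = z" if "z \<in> ?S" for n z
  proof (induction n)
    case (Suc n)
    have "(T ^^ Suc n) ((?I ^^ Suc n) z) = (T ^^ n) (T (?I ((?I ^^ n) z)))"
      by (simp add: funpow_swap1)
    also have "\<dots> = z" using Suc bij_betw_inv_into_right[OF T in2[OF that]] by simp
    finally show ?case .
  qed simp
  show ?thesis
  proof (cases "b \<le> a")
    case True
    then have "(T ^^ a) x = (T ^^ b) ((T ^^ (a - b)) x)"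
      by (metis comp_apply funpow_add le_add_diff_inverse)
    moreover have "int_iterate X T (int a - int b) x = (T ^^ (a - b)) x"
    proof -
      have "nat (int a - int b) = a - b" by arith
      then show ?thesis using True by (simp add: int_iterate_def)
    qed
    ultimately show ?thesis using inj[OF in1[OF x] y] by simp
  next
    case False
    then have "(T ^^ b) y = (T ^^ a) ((T ^^ (b - a)) y)"
      by (metis comp_apply funpow_add le_add_diff_inverse nat_le_linear)
    moreover have "int_iterate X T (int a - int b) x = (?I ^^ (b - a)) x"
    proof -
      have "nat (- (int a - int b)) = b - a" "\<not> 0 \<le> int a - int b" using False by arith+
      then show ?thesis unfolding int_iterate_def by (simp only: if_False)
    qed
    moreover have "(?I ^^ (b - a)) x = y \<longleftrightarrow> x = (T ^^ (b - a)) y"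
      using TI[OF x] inj[OF in2[OF x] y] by metis
    ultimately show ?thesis using inj[OF x in1[OF y]] by simp
  qed
qed

lemma system_orbit_iff:
  assumes "bij_betw T (topspace X) (topspace X)" "x \<in> topspace X" "y \<in> topspace X"
  shows "y \<in> system_orbit X T x \<longleftrightarrow> (\<exists>a b. (T ^^ a) x = (T ^^ b) y)"
proof
  assume "y \<in> system_orbit X T x"
  then obtain k where k: "y = int_iterate X T k x" by (auto simp: system_orbit_def)
  obtain a b where "k = int a - int b" using int_diff_cases by blast
  then show "\<exists>a b. (T ^^ a) x = (T ^^ b) y" using k int_iterate_diff_eq_iff[OF assms, of a b] by blast
next
  assume "\<exists>a b. (T ^^ a) x = (T ^^ b) y"
  then obtain a b where "int_iterate X T (int a - int b) x = y"
    using int_iterate_diff_eq_iff[OF assms] by blast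
  then show "y \<in> system_orbit X T x" by (auto simp: system_orbit_def)
qed

lemma system_orbit_subset:
  assumes "bij_betw T (topspace X) (topspace X)" "x \<in> topspace X"
  shows "system_orbit X T x \<subseteq> topspace X"
proof -
  have "(T ^^ n) x \<in> topspace X" for n
    using assms(2) bij_betwE[OF assms(1)] by (induction n) auto
  moreover have "(inv_into (topspace X) T ^^ n) x \<in> topspace X" for n
    using assms(2) bij_betwE[OF bij_betw_inv_into[OF assms(1)]] by (induction n) auto
  ultimately show ?thesis by (auto simp: system_orbit_def int_iterate_def)
qed

lemma funpow_meet_trans:
  fixes f :: "'a \<Rightarrow> 'a"
  assumes "\<exists>a b. (f ^^ a) u = (f ^^ b) v" "\<exists>a b. (f ^^ a) v = (f ^^ b) w"
  shows "\<exists>a b. (f ^^ a) u = (f ^^ b) w"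
proof -
  obtain a b where 1: "(f ^^ a) u = (f ^^ b) v" using assms(1) by blast
  obtain c d where 2: "(f ^^ c) v = (f ^^ d) w" using assms(2) by blast
  have "(f ^^ (c + a)) u = (f ^^ c) ((f ^^ b) v)" using 1 by (simp add: funpow_add)
  also have "\<dots> = (f ^^ (c + b)) v" by (simp add: funpow_add)
  also have "\<dots> = (f ^^ (b + c)) v" by (simp add: add.commute)
  also have "\<dots> = (f ^^ (b + d)) w" using 2 by (simp add: funpow_add)
  finally show ?thesis by blast
qed

lemma map_tail_path_fin_paths:
  "tail_path D m x \<Longrightarrow> map x [m..<n] \<in> fin_paths D m n"
  by (auto simp: fin_paths_def tail_path_def)

lemma fin_rng_map: "m < n \<Longrightarrow> fin_rng D n (map x [m..<n]) = rng D (n - 1) (x (n - 1))"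
  by (simp add: fin_rng_def last_map)

definition tail_eq :: "(nat \<Rightarrow> 'a) \<Rightarrow> (nat \<Rightarrow> 'a) \<Rightarrow> bool" where
  "tail_eq x y \<longleftrightarrow> (\<exists>n. \<forall>i\<ge>n. x i = y i)"

lemma tail_eq_refl [simp]: "tail_eq x x"
  by (simp add: tail_eq_def)

lemma tail_eq_sym: "tail_eq x y \<Longrightarrow> tail_eq y x"
  unfolding tail_eq_def by metis

lemma tail_eq_trans: "tail_eq x y \<Longrightarrow> tail_eq y z \<Longrightarrow> tail_eq x z"
  unfolding tail_eq_def by (metis max.bounded_iff)

context obd
begin

text \<open>The path order looks at the last difference only. If all edges are minimal, the edge at
  that place is smaller than its competitor; conversely, the path at time 0 of the same tower is
  itself a competitor.\<close>

lemma min_fin_path_iff: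
  assumes y: "y \<in> inf_paths D"
  shows "min_fin_path D n (map y [0..<n]) \<longleftrightarrow> (\<forall>i<n. min_edge D i (y i))"
proof
  assume m: "\<forall>i<n. min_edge D i (y i)"
  let ?p = "map y [0..<n]"
  have p: "?p \<in> fin_paths D 0 n" using map_tail_path_fin_paths[OF inf_paths_tail[OF y]] .
  show "min_fin_path D n ?p"
    unfolding min_fin_path_def
  proof (intro conjI ballI impI)
    fix q assume q: "q \<in> fin_paths D 0 n" and r: "fin_rng D n q = fin_rng D n ?p"
    show "(?p, q) \<in> path_order D 0 n"
    proof (cases "?p = q")
      case True then show ?thesis using p q by (simp add: path_order_def)
    next
      case False
      have lq: "length q = n" using q by (simp add: fin_paths_def)
      \<comment> \<open>The largest element of \<open>A\<close> is the position that decides the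
        path order.\<close>
      define A where "A = {i. i < n \<and> ?p ! i \<noteq> q ! i}"
      have "A \<noteq> {}" using False lq by (auto simp: A_def intro: nth_equalityI)
      have fA: "finite A" by (simp add: A_def)
      define i where "i = Max A"
      have iA: "i \<in> A" using Max_in[OF fA \<open>A \<noteq> {}\<close>] by (simp add: i_def)
      then have i: "i < n" "y i \<noteq> q ! i" by (auto simp: A_def)
      have later: "?p ! j = q ! j" if "i < j" "j < n" for j
      proof (rule ccontr)
        assume "?p ! j \<noteq> q ! j"
        then have "j \<in> A" using that by (simp add: A_def)
        then show False using Max_ge[OF fA, of j] that by (simp add: i_def)
      qed
      have eE: "y i \<in> edges D i" "q ! i \<in> edges D i"
        using y q i by (auto simp: inf_paths_def fin_paths_def)
      \<comment> \<open>Either both paths continue with the same edge, or \<open>i\<close> is the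
        last position and the end vertices agree by \<open>r\<close>.\<close>
      have "rng D i (y i) = rng D i (q ! i)"
      proof (cases "Suc i < n")
        case True
        then have "rng D i (q ! i) = src D (Suc i) (q ! Suc i)" using q by (simp add: fin_paths_def)
        moreover have "rng D i (y i) = src D (Suc i) (y (Suc i))" using y by (simp add: inf_paths_def)
        moreover have "y (Suc i) = q ! Suc i" using later[of "Suc i"] True by simp
        ultimately show ?thesis by simp
      next
        case False
        then have n: "n = Suc i" using i by simp
        then have "last q = q ! i" using lq by (cases q) (auto simp: last_conv_nth)
        then show ?thesis using r n by (simp add: fin_rng_def)
      qed
      then have "(y i, q ! i) \<in> edge_order D i"
      proof -
        assume r: "rng D i (y i) = rng D i (q ! i)"
        have "min_edge D i (y i)" using m i by blast
        then have "(q ! i, y i) \<in> edge_order D i \<Longrightarrow> q ! i = y i"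
          using eE(2) by (simp add: min_edge_def)
        then show ?thesis using ord_total[OF eE] r i(2) by auto
      qed
      then show ?thesis using p q r i later
        by (auto simp: path_order_def intro!: exI[of _ i])
    qed
  qed (rule p)
next
  assume m: "min_fin_path D n (map y [0..<n])"
  have "src D n (y n) \<in> vertices D n" using y src_vertex by (auto simp: inf_paths_def)
  \<comment> \<open>\<open>z\<close> has the tail of \<open>y\<close> but sits at the bottom of the
    tower, so its edges below \<open>n\<close> are minimal.\<close>
  then obtain z where z: "z \<in> inf_paths D" "\<forall>i\<ge>n. z i = y i" "pos D n z = 0"
    using pos_surj[OF inf_paths_tail[OF y], of 0 n] hgt_pos by metis
  have zmin: "\<forall>i<n. min_edge D i (z i)" using pos_eq_0_iff[OF z(1)] z(3) by simp
  show "\<forall>i<n. min_edge D i (y i)"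
  proof (cases "n = 0")
    case False
    have "rng D (n - 1) (z (n - 1)) = src D n (z n)" "rng D (n - 1) (y (n - 1)) = src D n (y n)"
      using z(1) y False by (auto simp: inf_paths_def)
    then have "fin_rng D n (map z [0..<n]) = fin_rng D n (map y [0..<n])"
      using False z(2) by (simp add: fin_rng_map)
    then have "(map y [0..<n], map z [0..<n]) \<in> path_order D 0 n"
      using m map_tail_path_fin_paths[OF inf_paths_tail[OF z(1)]] unfolding min_fin_path_def by blast
    then consider "map y [0..<n] = map z [0..<n]"
      | i where "i < n" "y i \<noteq> z i" "(y i, z i) \<in> edge_order D i"
      by (auto simp: path_order_def)
    then show ?thesis
    proof cases
      case 1 then show ?thesis using zmin by auto
    next
      case 2
      then have "y i = z i" using zmin y by (auto simp: min_edge_def inf_paths_def)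
      with 2 show ?thesis by simp
    qed
  qed simp
qed

text \<open>In tower coordinates the Vershik map adds 1 to the time. At the first non-maximal
  position \<open>m\<close>, the path is at the top of its tower of level \<open>m\<close>; one more
  unit of time leads to the bottom of the interval of the successor edge, which is what the
  definition prescribes.\<close>

lemma vershik_step:
  assumes x: "x \<in> inf_paths D" and y: "y \<in> inf_paths D"
    and tl: "\<And>i. i \<ge> n \<Longrightarrow> y i = x i" and ps: "pos D n y = Suc (pos D n x)"
  shows "vershik D x = y" and "\<not> max_path D x" and "\<exists>i<n. \<not> max_edge D i (x i)"
proof -
  have "\<not> (\<forall>i<n. max_edge D i (x i))"
    using pos_max_iff[OF x, of n] pos_less[OF y, of n] tl[of n] ps by simp
  then show ex: "\<exists>i<n. \<not> max_edge D i (x i)" by blast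
  then show nm: "\<not> max_path D x" by (auto simp: max_path_def)
  define m where "m = (LEAST i. \<not> max_edge D i (x i))"
  have m: "\<not> max_edge D m (x m)" using ex unfolding m_def by (metis (mono_tags, lifting) LeastI_ex)
  have mn: "m < n" using ex unfolding m_def by (metis (mono_tags, lifting) Least_le le_less_trans)
  have lm: "\<forall>i<m. max_edge D i (x i)" unfolding m_def using not_less_Least by blast
  have xm: "x m \<in> edges D m" "rng D m (x m) = src D (Suc m) (x (Suc m))"
    using x by (auto simp: inf_paths_def)
  let ?s = "edge_succ D m (x m)"
  note s = edge_succ[OF xm(1) m]
  have px: "Suc (pos D m x) = hgt D m (src D m (x m))" using pos_max_iff[OF x] lm by blast
  \<comment> \<open>Below \<open>m\<close> the path is at the top of its tower, so the offset of the
    successor edge is exactly one unit after the time of \<open>x\<close>.\<close>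
  then have offs: "off D m ?s = Suc (pos D (Suc m) x)" using s by simp
  \<comment> \<open>Any candidate that agrees with \<open>x\<close> beyond \<open>m\<close> and is
    one unit later must be \<open>y\<close>; this serves both existence and uniqueness in the
    definite description.\<close>
  have charz: "z = y" if z: "z \<in> inf_paths D" "\<forall>k>m. z k = x k" "pos D (Suc m) z = Suc (pos D (Suc m) x)" for z
  proof (rule pos_inj_tail[OF z(1) y, of n])
    show "z i = y i" if "i \<ge> n" for i using that mn z(2) tl by auto
    have "int (pos D n z) - int (pos D n x) = int (pos D (Suc m) z) - int (pos D (Suc m) x)"
      by (rule pos_add_tail) (use mn z(2) in auto)
    then show "pos D n z = pos D n y" using z(3) ps by simp
  qed
  have "Suc (pos D (Suc m) x) < hgt D (Suc m) (src D (Suc m) (x (Suc m)))"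
    using pos_max_iff[OF x, of "Suc m"] pos_less[OF x, of "Suc m"] m by (metis Suc_lessI lessI)
  then obtain y' where y': "y' \<in> inf_paths D" "\<forall>i\<ge>Suc m. y' i = x i" "pos D (Suc m) y' = Suc (pos D (Suc m) x)"
    using pos_surj[OF inf_paths_tail[OF x]] by meson
  have "y' = y" using charz y' by simp
  then have y2: "\<forall>k>m. y k = x k" "pos D (Suc m) y = off D m ?s" using y' offs by auto
  have ym: "y m \<in> edges D m" "rng D m (y m) = rng D m ?s"
    using y y2(1) xm s by (auto simp: inf_paths_def)
  have "0 < hgt D m (src D m ?s)" using s hgt_pos src_vertex by blast
  then have yms: "y m = ?s"
    using off_unique[OF ym(1) _ ym(2), of "pos D (Suc m) y"] s pos_less[OF y, of m] y2(2) by simp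
  then have "pos D m y = 0" using y2(2) by simp
  then have good: "y \<in> inf_paths D \<and> min_fin_path D m (map y [0..<m]) \<and> y m = ?s \<and> (\<forall>k>m. y k = x k)"
    using y y2(1) yms min_fin_path_iff[OF y] pos_eq_0_iff[OF y] by simp
  have "(THE y. y \<in> inf_paths D \<and> min_fin_path D m (map y [0..<m]) \<and> y m = ?s \<and> (\<forall>k>m. y k = x k)) = y"
  proof (rule the_equality)
    show "y \<in> inf_paths D \<and> min_fin_path D m (map y [0..<m]) \<and> y m = ?s \<and> (\<forall>k>m. y k = x k)"
      by (rule good)
  next
    fix z assume z: "z \<in> inf_paths D \<and> min_fin_path D m (map z [0..<m]) \<and> z m = ?s \<and> (\<forall>k>m. z k = x k)"
    then have "pos D m z = 0" using min_fin_path_iff pos_eq_0_iff by blast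
    then show "z = y" using z offs by (intro charz) auto
  qed
  then show "vershik D x = y" unfolding vershik_def using nm by (simp add: Let_def m_def)
qed

lemma vershik_nonmax:
  assumes x: "x \<in> inf_paths D" and n: "\<exists>i<n. \<not> max_edge D i (x i)"
  shows "vershik D x \<in> inf_paths D \<and> (\<forall>i\<ge>n. vershik D x i = x i) \<and>
    pos D n (vershik D x) = Suc (pos D n x)"
proof -
  have "Suc (pos D n x) < hgt D n (src D n (x n))"
    using pos_max_iff[OF x, of n] pos_less[OF x, of n] n by (metis Suc_lessI)
  then obtain y where y: "y \<in> inf_paths D" "\<forall>i\<ge>n. y i = x i" "pos D n y = Suc (pos D n x)"
    using pos_surj[OF inf_paths_tail[OF x]] by meson
  then have "vershik D x = y" using vershik_step(1)[OF x y(1)] by blast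
  then show ?thesis using y by simp
qed

lemma vershik_funpow:
  assumes "x \<in> inf_paths D" "y \<in> inf_paths D" "\<And>i. i \<ge> n \<Longrightarrow> y i = x i" "pos D n y = pos D n x + d"
  shows "(vershik D ^^ d) x = y"
  using assms
proof (induction d arbitrary: y)
  case 0
  then show ?case using pos_inj_tail[of x y n] by simp
next
  case (Suc d)
  have "pos D n x + d < hgt D n (src D n (x n))"
    using pos_less[OF Suc.prems(2), of n] Suc.prems(3)[of n] Suc.prems(4) by simp
  then obtain z where z: "z \<in> inf_paths D" "\<forall>i\<ge>n. z i = x i" "pos D n z = pos D n x + d"
    using pos_surj[OF inf_paths_tail[OF Suc.prems(1)]] by meson
  have "(vershik D ^^ d) x = z" using Suc.IH[OF Suc.prems(1) z(1)] z by blast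
  moreover have "vershik D z = y"
    using vershik_step(1)[OF z(1) Suc.prems(2), of n] z Suc.prems by simp
  ultimately show ?case by simp
qed

text \<open>Whichever path has the lower level is moved up to the other; two natural exponents
  replace a signed one.\<close>

lemma vershik_funpow_diff:
  assumes "x \<in> inf_paths D" "y \<in> inf_paths D" "\<And>i. i \<ge> n \<Longrightarrow> y i = x i"
  shows "\<exists>a b. (vershik D ^^ a) x = (vershik D ^^ b) y \<and> int a - int b = int (pos D n y) - int (pos D n x)"
proof (cases "pos D n x \<le> pos D n y")
  case True
  then have "(vershik D ^^ (pos D n y - pos D n x)) x = (vershik D ^^ 0) y"
    using vershik_funpow[OF assms] by simp
  then show ?thesis using True by (intro exI conjI) (assumption, simp)
next
  case False
  then have "(vershik D ^^ 0) x = (vershik D ^^ (pos D n x - pos D n y)) y"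
    using vershik_funpow[OF assms(2,1), of n] assms(3) by simp
  then show ?thesis using False by (intro exI conjI) (assumption, simp)
qed

end

section \<open>Proper orders: bijectivity and orbits of the Vershik map\<close>

locale proper_obd = obd +
  assumes properly: "properly_ordered D"
begin

definition xmax where "xmax = (THE x. max_path D x)"
definition xmin where "xmin = (THE x. min_path D x)"

lemma max_path_iff [simp]: "max_path D x \<longleftrightarrow> x = xmax"
  using properly theI'[of "max_path D"] unfolding properly_ordered_def xmax_def by blast

lemma min_path_iff [simp]: "min_path D x \<longleftrightarrow> x = xmin"
  using properly theI'[of "min_path D"] unfolding properly_ordered_def xmin_def by blast

lemma xmax_inf [simp]: "xmax \<in> inf_paths D"
  using max_path_iff[of xmax] unfolding max_path_def by blast

lemma xmin_inf [simp]: "xmin \<in> inf_paths D"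
  using min_path_iff[of xmin] unfolding min_path_def by blast

lemma vershik_xmax [simp]: "vershik D xmax = xmin"
  unfolding vershik_def xmin_def by simp

lemma eq_xmax_iff: "x \<in> inf_paths D \<Longrightarrow> x = xmax \<longleftrightarrow> (\<forall>n. max_edge D n (x n))"
  using max_path_iff[of x] unfolding max_path_def by blast

lemma eq_xmin_iff: "x \<in> inf_paths D \<Longrightarrow> x = xmin \<longleftrightarrow> (\<forall>n. min_edge D n (x n))"
  using min_path_iff[of x] unfolding min_path_def by blast

lemma pos_xmin: "pos D n xmin = 0"
  using pos_eq_0_iff[OF xmin_inf] eq_xmin_iff[OF xmin_inf] by simp

lemma ex_nonmax: "x \<in> inf_paths D \<Longrightarrow> x \<noteq> xmax \<Longrightarrow> \<exists>n. \<exists>i<n. \<not> max_edge D i (x i)"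
  using eq_xmax_iff[of x] by blast

lemma vershik_inf [simp]: "x \<in> inf_paths D \<Longrightarrow> vershik D x \<in> inf_paths D"
  using vershik_nonmax[of x] ex_nonmax[of x] vershik_xmax xmin_inf by metis

lemma vershik_eventually:
  assumes "x \<in> inf_paths D" "x \<noteq> xmax"
  shows "\<exists>n. \<forall>k\<ge>n. (\<forall>i\<ge>k. vershik D x i = x i) \<and> pos D k (vershik D x) = Suc (pos D k x)"
proof -
  obtain n i where "i < n" "\<not> max_edge D i (x i)" using ex_nonmax[OF assms] by blast
  then show ?thesis using vershik_nonmax[OF assms(1)] by (meson less_le_trans)
qed

text \<open>\<open>xmin\<close> is at time 0 in every tower, whereas a step from any other point
  than \<open>xmax\<close> ends at a positive time in all high towers.\<close>

lemma vershik_neq_xmin: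
  assumes "x \<in> inf_paths D" "x \<noteq> xmax"
  shows "vershik D x \<noteq> xmin"
  using vershik_eventually[OF assms] pos_xmin by (metis nat.distinct(1) order_refl)

lemma vershik_bij: "bij_betw (vershik D) (inf_paths D) (inf_paths D)"
  unfolding bij_betw_def
proof (intro conjI inj_onI equalityI subsetI)
  fix x y assume x: "x \<in> inf_paths D" and y: "y \<in> inf_paths D" and e: "vershik D x = vershik D y"
  show "x = y"
  proof (cases "x = xmax \<or> y = xmax")
    case True
    then show ?thesis
      using vershik_neq_xmin[OF x] vershik_neq_xmin[OF y] e vershik_xmax by metis
  next
    case False
    obtain n where
      n: "\<forall>k\<ge>n. (\<forall>i\<ge>k. vershik D x i = x i) \<and> pos D k (vershik D x) = Suc (pos D k x)"
      using vershik_eventually[OF x] False by blast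
    obtain m where
      m: "\<forall>k\<ge>m. (\<forall>i\<ge>k. vershik D y i = y i) \<and> pos D k (vershik D y) = Suc (pos D k y)"
      using vershik_eventually[OF y] False by blast
    show ?thesis
    proof (rule pos_inj_tail[OF x y, of "max n m"])
      show "x i = y i" if "i \<ge> max n m" for i
      proof -
        have "vershik D x i = x i" "vershik D y i = y i" using n m that by auto
        then show ?thesis using e by simp
      qed
      have "pos D (max n m) (vershik D x) = Suc (pos D (max n m) x)"
        "pos D (max n m) (vershik D y) = Suc (pos D (max n m) y)" using n m by auto
      then show "pos D (max n m) x = pos D (max n m) y" using e by simp
    qed
  qed
next
  fix y assume y: "y \<in> inf_paths D"
  show "y \<in> vershik D ` inf_paths D"
  proof (cases "y = xmin")
    case True then show ?thesis using vershik_xmax xmax_inf by (metis imageI)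
  next
    case False
    then obtain n where n: "\<not> min_edge D n (y n)" using eq_xmin_iff[OF y] by blast
    then have p: "pos D (Suc n) y \<noteq> 0" using pos_eq_0_iff[OF y, of "Suc n"] by auto
    \<comment> \<open>The preimage is the path with the same tail one unit of time earlier, in a
      tower where \<open>y\<close> has positive time.\<close>
    have "pos D (Suc n) y - 1 < hgt D (Suc n) (src D (Suc n) (y (Suc n)))"
      using pos_less[OF y, of "Suc n"] by simp
    then obtain x where "x \<in> inf_paths D" "\<forall>i\<ge>Suc n. x i = y i" "pos D (Suc n) x = pos D (Suc n) y - 1"
      using pos_surj[OF inf_paths_tail[OF y]] by meson
    then have "x \<in> inf_paths D" "vershik D x = y" using vershik_step(1)[of x y "Suc n"] y p by auto
    then show ?thesis by blast
  qed
qed auto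

text \<open>Orbits are cofinality classes, except that the classes of \<open>xmax\<close> and
  \<open>xmin\<close> are joined into one. This description depends on the order only through the
  two extreme paths, so it survives any reordering that keeps them.\<close>

definition orbit_rel where
  "orbit_rel x y \<longleftrightarrow> tail_eq x y \<or>
     (tail_eq x xmax \<or> tail_eq x xmin) \<and> (tail_eq y xmax \<or> tail_eq y xmin)"

lemma orbit_rel_sym: "orbit_rel x y \<Longrightarrow> orbit_rel y x"
  unfolding orbit_rel_def using tail_eq_sym by blast

lemma orbit_rel_trans: "orbit_rel x y \<Longrightarrow> orbit_rel y z \<Longrightarrow> orbit_rel x z"
  unfolding orbit_rel_def using tail_eq_sym tail_eq_trans by blast

lemma orbit_rel_vershik:
  assumes "x \<in> inf_paths D" shows "orbit_rel x ((vershik D ^^ n) x)"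
proof (induction n)
  case 0 show ?case by (simp add: orbit_rel_def)
next
  case (Suc n)
  have *: "orbit_rel y (vershik D y)" if "y \<in> inf_paths D" for y
  proof (cases "y = xmax")
    case False
    then have "tail_eq y (vershik D y)"
      using vershik_eventually[OF that] unfolding tail_eq_def by metis
    then show ?thesis by (simp add: orbit_rel_def)
  qed (simp add: orbit_rel_def)
  have "(vershik D ^^ n) x \<in> inf_paths D" by (induction n) (use assms in auto)
  from *[OF this] Suc show ?case using orbit_rel_trans by simp
qed

lemma tail_eq_funpow:
  assumes "x \<in> inf_paths D" "y \<in> inf_paths D" "tail_eq x y"
  shows "\<exists>a b. (vershik D ^^ a) x = (vershik D ^^ b) y"
proof -
  obtain n where "\<forall>i\<ge>n. x i = y i" using assms(3) by (auto simp: tail_eq_def)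
  then show ?thesis using vershik_funpow_diff[OF assms(1,2), of n] by metis
qed

lemma orbit_rel_funpow:
  assumes x: "x \<in> inf_paths D" and y: "y \<in> inf_paths D"
  shows "orbit_rel x y \<longleftrightarrow> (\<exists>a b. (vershik D ^^ a) x = (vershik D ^^ b) y)"
proof
  assume "\<exists>a b. (vershik D ^^ a) x = (vershik D ^^ b) y"
  then obtain a b where "(vershik D ^^ a) x = (vershik D ^^ b) y" by blast
  then show "orbit_rel x y"
    using orbit_rel_vershik[OF x, of a] orbit_rel_sym[OF orbit_rel_vershik[OF y, of b]]
    by (auto intro: orbit_rel_trans)
next
  assume r: "orbit_rel x y"
  note tr = funpow_meet_trans[of "vershik D"]
  \<comment> \<open>The step from \<open>xmax\<close> to \<open>xmin\<close> links the two
    exceptional cofinality classes.\<close>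
  have mm: "\<exists>a b. (vershik D ^^ a) xmax = (vershik D ^^ b) xmin"
    by (intro exI[of _ "Suc 0"] exI[of _ 0]) simp
  have mm': "\<exists>a b. (vershik D ^^ a) xmin = (vershik D ^^ b) xmax"
    by (intro exI[of _ 0] exI[of _ "Suc 0"]) simp
  have E: "\<exists>a b. (vershik D ^^ a) z = (vershik D ^^ b) xmax"
    if "z \<in> inf_paths D" "tail_eq z xmax \<or> tail_eq z xmin" for z
    using that(2) tail_eq_funpow[OF that(1) xmax_inf] tr[OF tail_eq_funpow[OF that(1) xmin_inf] mm']
    by blast
  show "\<exists>a b. (vershik D ^^ a) x = (vershik D ^^ b) y"
    using r unfolding orbit_rel_def
  proof (elim disjE[of "tail_eq x y"])
    assume "(tail_eq x xmax \<or> tail_eq x xmin) \<and> (tail_eq y xmax \<or> tail_eq y xmin)"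
    then have "\<exists>a b. (vershik D ^^ a) x = (vershik D ^^ b) xmax"
      "\<exists>a b. (vershik D ^^ a) y = (vershik D ^^ b) xmax"
      using E[OF x] E[OF y] by blast+
    then have "\<exists>a b. (vershik D ^^ a) x = (vershik D ^^ b) xmax"
      "\<exists>a b. (vershik D ^^ a) xmax = (vershik D ^^ b) y"
      by (blast, metis)
    then show ?thesis by (rule tr)
  qed (use tail_eq_funpow x y in blast)
qed

end

section \<open>Topology of the path space\<close>

lemma topspace_path_space [simp]: "topspace (path_space D) = inf_paths D"
  by (auto simp: path_space_def inf_paths_def PiE_iff)

lemma openin_path_space_iff:
  "openin (path_space D) U \<longleftrightarrow> U \<subseteq> inf_paths D \<and>
     (\<forall>x\<in>U. \<exists>n. \<forall>y\<in>inf_paths D. (\<forall>i<n. y i = x i) \<longrightarrow> y \<in> U)"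
    (is "?L \<longleftrightarrow> ?R")
proof
  assume ?L
  then obtain T where T: "openin (product_topology (\<lambda>n. discrete_topology (edges D n)) UNIV) T"
    and U: "U = T \<inter> inf_paths D"
    unfolding path_space_def openin_subtopology by blast
  show ?R
  proof (intro conjI ballI)
    show "U \<subseteq> inf_paths D" using U by blast
    fix x assume x: "x \<in> U"
    then have "x \<in> T" using U by blast
    then obtain W where W: "finite {i. W i \<noteq> edges D i}" "x \<in> Pi\<^sub>E UNIV W" "Pi\<^sub>E UNIV W \<subseteq> T"
      using T unfolding openin_product_topology_alt by auto
    obtain n where n: "\<And>i. W i \<noteq> edges D i \<Longrightarrow> i < n"
      using W(1) unfolding finite_nat_set_iff_bounded by blast
    show "\<exists>n. \<forall>y\<in>inf_paths D. (\<forall>i<n. y i = x i) \<longrightarrow> y \<in> U"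
    proof (intro exI ballI impI)
      fix y assume y: "y \<in> inf_paths D" and a: "\<forall>i<n. y i = x i"
      have "y i \<in> W i" for i
      proof (cases "i < n")
        case True
        then show ?thesis using a W(2) by (simp add: PiE_iff)
      next
        case False
        then have "W i = edges D i" using n by blast
        then show ?thesis using y by (simp add: inf_paths_def)
      qed
      then show "y \<in> U" using W(3) U y by (auto simp: PiE_iff)
    qed
  qed
next
  assume R: ?R
  then have "\<forall>x. \<exists>n. x \<in> U \<longrightarrow> (\<forall>y\<in>inf_paths D. (\<forall>i<n. y i = x i) \<longrightarrow> y \<in> U)" by blast
  then obtain n where n: "\<And>x y. x \<in> U \<Longrightarrow> y \<in> inf_paths D \<Longrightarrow> (\<forall>i<n x. y i = x i) \<Longrightarrow> y \<in> U"
    by metis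
  \<comment> \<open>The box of \<open>W x\<close> is the cylinder of \<open>x\<close> of length
    \<open>n x\<close>.\<close>
  define W where "W x i = (if i < n x then {x i} else edges D i)" for x i
  define T where "T = (\<Union>x\<in>U. Pi\<^sub>E UNIV (W x))"
  have "openin (product_topology (\<lambda>n. discrete_topology (edges D n)) UNIV) (Pi\<^sub>E UNIV (W x))"
    if "x \<in> U" for x
  proof -
    have "\<forall>i. x i \<in> edges D i" using that R by (auto simp: inf_paths_def)
    moreover have "finite {i. W x i \<noteq> edges D i}"
      by (rule finite_subset[of _ "{..<n x}"]) (auto simp: W_def)
    ultimately show ?thesis
      by (intro openin_PiE_gen[THEN iffD2]) (auto simp: W_def)
  qed
  then have oT: "openin (product_topology (\<lambda>n. discrete_topology (edges D n)) UNIV) T"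
    unfolding T_def by blast
  have "U = T \<inter> inf_paths D"
  proof (intro equalityI subsetI)
    fix x assume x: "x \<in> U"
    then have xi: "x \<in> inf_paths D" using R by blast
    then have "x \<in> Pi\<^sub>E UNIV (W x)" by (auto simp: W_def inf_paths_def)
    then show "x \<in> T \<inter> inf_paths D" using x xi by (auto simp: T_def)
  next
    fix y assume y: "y \<in> T \<inter> inf_paths D"
    then obtain x where x: "x \<in> U" "y \<in> Pi\<^sub>E UNIV (W x)" by (auto simp: T_def)
    have "\<forall>i<n x. y i = x i"
    proof (intro allI impI)
      fix i assume "i < n x"
      moreover have "y i \<in> W x i" using x(2) by (simp add: PiE_iff)
      ultimately show "y i = x i" by (simp add: W_def)
    qed
    then show "y \<in> U" using n[OF x(1)] y by blast
  qed
  then show ?L using oT unfolding path_space_def openin_subtopology by blast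
qed

lemma openin_cylinder:
  assumes "U \<subseteq> inf_paths D"
    "\<And>x y. x \<in> U \<Longrightarrow> y \<in> inf_paths D \<Longrightarrow> (\<forall>i<n. y i = x i) \<Longrightarrow> y \<in> U"
  shows "openin (path_space D) U" and "closedin (path_space D) U"
proof -
  show "openin (path_space D) U" unfolding openin_path_space_iff using assms by blast
  have "openin (path_space D) (inf_paths D - U)"
    unfolding openin_path_space_iff
  proof (intro conjI ballI exI impI)
    fix x y assume "x \<in> inf_paths D - U" "y \<in> inf_paths D" "\<forall>i<n. y i = x i"
    then show "y \<in> inf_paths D - U" using assms(2)[of y x] by auto
  qed auto
  then show "closedin (path_space D) U" using assms(1) by (simp add: closedin_def)
qed

lemma Hausdorff_path_space: "Hausdorff_space (path_space D)"
  unfolding path_space_def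
  by (intro Hausdorff_space_subtopology) (simp add: Hausdorff_space_product_topology)

lemma continuous_map_path_space:
  assumes "\<And>x. x \<in> inf_paths D \<Longrightarrow> F x \<in> inf_paths D'"
    "\<And>x n. x \<in> inf_paths D \<Longrightarrow>
       \<exists>m. \<forall>y\<in>inf_paths D. (\<forall>i<m. y i = x i) \<longrightarrow> (\<forall>i<n. F y i = F x i)"
  shows "continuous_map (path_space D) (path_space D') F"
  unfolding continuous_map_def
proof (intro conjI allI impI)
  show "F \<in> topspace (path_space D) \<rightarrow> topspace (path_space D')" using assms(1) by simp
  fix U assume U: "openin (path_space D') U"
  show "openin (path_space D) {x \<in> topspace (path_space D). F x \<in> U}"
    unfolding openin_path_space_iff
  proof (intro conjI ballI)
    fix x assume "x \<in> {x \<in> topspace (path_space D). F x \<in> U}"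
    then have x: "x \<in> inf_paths D" "F x \<in> U" by auto
    obtain n where n: "\<forall>y\<in>inf_paths D'. (\<forall>i<n. y i = F x i) \<longrightarrow> y \<in> U"
      using U x(2) unfolding openin_path_space_iff by blast
    obtain m where "\<forall>y\<in>inf_paths D. (\<forall>i<m. y i = x i) \<longrightarrow> (\<forall>i<n. F y i = F x i)"
      using assms(2)[OF x(1)] by blast
    then have "\<forall>y\<in>inf_paths D. (\<forall>i<m. y i = x i) \<longrightarrow> y \<in> {x \<in> topspace (path_space D). F x \<in> U}"
      using n assms(1) by simp
    then show "\<exists>m. \<forall>y\<in>inf_paths D. (\<forall>i<m. y i = x i) \<longrightarrow> y \<in> {x \<in> topspace (path_space D). F x \<in> U}"
      by blast
  qed auto
qed

lemma continuous_map_locally_constant: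
  assumes "\<And>x. x \<in> inf_paths D \<Longrightarrow> F x \<in> topspace Y"
    "\<And>x. x \<in> inf_paths D \<Longrightarrow> \<exists>m. \<forall>y\<in>inf_paths D. (\<forall>i<m. y i = x i) \<longrightarrow> F y = F x"
  shows "continuous_map (path_space D) Y F"
  unfolding continuous_map_def
proof (intro conjI allI impI)
  show "F \<in> topspace (path_space D) \<rightarrow> topspace Y" using assms(1) by simp
  fix U assume U: "openin Y U"
  show "openin (path_space D) {x \<in> topspace (path_space D). F x \<in> U}"
    unfolding openin_path_space_iff
  proof (intro conjI ballI)
    fix x assume "x \<in> {x \<in> topspace (path_space D). F x \<in> U}"
    then have x: "x \<in> inf_paths D" "F x \<in> U" by auto
    obtain m where m: "\<forall>y\<in>inf_paths D. (\<forall>i<m. y i = x i) \<longrightarrow> F y = F x"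
      using assms(2)[OF x(1)] by blast
    show "\<exists>m. \<forall>y\<in>inf_paths D. (\<forall>i<m. y i = x i) \<longrightarrow> y \<in> {x \<in> topspace (path_space D). F x \<in> U}"
    proof (intro exI[of _ m] ballI impI)
      fix y assume y: "y \<in> inf_paths D" "\<forall>i<m. y i = x i"
      then have "F y = F x" using m by blast
      then show "y \<in> {x \<in> topspace (path_space D). F x \<in> U}" using x y by simp
    qed
  qed auto
qed

text \<open>Otherwise the sets \<open>A N\<close>, of the points whose cylinder of length
  \<open>N\<close> contains two values at distance at least \<open>e\<close>, are nonempty. They are
  decreasing, and closed because membership depends on \<open>N\<close> entries only, so by
  compactness they share a point, at which \<open>f\<close> is not continuous.\<close>

lemma uniformly_continuous_path_space:
  fixes f :: "(nat \<Rightarrow> 'e) \<Rightarrow> 'm::metric_space"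
  assumes cpt: "compact_space (path_space D)" and f: "continuous_map (path_space D) euclidean f" and "0 < e"
  shows "\<exists>N. \<forall>x\<in>inf_paths D. \<forall>y\<in>inf_paths D. (\<forall>i<N. x i = y i) \<longrightarrow> dist (f x) (f y) < e"
proof (rule ccontr)
  assume contra: "\<not> ?thesis"
  define A where "A N = {x\<in>inf_paths D. \<exists>y\<in>inf_paths D. \<exists>z\<in>inf_paths D.
     (\<forall>i<N. y i = x i) \<and> (\<forall>i<N. z i = x i) \<and> e \<le> dist (f y) (f z)}" for N
  have "(\<Inter>N. A N) \<noteq> {}"
  proof (rule compact_space_imp_nest[OF cpt])
    show "closedin (path_space D) (A N)" for N
    proof (rule openin_cylinder(2)[where n = N])
      fix x x' assume "x \<in> A N" "x' \<in> inf_paths D" "\<forall>i<N. x' i = x i"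
      then show "x' \<in> A N" by (simp add: A_def)
    qed (auto simp: A_def)
    show "A N \<noteq> {}" for N
    proof -
      have "\<not> (\<forall>x\<in>inf_paths D. \<forall>y\<in>inf_paths D. (\<forall>i<N. x i = y i) \<longrightarrow> dist (f x) (f y) < e)"
        using contra by blast
      then obtain x y where "x \<in> inf_paths D" "y \<in> inf_paths D" "\<forall>i<N. x i = y i" "\<not> dist (f x) (f y) < e"
        by blast
      then have "x \<in> A N" unfolding A_def by (intro CollectI conjI bexI[of _ x] bexI[of _ y]) simp_all
      then show ?thesis by blast
    qed
    show "decseq A"
    proof (rule decseq_SucI, rule subsetI)
      fix N x assume "x \<in> A (Suc N)"
      then show "x \<in> A N" unfolding A_def using less_SucI by blast
    qed
  qed
  then obtain x where x: "\<And>N. x \<in> A N" by blast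
  then have xi: "x \<in> inf_paths D" by (auto simp: A_def)
  have "openin (path_space D) {y \<in> topspace (path_space D). f y \<in> ball (f x) (e/2)}"
    using f open_openin[of "ball (f x) (e/2)"] unfolding continuous_map_def by blast
  moreover have "x \<in> {y \<in> topspace (path_space D). f y \<in> ball (f x) (e/2)}"
    using xi \<open>0 < e\<close> by simp
  ultimately obtain n where n: "\<forall>y\<in>inf_paths D. (\<forall>i<n. y i = x i) \<longrightarrow>
      y \<in> {y \<in> topspace (path_space D). f y \<in> ball (f x) (e/2)}"
    unfolding openin_path_space_iff by blast
  obtain y z where "y \<in> inf_paths D" "z \<in> inf_paths D" "\<forall>i<n. y i = x i" "\<forall>i<n. z i = x i" "e \<le> dist (f y) (f z)"
    using x[of n] unfolding A_def by blast
  moreover from this have "dist (f x) (f y) < e/2" "dist (f x) (f z) < e/2" using n by auto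
  then have "dist (f y) (f z) < e" by (metis dist_commute dist_triangle_half_l)
  ultimately show False by simp
qed

lemma homeomorphic_map_bij_betw: "homeomorphic_map X Y f \<Longrightarrow> bij_betw f (topspace X) (topspace Y)"
  by (simp add: bij_betw_def homeomorphic_imp_injective_map homeomorphic_imp_surjective_map)

context proper_obd
begin

text \<open>A compactness argument from the uniqueness of the minimal path. It gives continuity of
  the Vershik map at \<open>xmax\<close>.\<close>

lemma ball_xmin:
  assumes cpt: "compact_space (path_space D)"
  shows "\<exists>N. \<forall>z\<in>inf_paths D. (\<forall>i<N. min_edge D i (z i)) \<longrightarrow> (\<forall>i<n. z i = xmin i)"
proof (rule ccontr)
  assume contra: "\<not> ?thesis"
  define A where "A N = {z\<in>inf_paths D. (\<forall>i<N. min_edge D i (z i)) \<and> \<not> (\<forall>i<n. z i = xmin i)}" for N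
  have "(\<Inter>N. A N) \<noteq> {}"
  proof (rule compact_space_imp_nest[OF cpt])
    show "closedin (path_space D) (A N)" for N
    proof (rule openin_cylinder(2)[where n = "max n N"])
      fix x x' assume x: "x \<in> A N" and x': "x' \<in> inf_paths D" and a: "\<forall>i<max n N. x' i = x i"
      obtain i where "i < n" "x i \<noteq> xmin i" using x by (auto simp: A_def)
      then have "\<not> (\<forall>i<n. x' i = xmin i)" using a by (metis max.strict_coboundedI1)
      moreover have "\<forall>i<N. min_edge D i (x' i)" using x a by (simp add: A_def)
      ultimately show "x' \<in> A N" using x' unfolding A_def by blast
    qed (auto simp: A_def)
    show "A N \<noteq> {}" for N using contra unfolding A_def by blast
    show "decseq A" by (rule decseq_SucI) (auto simp: A_def)
  qed
  then obtain z where z: "\<And>N. z \<in> A N" by blast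
  then have "z \<in> inf_paths D" "\<forall>i. min_edge D i (z i)" unfolding A_def by blast+
  then have "z = xmin" using eq_xmin_iff by blast
  then show False using z by (auto simp: A_def)
qed

lemma vershik_locally:
  assumes x: "x \<in> inf_paths D" and nm: "\<exists>i<n. \<not> max_edge D i (x i)"
    and y: "y \<in> inf_paths D" and a: "\<forall>i<n. y i = x i"
  shows "\<forall>i<n. vershik D y i = vershik D x i"
proof -
  have ny: "\<exists>i<n. \<not> max_edge D i (y i)" using nm a by auto
  note vx = vershik_nonmax[OF x nm] and vy = vershik_nonmax[OF y ny]
  obtain k where n: "n = Suc k" using nm by (cases n) auto
  have "rng D k (x k) = rng D k (y k)" using a n by simp
  then have "src D n (x n) = src D n (y n)" using x y n by (simp add: inf_paths_def)
  moreover have "pos D n x = pos D n y" using a by (intro pos_cong) simp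
  ultimately have "\<forall>i<n. vershik D x i = vershik D y i"
    by (intro pos_inj) (use vx vy in auto)
  then show ?thesis by simp
qed

text \<open>The successor edge is inserted at a position \<open>m\<close> with
  \<open>n \<le> m\<close>, and everything below \<open>m\<close> is reset to minimal edges, like a
  carry in an odometer.\<close>

lemma pos_vershik_top:
  assumes x: "x \<in> inf_paths D" and m: "\<forall>i<n. max_edge D i (x i)"
  shows "pos D n (vershik D x) = 0"
proof (cases "x = xmax")
  case True then show ?thesis using pos_xmin by simp
next
  case False
  define m where "m = (LEAST i. \<not> max_edge D i (x i))"
  have ex: "\<exists>i. \<not> max_edge D i (x i)" using False eq_xmax_iff[OF x] by blast
  have m: "\<not> max_edge D m (x m)" using ex unfolding m_def by (metis (mono_tags, lifting) LeastI_ex)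
  have lm: "\<forall>i<m. max_edge D i (x i)" unfolding m_def using not_less_Least by blast
  have nm: "n \<le> m" using \<open>\<forall>i<n. max_edge D i (x i)\<close> m by (meson not_less)
  have n1: "\<exists>i<Suc m. \<not> max_edge D i (x i)" using m by blast
  note v = vershik_nonmax[OF x n1]
  have e: "x m \<in> edges D m" using x by (simp add: inf_paths_def)
  have "Suc (pos D m x) = hgt D m (src D m (x m))" using pos_max_iff[OF x] lm by blast
  then have pv: "pos D (Suc m) (vershik D x) = off D m (edge_succ D m (x m))"
    using v edge_succ[OF e m] by simp
  have ev: "vershik D x m \<in> edges D m" "rng D m (vershik D x m) = rng D m (edge_succ D m (x m))"
    using v x edge_succ[OF e m] by (auto simp: inf_paths_def)
  have "0 < hgt D m (src D m (edge_succ D m (x m)))"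
    using hgt_pos src_vertex edge_succ[OF e m] by blast
  then have "vershik D x m = edge_succ D m (x m)"
    using off_unique[OF ev(1) _ ev(2), of "pos D (Suc m) (vershik D x)"] edge_succ[OF e m]
      pos_less[OF vershik_inf[OF x], of m] pv by simp
  then have "pos D m (vershik D x) = 0" using pv by simp
  then have "\<forall>i<m. min_edge D i (vershik D x i)" using pos_eq_0_iff[OF vershik_inf[OF x]] by blast
  then show ?thesis using pos_eq_0_iff[OF vershik_inf[OF x], of n] nm by auto
qed

text \<open>Away from \<open>xmax\<close> finitely many entries determine finitely many entries of
  the image. Near \<open>xmax\<close> the image begins with many minimal edges and is therefore
  close to \<open>xmin\<close>.\<close>

lemma vershik_continuous:
  assumes cpt: "compact_space (path_space D)"
  shows "continuous_map (path_space D) (path_space D) (vershik D)"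
proof (rule continuous_map_path_space)
  fix x n assume x: "x \<in> inf_paths D"
  show "\<exists>m. \<forall>y\<in>inf_paths D. (\<forall>i<m. y i = x i) \<longrightarrow> (\<forall>i<n. vershik D y i = vershik D x i)"
  proof (cases "x = xmax")
    case False
    then obtain k i where "i < k" "\<not> max_edge D i (x i)" using ex_nonmax[OF x] by blast
    then have "\<exists>i<max k n. \<not> max_edge D i (x i)" by (meson less_le_trans max.cobounded1)
    then show ?thesis using vershik_locally[OF x, of "max k n"]
      by (intro exI[of _ "max k n"]) auto
  next
    case True
    obtain N where N: "\<forall>z\<in>inf_paths D. (\<forall>i<N. min_edge D i (z i)) \<longrightarrow> (\<forall>i<n. z i = xmin i)"
      using ball_xmin[OF cpt] by blast
    show ?thesis
    proof (intro exI[of _ N] ballI impI)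
      fix y assume y: "y \<in> inf_paths D" and a: "\<forall>i<N. y i = x i"
      have "\<forall>i<N. max_edge D i (y i)" using a True eq_xmax_iff[OF xmax_inf] by simp
      then have "\<forall>i<N. min_edge D i (vershik D y i)"
        using pos_vershik_top[OF y] pos_eq_0_iff[OF vershik_inf[OF y]] by blast
      then show "\<forall>i<n. vershik D y i = vershik D x i" using N vershik_inf[OF y] True by simp
    qed
  qed
qed simp

lemma vershik_homeomorphic_map:
  assumes "compact_space (path_space D)"
  shows "homeomorphic_map (path_space D) (path_space D) (vershik D)"
  by (rule continuous_imp_homeomorphic_map[OF vershik_continuous])
    (use assms vershik_bij in \<open>auto simp: bij_betw_def Hausdorff_path_space\<close>)

lemma orbit_vershik_iff:
  assumes "x \<in> inf_paths D" "y \<in> inf_paths D"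
  shows "y \<in> system_orbit (path_space D) (vershik D) x \<longleftrightarrow> orbit_rel x y"
  using system_orbit_iff[of "vershik D" "path_space D" x y] vershik_bij assms orbit_rel_funpow by simp

end

section \<open>Cantor spaces, minimality and eigenfunctions\<close>

lemma cantor_space_compact: "cantor_space X \<Longrightarrow> compact_space X"
  unfolding cantor_space_def
  using homeomorphic_compact_space compact_space_product_topology compact_space_discrete_topology finite
  by (metis (mono_tags, lifting))

lemma cantor_space_infinite: "cantor_space X \<Longrightarrow> infinite (topspace X)"
proof
  assume c: "cantor_space X" and f: "finite (topspace X)"
  obtain g where g: "homeomorphic_map X (product_topology (\<lambda>_::nat. discrete_topology (UNIV :: bool set)) UNIV) g"
    using c unfolding cantor_space_def homeomorphic_space_def homeomorphic_map_maps by blast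
  have "finite (g ` topspace X)" using f by simp
  then have "finite (UNIV :: (nat \<Rightarrow> bool) set)"
    using homeomorphic_imp_surjective_map[OF g] by simp
  then have "finite (range (\<lambda>n i::nat. i = (n::nat)))" by (rule finite_subset[rotated]) simp
  moreover have "inj (\<lambda>n i::nat. i = (n::nat))" by (rule injI) metis
  ultimately show False using finite_imageD infinite_UNIV_nat by blast
qed

lemma minimal_cantor_bij:
  "minimal_cantor_system X T \<Longrightarrow> bij_betw T (topspace X) (topspace X)"
  by (simp add: minimal_cantor_system_def homeomorphic_map_bij_betw)

text \<open>Minimality speaks of orbits as sets, and a homeomorphism carrying orbits to orbits also
  carries their closures.\<close>

lemma orbit_equivalence_minimal:
  assumes X: "minimal_cantor_system X T" and e: "orbit_equivalence X T Y S \<phi>" and S: "homeomorphic_map Y Y S"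
  shows "minimal_cantor_system Y S"
  unfolding minimal_cantor_system_def
proof (intro conjI ballI S)
  have h: "homeomorphic_map X Y \<phi>" using e by (simp add: orbit_equivalence_def)
  have "Y homeomorphic_space X"
    using h homeomorphic_map_imp_homeomorphic_space homeomorphic_space_sym by blast
  then show "cantor_space Y"
    using X homeomorphic_space_trans unfolding minimal_cantor_system_def cantor_space_def by blast
  fix y assume "y \<in> topspace Y"
  then obtain x where x: "x \<in> topspace X" "y = \<phi> x"
    using homeomorphic_imp_surjective_map[OF h] by auto
  have "Y closure_of system_orbit Y S y = Y closure_of (\<phi> ` system_orbit X T x)"
    using e x by (simp add: orbit_equivalence_def)
  also have "\<dots> = \<phi> ` (X closure_of system_orbit X T x)"
    using homeomorphic_map_closure_of[OF h system_orbit_subset[OF minimal_cantor_bij[OF X] x(1)]] .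
  also have "\<dots> = topspace Y"
    using X x(1) homeomorphic_imp_surjective_map[OF h] by (simp add: minimal_cantor_system_def)
  finally show "Y closure_of system_orbit Y S y = topspace Y" .
qed

text \<open>A level set of \<open>g\<close> is closed and, once it contains a point, contains its
  dense orbit.\<close>

lemma minimal_invariant_const:
  fixes g :: "'x \<Rightarrow> 'm::t2_space"
  assumes X: "minimal_cantor_system X T" and g: "continuous_map X euclidean g"
    and inv: "\<And>x. x \<in> topspace X \<Longrightarrow> g (T x) = g x"
    and x: "x \<in> topspace X" and y: "y \<in> topspace X"
  shows "g x = g y"
proof -
  let ?A = "{z \<in> topspace X. g z = g x}"
  have bij: "bij_betw T (topspace X) (topspace X)" using minimal_cantor_bij[OF X] .
  have it: "(T ^^ n) z \<in> topspace X \<and> g ((T ^^ n) z) = g z" if "z \<in> topspace X" for z n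
    using that inv bij_betwE[OF bij] by (induction n) auto
  have "closedin X {z \<in> topspace X. g z \<in> {g x}}"
    by (rule closedin_continuous_map_preimage[OF g]) simp
  then have cl: "closedin X ?A" by simp
  have "system_orbit X T x \<subseteq> ?A"
  proof
    fix z assume z: "z \<in> system_orbit X T x"
    then have zt: "z \<in> topspace X" using system_orbit_subset[OF bij x] by blast
    then obtain a b where "(T ^^ a) x = (T ^^ b) z" using z system_orbit_iff[OF bij x zt] by blast
    then show "z \<in> ?A" using it[OF x, of a] it[OF zt, of b] zt by simp
  qed
  then have "X closure_of system_orbit X T x \<subseteq> ?A" by (rule closure_of_minimal[OF _ cl])
  then show ?thesis using X x y by (auto simp: minimal_cantor_system_def)
qed

text \<open>The modulus of \<open>f\<close> attains its maximum at some \<open>m\<close>. Comparing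
  \<open>m\<close> with its image gives \<open>cmod z \<le> 1\<close>, and with its preimage
  \<open>1 \<le> cmod z\<close>; then the modulus is invariant, hence constant.\<close>

lemma minimal_eigenfunction:
  assumes X: "minimal_cantor_system X T" and f: "continuous_eigenfunction X T z f"
  shows "cmod z = 1" and "\<exists>c>0. \<forall>x\<in>topspace X. cmod (f x) = c"
proof -
  have fc: "continuous_map X euclidean f" and fT: "\<And>x. x \<in> topspace X \<Longrightarrow> f (T x) = z * f x"
    using f by (auto simp: continuous_eigenfunction_def)
  obtain a where a: "a \<in> topspace X" "f a \<noteq> 0" using f by (auto simp: continuous_eigenfunction_def)
  have nc: "continuous_map X euclidean (\<lambda>x. cmod (f x))"
    using fc by (rule continuous_map_norm)
  have bij: "bij_betw T (topspace X) (topspace X)" using minimal_cantor_bij[OF X] .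
  have "compact_space X" using X cantor_space_compact by (auto simp: minimal_cantor_system_def)
  then have "compactin euclidean ((\<lambda>x. cmod (f x)) ` topspace X)"
    using image_compactin[OF _ nc] by (simp add: compact_space_def)
  then have "compact ((\<lambda>x. cmod (f x)) ` topspace X)" by simp
  moreover have "(\<lambda>x. cmod (f x)) ` topspace X \<noteq> {}" using a(1) by blast
  ultimately obtain s where s: "s \<in> (\<lambda>x. cmod (f x)) ` topspace X"
    "\<forall>t\<in>(\<lambda>x. cmod (f x)) ` topspace X. t \<le> s"
    using compact_attains_sup by blast
  then obtain m where m: "m \<in> topspace X" "\<And>x. x \<in> topspace X \<Longrightarrow> cmod (f x) \<le> cmod (f m)"
    by blast
  have pos: "0 < cmod (f m)" using m(2)[OF a(1)] a(2) by (metis less_le_trans zero_less_norm_iff)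
  obtain m' where m': "m' \<in> topspace X" "T m' = m" 
    using bij_betw_imp_surj_on[OF bij] m(1) by (metis imageE)
  have Tm: "T m \<in> topspace X" using bij m(1) by (auto simp: bij_betw_def)
  have "cmod z * cmod (f m) \<le> cmod (f m)"
    using m(2)[OF Tm] fT[OF m(1)] by (simp add: norm_mult)
  then have 1: "cmod z \<le> 1" using pos by simp
  have "cmod (f m) = cmod z * cmod (f m')" using fT[OF m'(1)] m'(2) by (simp add: norm_mult)
  also have "\<dots> \<le> cmod z * cmod (f m)" using m(2)[OF m'(1)] by (simp add: mult_left_mono)
  finally have "1 \<le> cmod z" using pos by simp
  with 1 show z: "cmod z = 1" by simp
  have "cmod (f x) = cmod (f m)" if "x \<in> topspace X" for x
    by (rule minimal_invariant_const[OF X nc _ that m(1)]) (simp add: fT norm_mult z)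
  then show "\<exists>c>0. \<forall>x\<in>topspace X. cmod (f x) = c" using pos by blast
qed

section \<open>Paths between two levels\<close>

text \<open>Counts the integer points of disjoint intervals. The second claim is the same count for
  the times below \<open>a p\<close>, which are exactly filled by the intervals starting
  earlier.\<close>

lemma tiling_sum:
  fixes a w :: "'p \<Rightarrow> nat"
  assumes fin: "finite P" and top: "\<And>p. p \<in> P \<Longrightarrow> a p + w p \<le> N" and wpos: "\<And>p. p \<in> P \<Longrightarrow> 0 < w p"
    and cov: "\<And>t. t < N \<Longrightarrow> \<exists>p\<in>P. a p \<le> t \<and> t < a p + w p"
    and uniq: "\<And>p q t. p \<in> P \<Longrightarrow> q \<in> P \<Longrightarrow> a p \<le> t \<Longrightarrow> t < a p + w p \<Longrightarrow>
        a q \<le> t \<Longrightarrow> t < a q + w q \<Longrightarrow> p = q"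
  shows "(\<Sum>q\<in>P. w q) = N" and "p \<in> P \<Longrightarrow> (\<Sum>q\<in>{q\<in>P. a q < a p}. w q) = a p"
proof -
  have main: "(\<Sum>q\<in>Q. w q) = M"
    if Q: "Q \<subseteq> P" and M: "(\<Union>q\<in>Q. {a q..<a q + w q}) = {..<M}" for Q M
  proof -
    have "disjoint_family_on (\<lambda>q. {a q..<a q + w q}) Q"
      unfolding disjoint_family_on_def
    proof (intro ballI impI)
      fix p q assume pq: "p \<in> Q" "q \<in> Q" "p \<noteq> q"
      show "{a p..<a p + w p} \<inter> {a q..<a q + w q} = {}"
      proof (rule ccontr)
        assume "{a p..<a p + w p} \<inter> {a q..<a q + w q} \<noteq> {}"
        then obtain t where "t \<in> {a p..<a p + w p}" "t \<in> {a q..<a q + w q}" by blast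
        then have "p = q" using uniq[of p q t] pq Q by auto
        then show False using pq by simp
      qed
    qed
    moreover have "finite Q" using Q fin finite_subset by blast
    ultimately have "card (\<Union>q\<in>Q. {a q..<a q + w q}) = (\<Sum>q\<in>Q. card {a q..<a q + w q})"
      by (intro card_UN_disjoint) (auto simp: disjoint_family_on_def)
    then show ?thesis unfolding M by simp
  qed
  show "(\<Sum>q\<in>P. w q) = N"
  proof (rule main)
    show "(\<Union>q\<in>P. {a q..<a q + w q}) = {..<N}"
      using top cov by (auto, meson less_le_trans)
  qed simp
  show "(\<Sum>q\<in>{q\<in>P. a q < a p}. w q) = a p" if p: "p \<in> P"
  proof (rule main)
    show "(\<Union>q\<in>{q\<in>P. a q < a p}. {a q..<a q + w q}) = {..<a p}"
    proof (intro equalityI subsetI)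
      fix t assume "t \<in> (\<Union>q\<in>{q\<in>P. a q < a p}. {a q..<a q + w q})"
      then obtain q where q: "q \<in> P" "a q < a p" "t < a q + w q" by auto
      have "a q + w q \<le> a p"
      proof (rule ccontr)
        assume "\<not> a q + w q \<le> a p"
        then have "q = p" using uniq[OF q(1) p, of "a p"] q wpos[OF p] by simp
        then show False using q by simp
      qed
      then show "t \<in> {..<a p}" using q by simp
    next
      fix t assume t: "t \<in> {..<a p}"
      then have "t < N" using top[OF p] by simp
      then obtain q where "q \<in> P" "a q \<le> t" "t < a q + w q" using cov by blast
      then show "t \<in> (\<Union>q\<in>{q\<in>P. a q < a p}. {a q..<a q + w q})" using t by force
    qed
  qed blast
qed

text \<open>The time at which the tower over the end of \<open>p\<close> enters the copy of the
  lower tower that belongs to \<open>p\<close>.\<close>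

definition seg_off :: "'e ordered_bratteli \<Rightarrow> nat \<Rightarrow> 'e list \<Rightarrow> nat" where
  "seg_off D n p = (\<Sum>i<length p. off D (n + i) (p ! i))"

lemma seg_off_map: "seg_off D n (map x [n..<m]) = (\<Sum>i=n..<m. off D i (x i))"
proof -
  have "seg_off D n (map x [n..<m]) = (\<Sum>i=0..<m - n. off D (i + n) (x (i + n)))"
    unfolding seg_off_def by (intro sum.cong) (auto simp: add.commute)
  also have "\<dots> = (\<Sum>i=n..<m. off D i (x i))"
    using sum.shift_bounds_nat_ivl[of "\<lambda>i. off D i (x i)" 0 n "m - n"]
    by (cases "n \<le> m") auto
  finally show ?thesis .
qed

lemma pos_seg: "n \<le> m \<Longrightarrow> pos D m x = pos D n x + seg_off D n (map x [n..<m])"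
  unfolding seg_off_map by (rule pos_split)

lemma fin_paths_length: "p \<in> fin_paths D n m \<Longrightarrow> length p = m - n"
  by (simp add: fin_paths_def)

context obd
begin

lemma finite_fin_paths [simp]: "finite (fin_paths D n m)"
proof (rule finite_subset)
  show "fin_paths D n m \<subseteq> {xs. set xs \<subseteq> (\<Union>i<m. edges D i) \<and> length xs = m - n}"
    by (fastforce simp: fin_paths_def in_set_conv_nth)
qed (intro finite_lists_length_eq finite_UN_I, auto)

lemma fin_path_ends:
  assumes "p \<in> fin_paths D n m" "n < m"
  shows "src D n (hd p) \<in> vertices D n" and "fin_rng D m p \<in> vertices D m" and "p \<noteq> []"
proof -
  have l: "length p = m - n" and e: "\<And>i. i < m - n \<Longrightarrow> p ! i \<in> edges D (n + i)"
    using assms by (auto simp: fin_paths_def)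
  show ne: "p \<noteq> []" using l assms(2) by auto
  have "hd p = p ! 0" using ne by (simp add: hd_conv_nth)
  then show "src D n (hd p) \<in> vertices D n" using e[of 0] src_vertex assms(2) by simp
  have "last p = p ! (m - n - 1)" using ne l by (simp add: last_conv_nth)
  then have "last p \<in> edges D (m - 1)" using e[of "m - n - 1"] assms(2) by simp
  then show "fin_rng D m p \<in> vertices D m" using rng_vertex[of "last p" "m - 1"] assms(2) by (simp add: fin_rng_def)
qed

text \<open>A time in the lower tower, a segment and a tail can be prescribed independently as long
  as the end vertices match. Statements about segments are thereby tested on infinite paths.\<close>

lemma seg_extend:
  assumes p: "p \<in> fin_paths D n m" and nm: "n < m" and y: "tail_path D m y" "src D m (y m) = fin_rng D m p"
    and t: "t < hgt D n (src D n (hd p))"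
  shows "\<exists>x\<in>inf_paths D. map x [n..<m] = p \<and> pos D n x = t \<and> (\<forall>i\<ge>m. x i = y i)"
proof -
  define z where "z i = (if i < m then p ! (i - n) else y i)" for i
  have l: "length p = m - n" using p by (simp add: fin_paths_def)
  have "tail_path D n z"
    unfolding tail_path_def
  proof (intro allI impI)
    fix i assume i: "n \<le> i"
    consider "Suc i < m" | "Suc i = m" | "m \<le> i" by linarith
    then show "z i \<in> edges D i \<and> rng D i (z i) = src D (Suc i) (z (Suc i))"
    proof cases
      case 1
      obtain k where k: "i = n + k" using i le_Suc_ex by blast
      then have "k < m - n" "Suc k < m - n" using 1 by simp_all
      then have "p ! k \<in> edges D (n + k)" "rng D (n + k) (p ! k) = src D (Suc (n + k)) (p ! Suc k)"
        using p by (auto simp: fin_paths_def)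
      then show ?thesis using 1 k by (simp add: z_def Suc_diff_le)
    next
      case 2
      obtain k where k: "i = n + k" using i le_Suc_ex by blast
      have "p ! k \<in> edges D (n + k)" using p k 2 by (simp add: fin_paths_def)
      moreover have "last p = p ! k" using l 2 k nm by (subst last_conv_nth) auto
      ultimately show ?thesis using y(2) 2 k by (auto simp: z_def fin_rng_def)
    next
      case 3 then show ?thesis using y(1) by (simp add: z_def tail_path_def)
    qed
  qed
  moreover have "z n = hd p" using l nm by (subst hd_conv_nth) (auto simp: z_def)
  ultimately obtain x where x: "x \<in> inf_paths D" "\<forall>i\<ge>n. x i = z i" "pos D n x = t"
    using pos_surj[of n z t] t by auto
  have "map x [n..<m] = p"
    using l x(2) by (intro nth_equalityI) (auto simp: z_def)
  moreover have "\<forall>i\<ge>m. x i = y i" using x(2) nm by (simp add: z_def)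
  ultimately show ?thesis using x by blast
qed

lemma seg_extend':
  assumes "p \<in> fin_paths D n m" "n < m" "t < hgt D n (src D n (hd p))"
  shows "\<exists>x\<in>inf_paths D. map x [n..<m] = p \<and> pos D n x = t \<and> src D m (x m) = fin_rng D m p"
proof -
  obtain y where "tail_path D m y" "src D m (y m) = fin_rng D m p"
    using ex_tail_path[OF fin_path_ends(2)[OF assms(1,2)]] by blast
  then show ?thesis using seg_extend[OF assms(1,2)] assms(3) by (metis order_refl)
qed

lemma inf_path_seg:
  assumes "x \<in> inf_paths D" "n < m"
  shows "map x [n..<m] \<in> fin_paths D n m" "hd (map x [n..<m]) = x n"
    "fin_rng D m (map x [n..<m]) = src D m (x m)"
proof -
  show "map x [n..<m] \<in> fin_paths D n m" using map_tail_path_fin_paths[OF inf_paths_tail[OF assms(1)]] .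
  show "hd (map x [n..<m]) = x n" using assms(2) by (simp add: upt_rec)
  obtain k where "m = Suc k" using assms(2) by (cases m) auto
  then show "fin_rng D m (map x [n..<m]) = src D m (x m)"
    using assms fin_rng_map[of n m D x] by (simp add: inf_paths_def)
qed

text \<open>Tested on a path through \<open>p\<close> at the top of the lower tower, whose level
  must still be below the height of the upper tower.\<close>

lemma seg_top:
  assumes "p \<in> fin_paths D n m" "n < m"
  shows "seg_off D n p + hgt D n (src D n (hd p)) \<le> hgt D m (fin_rng D m p)"
proof -
  have h: "0 < hgt D n (src D n (hd p))" using hgt_pos fin_path_ends(1)[OF assms] .
  then have "hgt D n (src D n (hd p)) - 1 < hgt D n (src D n (hd p))" by simp
  then obtain x where x: "x \<in> inf_paths D" "map x [n..<m] = p" "pos D n x = hgt D n (src D n (hd p)) - 1"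
    "src D m (x m) = fin_rng D m p"
    using seg_extend'[OF assms] by blast
  show ?thesis using pos_less[OF x(1), of m] pos_seg[of n m D x] x assms(2) h by simp
qed

lemma seg_unique:
  assumes p: "p \<in> fin_paths D n m" and q: "q \<in> fin_paths D n m" and nm: "n < m"
    and r: "fin_rng D m p = fin_rng D m q"
    and tp: "seg_off D n p \<le> t" "t < seg_off D n p + hgt D n (src D n (hd p))"
    and tq: "seg_off D n q \<le> t" "t < seg_off D n q + hgt D n (src D n (hd q))"
  shows "p = q"
proof -
  have bp: "t - seg_off D n p < hgt D n (src D n (hd p))" using tp by simp
  have bq: "t - seg_off D n q < hgt D n (src D n (hd q))" using tq by simp
  obtain x where x: "x \<in> inf_paths D" "map x [n..<m] = p" "pos D n x = t - seg_off D n p"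
    "src D m (x m) = fin_rng D m p"
    using seg_extend'[OF p nm bp] by blast
  obtain y where y: "y \<in> inf_paths D" "map y [n..<m] = q" "pos D n y = t - seg_off D n q"
    "src D m (y m) = fin_rng D m q"
    using seg_extend'[OF q nm bq] by blast
  have "pos D m x = pos D m y"
    using pos_seg[of n m D x] pos_seg[of n m D y] x y nm tp tq by simp
  then have "\<forall>i<m. x i = y i" using x(4) y(4) r by (intro pos_inj[OF x(1) y(1)]) simp_all
  then have "map x [n..<m] = map y [n..<m]" by simp
  then show ?thesis using x y by simp
qed

lemma seg_cover:
  assumes v: "v \<in> vertices D m" and nm: "n < m" and t: "t < hgt D m v"
  shows "\<exists>x\<in>inf_paths D. src D m (x m) = v \<and> pos D m x = t"
proof -
  obtain y where "tail_path D m y" "src D m (y m) = v" using ex_tail_path[OF v] by blast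
  then show ?thesis using pos_surj[of m y t] t by (metis order_refl)
qed

definition segs :: "nat \<Rightarrow> nat \<Rightarrow> nat \<Rightarrow> 'e list set" where
  "segs n m v = {p\<in>fin_paths D n m. fin_rng D m p = v}"

lemma finite_segs [simp]: "finite (segs n m v)"
  by (simp add: segs_def)

text \<open>Copies of the lower towers tile the upper one. The second claim makes
  \<open>seg_off\<close> a prefix sum of heights, the form in which it can be compared with the
  offsets of a reordered diagram.\<close>

lemma seg_tiling:
  assumes v: "v \<in> vertices D m" and nm: "n < m"
  shows "(\<Sum>q\<in>segs n m v. hgt D n (src D n (hd q))) = hgt D m v"
    and "p \<in> segs n m v \<Longrightarrow>
      (\<Sum>q\<in>{q\<in>segs n m v. seg_off D n q < seg_off D n p}. hgt D n (src D n (hd q))) = seg_off D n p"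
proof -
  have top: "seg_off D n q + hgt D n (src D n (hd q)) \<le> hgt D m v" if "q \<in> segs n m v" for q
    using seg_top[OF _ nm] that by (auto simp: segs_def)
  have wpos: "0 < hgt D n (src D n (hd q))" if "q \<in> segs n m v" for q
    using hgt_pos fin_path_ends(1)[OF _ nm] that by (auto simp: segs_def)
  have cov: "\<exists>q\<in>segs n m v. seg_off D n q \<le> t \<and> t < seg_off D n q + hgt D n (src D n (hd q))"
    if t: "t < hgt D m v" for t
  proof -
    obtain x where x: "x \<in> inf_paths D" "src D m (x m) = v" "pos D m x = t"
      using seg_cover[OF v nm t] by blast
    show ?thesis
      using inf_path_seg[OF x(1) nm] pos_less[OF x(1), of n] pos_seg[of n m D x] x nm
      by (intro bexI[of _ "map x [n..<m]"]) (auto simp: segs_def)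
  qed
  have uniq: "p = q" if "p \<in> segs n m v" "q \<in> segs n m v" "seg_off D n p \<le> t"
    "t < seg_off D n p + hgt D n (src D n (hd p))" "seg_off D n q \<le> t"
    "t < seg_off D n q + hgt D n (src D n (hd q))" for p q t
    using seg_unique[OF _ _ nm, of p q t] that by (simp add: segs_def)
  show "(\<Sum>q\<in>segs n m v. hgt D n (src D n (hd q))) = hgt D m v"
    by (rule tiling_sum(1)[OF finite_segs top wpos cov uniq])
  show "(\<Sum>q\<in>{q\<in>segs n m v. seg_off D n q < seg_off D n p}. hgt D n (src D n (hd q))) = seg_off D n p"
    if "p \<in> segs n m v"
    by (rule tiling_sum(2)[OF finite_segs top wpos cov uniq that])
qed

lemma seg_off_inj:
  assumes "p \<in> segs n m v" "q \<in> segs n m v" "n < m" "seg_off D n p = seg_off D n q"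
  shows "p = q"
  using seg_unique[of p n m q "seg_off D n p"] assms hgt_pos fin_path_ends(1)[of p n m] fin_path_ends(1)[of q n m]
  by (simp add: segs_def)

lemma seg_min_iff:
  assumes p: "p \<in> fin_paths D n m"
  shows "seg_off D n p = 0 \<longleftrightarrow> (\<forall>i<m - n. min_edge D (n + i) (p ! i))"
  using p by (auto simp: seg_off_def min_edge_iff fin_paths_def)

lemma seg_max_iff:
  assumes p: "p \<in> fin_paths D n m" and nm: "n < m"
  shows "seg_off D n p + hgt D n (src D n (hd p)) = hgt D m (fin_rng D m p) \<longleftrightarrow>
    (\<forall>i<m - n. max_edge D (n + i) (p ! i))"
proof -
  have h: "0 < hgt D n (src D n (hd p))" using hgt_pos fin_path_ends(1)[OF assms] .
  then have "hgt D n (src D n (hd p)) - 1 < hgt D n (src D n (hd p))" by simp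
  \<comment> \<open>At the top of the lower tower all edges below \<open>n\<close> are maximal, so
    maximality up to \<open>m\<close> concerns \<open>p\<close> alone.\<close>
  then obtain x where x: "x \<in> inf_paths D" "map x [n..<m] = p" "pos D n x = hgt D n (src D n (hd p)) - 1"
    "src D m (x m) = fin_rng D m p"
    using seg_extend'[OF assms] by blast
  have xn: "x n = hd p" using inf_path_seg(2)[OF x(1) nm] x(2) by simp
  have "Suc (pos D n x) = hgt D n (src D n (x n))" using x xn h by simp
  then have lo: "\<forall>i<n. max_edge D i (x i)" using pos_max_iff[OF x(1)] by blast
  have "seg_off D n p + hgt D n (src D n (hd p)) = Suc (pos D m x)"
    using pos_seg[of n m D x] nm x h by simp
  then have "seg_off D n p + hgt D n (src D n (hd p)) = hgt D m (fin_rng D m p) \<longleftrightarrow> (\<forall>i<m. max_edge D i (x i))"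
    using pos_max_iff[OF x(1), of m] x(4) by simp
  also have "\<dots> \<longleftrightarrow> (\<forall>i<m - n. max_edge D (n + i) (x (n + i)))"
  proof (intro iffI allI impI)
    fix i assume a: "\<forall>i<m - n. max_edge D (n + i) (x (n + i))" and i: "i < m"
    show "max_edge D i (x i)"
    proof (cases "i < n")
      case False
      then have "i - n < m - n" using i by simp
      then have "max_edge D (n + (i - n)) (x (n + (i - n)))" using a by blast
      then show ?thesis using False by simp
    qed (use lo in blast)
  qed simp
  also have "\<dots> \<longleftrightarrow> (\<forall>i<m - n. max_edge D (n + i) (p ! i))"
    using x(2) by auto
  finally show ?thesis .
qed

lemma ex_last_seg:
  assumes "v \<in> vertices D m" "n < m"
  shows "\<exists>p\<in>segs n m v. seg_off D n p + hgt D n (src D n (hd p)) = hgt D m v"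
proof -
  have "hgt D m v - 1 < hgt D m v" using hgt_pos[OF assms(1)] by simp
  then obtain x where x: "x \<in> inf_paths D" "src D m (x m) = v" "pos D m x = hgt D m v - 1"
    using seg_cover[OF assms] by blast
  let ?p = "map x [n..<m]"
  note p = inf_path_seg[OF x(1) assms(2)]
  have "hgt D m v \<le> seg_off D n ?p + hgt D n (src D n (hd ?p))"
    using pos_less[OF x(1), of n] pos_seg[of n m D x] x p(2) assms(2) by simp
  moreover have "seg_off D n ?p + hgt D n (src D n (hd ?p)) \<le> hgt D m v"
    using seg_top[OF p(1) assms(2)] p(3) x(2) by simp
  ultimately show ?thesis using p x(2) by (intro bexI[of _ ?p]) (auto simp: segs_def)
qed

lemma ex_first_seg:
  assumes "v \<in> vertices D m" "n < m"
  shows "\<exists>p\<in>segs n m v. seg_off D n p = 0"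
proof -
  obtain x where x: "x \<in> inf_paths D" "src D m (x m) = v" "pos D m x = 0"
    using seg_cover[OF assms hgt_pos[OF assms(1)]] by blast
  let ?p = "map x [n..<m]"
  note p = inf_path_seg[OF x(1) assms(2)]
  show ?thesis using p x pos_seg[of n m D x] assms(2) by (intro bexI[of _ ?p]) (auto simp: segs_def)
qed

end

section \<open>Contractions with reordered edges\<close>

lemma strict_mono_le:
  fixes l :: "nat \<Rightarrow> nat"
  assumes "strict_mono l" shows "n \<le> l n"
  using strict_mono_imp_increasing[OF assms] .

locale contracted = proper_obd B for B :: "'e ordered_bratteli" +
  fixes l :: "nat \<Rightarrow> nat" and key :: "nat \<Rightarrow> 'e list \<Rightarrow> nat"
  assumes l_mono: "strict_mono l" and l_0: "l 0 = 0"
    and key_inj: "inj_on (key k) (segs (l k) (l (Suc k)) v)"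
    and key_min: "p \<in> segs (l k) (l (Suc k)) v \<Longrightarrow> q \<in> segs (l k) (l (Suc k)) v \<Longrightarrow>
      seg_off B (l k) p = 0 \<Longrightarrow> key k p \<le> key k q"
    and key_max: "p \<in> segs (l k) (l (Suc k)) v \<Longrightarrow> q \<in> segs (l k) (l (Suc k)) v \<Longrightarrow>
      seg_off B (l k) p + hgt B (l k) (src B (l k) (hd p)) = hgt B (l (Suc k)) v \<Longrightarrow> key k q \<le> key k p"
begin

definition C :: "'e list ordered_bratteli" where
  "C = contraction B l\<lparr>edge_order := (\<lambda>k. {(p, q). p \<in> fin_paths B (l k) (l (Suc k)) \<and>
     q \<in> fin_paths B (l k) (l (Suc k)) \<and> fin_rng B (l (Suc k)) p = fin_rng B (l (Suc k)) q \<and>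
     key k p \<le> key k q})\<rparr>"

lemma C_simps [simp]:
  "width C k = width B (l k)"
  "edges C k = fin_paths B (l k) (l (Suc k))"
  "src C k p = src B (l k) (hd p)"
  "rng C k p = fin_rng B (l (Suc k)) p"
  "(p, q) \<in> edge_order C k \<longleftrightarrow> p \<in> fin_paths B (l k) (l (Suc k)) \<and>
     q \<in> fin_paths B (l k) (l (Suc k)) \<and> fin_rng B (l (Suc k)) p = fin_rng B (l (Suc k)) q \<and>
     key k p \<le> key k q"
  "vertices C k = vertices B (l k)"
  by (simp_all add: C_def contraction_def vertices_def)

lemma l_less [simp]: "l k < l (Suc k)"
  using l_mono by (simp add: strict_mono_def)

lemma l_le: "k \<le> j \<Longrightarrow> l k \<le> l j"
  using l_mono by (simp add: strict_mono_less_eq)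

lemma key_eq:
  assumes "p \<in> fin_paths B (l k) (l (Suc k))" "q \<in> fin_paths B (l k) (l (Suc k))"
    "fin_rng B (l (Suc k)) p = fin_rng B (l (Suc k)) q" "key k p = key k q"
  shows "p = q"
  using inj_onD[OF key_inj[of k "fin_rng B (l (Suc k)) p"], of p q] assms by (simp add: segs_def)

lemma ordered_C: "ordered_bratteli_diagram C"
  unfolding ordered_bratteli_diagram_def
proof (intro conjI allI ballI)
  show "bratteli_diagram C"
    unfolding bratteli_diagram_def
  proof (intro conjI allI ballI)
    show "width C 0 = 1" using width_0 l_0 by simp
    show "finite (edges C n)" for n by simp
    show "src C n e \<in> vertices C n" "rng C n e \<in> vertices C (Suc n)" if "e \<in> edges C n" for n e
      using that fin_path_ends[of e "l n" "l (Suc n)"] by simp_all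
    show "\<exists>e\<in>edges C n. src C n e = v" if v: "v \<in> vertices C n" for n v
    proof -
      obtain y where y: "tail_path B (l n) y" "src B (l n) (y (l n)) = v" using ex_tail_path v by auto
      have "hd (map y [l n..<l (Suc n)]) = y (l n)" using l_less[of n] by (simp add: upt_rec del: l_less)
      then show ?thesis
        using map_tail_path_fin_paths[OF y(1), of "l (Suc n)"] y(2)
        by (intro bexI[of _ "map y [l n..<l (Suc n)]"]) simp_all
    qed
    show "\<exists>e\<in>edges C n. rng C n e = v" if v: "v \<in> vertices C (Suc n)" for n v
      using ex_first_seg[of v "l (Suc n)" "l n"] v by (auto simp: segs_def)
  qed
  show "partial_order_on (edges C n) (edge_order C n)" for n
    unfolding partial_order_on_def preorder_on_def
  proof (intro conjI)
    show "refl_on (edges C n) (edge_order C n)" by (auto simp: refl_on_def)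
    show "trans (edge_order C n)" by (rule transI) auto
    show "antisym (edge_order C n)" by (rule antisymI) (auto intro: key_eq)
    show "edge_order C n \<subseteq> edges C n \<times> edges C n" by auto
  qed
  show "((e, f) \<in> edge_order C n \<or> (f, e) \<in> edge_order C n) = (rng C n e = rng C n f)"
    if "e \<in> edges C n" "f \<in> edges C n" for n e f
    using that by auto
qed

sublocale C: obd C
  by (unfold_locales) (rule ordered_C)

lemma order_modification_C: "order_modification (contraction B l) C"
  unfolding order_modification_def using ordered_C C_def by blast

text \<open>A height does not depend on the order, and by the tiling it satisfies the recursion of
  the contracted diagram.\<close>

lemma hgt_C: "v \<in> vertices B (l k) \<Longrightarrow> hgt C k v = hgt B (l k) v"
proof (induction k arbitrary: v)
  case 0 show ?case by (simp add: l_0)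
next
  case (Suc k)
  have "hgt C (Suc k) v = (\<Sum>p\<in>segs (l k) (l (Suc k)) v. hgt C k (src B (l k) (hd p)))"
    by (simp add: segs_def)
  also have "\<dots> = (\<Sum>p\<in>segs (l k) (l (Suc k)) v. hgt B (l k) (src B (l k) (hd p)))"
    by (intro sum.cong refl Suc.IH) (auto simp: segs_def intro: fin_path_ends)
  also have "\<dots> = hgt B (l (Suc k)) v" by (rule seg_tiling(1)[OF Suc.prems l_less])
  finally show ?case .
qed

lemma off_C:
  assumes p: "p \<in> segs (l k) (l (Suc k)) v"
  shows "off C k p =
    (\<Sum>q\<in>{q\<in>segs (l k) (l (Suc k)) v. key k q < key k p}. hgt B (l k) (src B (l k) (hd q)))"
  unfolding off_def
proof (rule sum.cong)
  show "{g \<in> edges C k. (g, p) \<in> edge_order C k \<and> g \<noteq> p} = {q\<in>segs (l k) (l (Suc k)) v. key k q < key k p}"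
  proof (intro set_eqI iffI)
    fix g assume g: "g \<in> {g \<in> edges C k. (g, p) \<in> edge_order C k \<and> g \<noteq> p}"
    then have "key k g \<noteq> key k p" using key_eq[of g k p] by auto
    then show "g \<in> {q\<in>segs (l k) (l (Suc k)) v. key k q < key k p}"
      using g p by (auto simp: segs_def)
  qed (use p in \<open>auto simp: segs_def\<close>)
  show "hgt C k (src C k x) = hgt B (l k) (src B (l k) (hd x))"
    if "x \<in> {q \<in> segs (l k) (l (Suc k)) v. key k q < key k p}" for x
    using that fin_path_ends(1)[of x "l k" "l (Suc k)"] hgt_C by (auto simp: segs_def)
qed

text \<open>By \<open>key_max\<close> the top segment of a tower is also the largest in the new
  order, and a segment is on top exactly if all its edges are maximal.\<close>

lemma max_edge_C:
  "max_edge C k p \<longleftrightarrow> p \<in> fin_paths B (l k) (l (Suc k)) \<and>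
     (\<forall>i<l (Suc k) - l k. max_edge B (l k + i) (p ! i))"
proof (cases "p \<in> fin_paths B (l k) (l (Suc k))")
  case True
  let ?v = "fin_rng B (l (Suc k)) p"
  have ps: "p \<in> segs (l k) (l (Suc k)) ?v" using True by (simp add: segs_def)
  have "max_edge C k p \<longleftrightarrow> seg_off B (l k) p + hgt B (l k) (src B (l k) (hd p)) = hgt B (l (Suc k)) ?v"
  proof
    assume m: "max_edge C k p"
    obtain q where q: "q \<in> segs (l k) (l (Suc k)) ?v"
      "seg_off B (l k) q + hgt B (l k) (src B (l k) (hd q)) = hgt B (l (Suc k)) ?v"
      using ex_last_seg[OF fin_path_ends(2)[OF True l_less] l_less] by blast
    have "(p, q) \<in> edge_order C k" using key_max[OF q(1) ps q(2)] q(1) True by (simp add: segs_def)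
    then have "q = p" using m q(1) by (simp add: max_edge_def segs_def)
    then show "seg_off B (l k) p + hgt B (l k) (src B (l k) (hd p)) = hgt B (l (Suc k)) ?v" using q(2) by simp
  next
    assume t: "seg_off B (l k) p + hgt B (l k) (src B (l k) (hd p)) = hgt B (l (Suc k)) ?v"
    show "max_edge C k p"
      unfolding max_edge_def
    proof (intro conjI ballI impI)
      fix q assume q: "q \<in> edges C k" "(p, q) \<in> edge_order C k"
      then have "key k q \<le> key k p" using key_max[OF ps _ t, of q] by (simp add: segs_def)
      then show "q = p" using q by (intro key_eq[of q k p]) simp_all
    qed (use True in simp)
  qed
  then show ?thesis using seg_max_iff[OF True l_less] True by simp
qed (simp add: max_edge_def)

lemma min_edge_C:
  "min_edge C k p \<longleftrightarrow> p \<in> fin_paths B (l k) (l (Suc k)) \<and>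
     (\<forall>i<l (Suc k) - l k. min_edge B (l k + i) (p ! i))"
proof (cases "p \<in> fin_paths B (l k) (l (Suc k))")
  case True
  let ?v = "fin_rng B (l (Suc k)) p"
  have ps: "p \<in> segs (l k) (l (Suc k)) ?v" using True by (simp add: segs_def)
  have "min_edge C k p \<longleftrightarrow> seg_off B (l k) p = 0"
  proof
    assume m: "min_edge C k p"
    obtain q where q: "q \<in> segs (l k) (l (Suc k)) ?v" "seg_off B (l k) q = 0"
      using ex_first_seg[OF fin_path_ends(2)[OF True l_less] l_less] by blast
    have "(q, p) \<in> edge_order C k" using key_min[OF q(1) ps q(2)] q(1) True by (simp add: segs_def)
    then have "q = p" using m q(1) by (simp add: min_edge_def segs_def)
    then show "seg_off B (l k) p = 0" using q(2) by simp
  next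
    assume t: "seg_off B (l k) p = 0"
    show "min_edge C k p"
      unfolding min_edge_def
    proof (intro conjI ballI impI)
      fix q assume q: "q \<in> edges C k" "(q, p) \<in> edge_order C k"
      then have "key k p \<le> key k q" using key_min[OF ps _ t, of q] by (simp add: segs_def)
      then show "q = p" using q by (intro key_eq[of q k p]) simp_all
    qed (use True in simp)
  qed
  then show ?thesis using seg_min_iff[OF True] True by simp
qed (simp add: min_edge_def)

section \<open>Grouping the entries of a path into blocks and back\<close>

definition blk :: "nat \<Rightarrow> nat" where
  "blk i = (LEAST k. i < l (Suc k))"

lemma blk_upper: "i < l (Suc (blk i))"
  unfolding blk_def by (rule LeastI[of _ i]) (use strict_mono_le[OF l_mono, of "Suc i"] in simp)

lemma blk_lower: "l (blk i) \<le> i"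
proof (cases "blk i")
  case 0 then show ?thesis by (simp add: l_0)
next
  case (Suc k)
  then have "\<not> i < l (Suc k)" using not_less_Least[of k "\<lambda>k. i < l (Suc k)"] by (simp add: blk_def)
  then show ?thesis using Suc by simp
qed

lemma blk_less_iff: "blk i < k \<longleftrightarrow> i < l k"
proof
  assume "blk i < k"
  then have "l (Suc (blk i)) \<le> l k" by (intro l_le) simp
  then show "i < l k" using blk_upper[of i] by simp
next
  assume i: "i < l k"
  show "blk i < k"
  proof (rule ccontr)
    assume "\<not> blk i < k"
    then have "l k \<le> l (blk i)" by (intro l_le) simp
    then show False using i blk_lower[of i] by simp
  qed
qed

lemma blk_eq: "l k \<le> i \<Longrightarrow> i < l (Suc k) \<Longrightarrow> blk i = k"
  using blk_less_iff[of i k] blk_less_iff[of i "Suc k"] by simp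

abbreviation "PI \<equiv> path_identification l"

definition unblock :: "(nat \<Rightarrow> 'e list) \<Rightarrow> nat \<Rightarrow> 'e" where
  "unblock y i = y (blk i) ! (i - l (blk i))"

lemma unblock_PI: "unblock (PI x) = x"
proof
  fix i
  show "unblock (PI x) i = x i"
    using blk_lower[of i] blk_upper[of i] by (simp add: unblock_def path_identification_def)
qed

lemma PI_inf [simp]:
  assumes "x \<in> inf_paths B" shows "PI x \<in> inf_paths C"
  using inf_path_seg[OF assms l_less] unfolding inf_paths_def
  by (simp add: path_identification_def)

lemma PI_unblock: 
  assumes "y \<in> inf_paths C" shows "PI (unblock y) = y"
proof
  fix k
  have y: "y k \<in> fin_paths B (l k) (l (Suc k))" using assms by (auto simp: inf_paths_def)
  then have len: "length (y k) = l (Suc k) - l k" by (rule fin_paths_length)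
  show "PI (unblock y) k = y k"
  proof (rule nth_equalityI)
    fix i assume "i < length (PI (unblock y) k)"
    then have i: "i < l (Suc k) - l k" by (simp add: path_identification_def)
    have "blk (l k + i) = k" by (rule blk_eq) (use i in simp_all)
    then show "PI (unblock y) k ! i = y k ! i" using i by (simp add: path_identification_def unblock_def)
  qed (simp add: path_identification_def len)
qed

lemma unblock_inf [simp]:
  assumes "y \<in> inf_paths C" shows "unblock y \<in> inf_paths B"
proof -
  have y: "y k \<in> fin_paths B (l k) (l (Suc k))" for k using assms by (auto simp: inf_paths_def)
  have yr: "fin_rng B (l (Suc k)) (y k) = src B (l (Suc k)) (hd (y (Suc k)))" for k
    using assms by (auto simp: inf_paths_def)
  show ?thesis
    unfolding inf_paths_def
  proof (rule CollectI, rule allI)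
    fix i
    define k where "k = blk i"
    define j where "j = i - l k"
    have lk: "l k \<le> i" "i < l (Suc k)" using blk_lower blk_upper by (auto simp: k_def)
    then have i: "i = l k + j" "j < l (Suc k) - l k" by (auto simp: j_def)
    have ui: "unblock y i = y k ! j" by (simp add: unblock_def k_def j_def)
    have e: "y k ! j \<in> edges B (l k + j)" using y[of k] i by (simp add: fin_paths_def)
    have len: "length (y k) = l (Suc k) - l k" using y fin_paths_length by blast
    show "unblock y i \<in> edges B i \<and> rng B i (unblock y i) = src B (Suc i) (unblock y (Suc i))"
    proof (cases "Suc i < l (Suc k)")
      case True
      have "blk (Suc i) = k" using lk True by (intro blk_eq) simp_all
      then have u2: "unblock y (Suc i) = y k ! Suc j"
        using lk by (simp add: unblock_def j_def Suc_diff_le)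
      have "Suc j < l (Suc k) - l k" using True i by simp
      then have "rng B (l k + j) (y k ! j) = src B (Suc (l k + j)) (y k ! Suc j)"
        using y[of k] by (simp add: fin_paths_def)
      then show ?thesis using ui u2 e i by simp
    next
      case False
      then have si: "Suc i = l (Suc k)" using lk by simp
      have b: "blk (Suc i) = Suc k" using si by (intro blk_eq) simp_all
      have "y (Suc k) \<noteq> []" using fin_path_ends(3)[OF y l_less] .
      then have u2: "unblock y (Suc i) = hd (y (Suc k))"
        using b si by (simp add: unblock_def hd_conv_nth)
      have "y k \<noteq> []" using fin_path_ends(3)[OF y l_less] .
      moreover have "length (y k) - 1 = j" using len si i by simp
      ultimately have "last (y k) = y k ! j" by (simp add: last_conv_nth)
      then have "fin_rng B (l (Suc k)) (y k) = rng B i (y k ! j)"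
        using si by (simp add: fin_rng_def flip: si)
      then show ?thesis using ui u2 e i(1) yr[of k] si by simp
    qed
  qed
qed

lemma PI_bij: "bij_betw PI (inf_paths B) (inf_paths C)"
  by (rule bij_betw_byWitness[where f' = unblock]) (auto simp: unblock_PI PI_unblock)

lemma PI_agree:
  assumes "\<forall>i<l n. y i = x i" shows "\<forall>k<n. PI y k = PI x k"
proof (intro allI impI)
  fix k assume "k < n"
  then have "l (Suc k) \<le> l n" by (intro l_le) simp
  then show "PI y k = PI x k" using assms by (auto simp: path_identification_def)
qed

lemma unblock_agree:
  assumes "\<forall>k<n. y k = x k" shows "\<forall>i<l n. unblock y i = unblock x i"
  using assms by (auto simp: unblock_def simp flip: blk_less_iff)

lemma PI_agree_tail:
  assumes "\<forall>i\<ge>l n. y i = x i" shows "\<forall>k\<ge>n. PI y k = PI x k"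
proof (intro allI impI)
  fix k assume "n \<le> k"
  then have "l n \<le> l k" by (rule l_le)
  then show "PI y k = PI x k" using assms by (auto simp: path_identification_def)
qed

lemma unblock_agree_tail:
  assumes "\<forall>k\<ge>n. y k = x k" shows "\<forall>i\<ge>l n. unblock y i = unblock x i"
proof (intro allI impI)
  fix i assume "l n \<le> i"
  then have "n \<le> blk i" using blk_less_iff[of i n] by simp
  then show "unblock y i = unblock x i" using assms by (simp add: unblock_def)
qed

lemma tail_eq_PI:
  fixes x y :: "nat \<Rightarrow> 'e"
  shows "tail_eq (PI x) (PI y) \<longleftrightarrow> tail_eq x y"
proof
  assume "tail_eq (PI x) (PI y)"
  then obtain n where "\<forall>k\<ge>n. PI x k = PI y k" by (auto simp: tail_eq_def)
  from unblock_agree_tail[OF this] show "tail_eq x y" unfolding unblock_PI tail_eq_def by blast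
next
  assume "tail_eq x y"
  then obtain n where n: "\<forall>i\<ge>n. x i = y i" by (auto simp: tail_eq_def)
  have "\<forall>i\<ge>l n. x i = y i" using n strict_mono_le[OF l_mono, of n] by simp
  from PI_agree_tail[OF this] show "tail_eq (PI x) (PI y)" unfolding tail_eq_def by blast
qed

text \<open>Abstract in the edge property, because it serves maximal and minimal edges
  alike.\<close>

lemma edges_PI:
  assumes "\<And>k p. P' k p \<longleftrightarrow> p \<in> fin_paths B (l k) (l (Suc k)) \<and> (\<forall>i<l (Suc k) - l k. P (l k + i) (p ! i))"
    and x: "x \<in> inf_paths B"
  shows "(\<forall>k. P' k (PI x k)) \<longleftrightarrow> (\<forall>i. P i (x i))"
proof
  assume a: "\<forall>k. P' k (PI x k)"
  show "\<forall>i. P i (x i)"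
  proof
    fix i
    define k where "k = blk i"
    define j where "j = i - l k"
    have lk: "l k \<le> i" "i < l (Suc k)" using blk_lower blk_upper by (auto simp: k_def)
    then have i: "i = l k + j" "j < l (Suc k) - l k" by (auto simp: j_def)
    have "P (l k + j) (PI x k ! j)" using a i assms(1) by blast
    then show "P i (x i)" using i by (simp add: path_identification_def)
  qed
next
  assume a: "\<forall>i. P i (x i)"
  show "\<forall>k. P' k (PI x k)"
    using a inf_path_seg(1)[OF x l_less] unfolding assms(1) by (simp add: path_identification_def)
qed

lemma max_path_PI:
  assumes "x \<in> inf_paths B"
  shows "max_path C (PI x) \<longleftrightarrow> max_path B x"
  using edges_PI[OF max_edge_C assms] assms by (simp add: max_path_def del: max_path_iff)

lemma min_path_PI:
  assumes "x \<in> inf_paths B"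
  shows "min_path C (PI x) \<longleftrightarrow> min_path B x"
  using edges_PI[OF min_edge_C assms] assms by (simp add: min_path_def del: min_path_iff)

lemma max_path_C_iff: "max_path C y \<longleftrightarrow> y = PI xmax"
proof
  assume y: "max_path C y"
  then have yi: "y \<in> inf_paths C" by (simp add: max_path_def)
  have "max_path B (unblock y)" using max_path_PI[OF unblock_inf[OF yi]] PI_unblock[OF yi] y by simp
  then have "unblock y = xmax" by simp
  then show "y = PI xmax" using PI_unblock[OF yi] by simp
next
  assume "y = PI xmax"
  then show "max_path C y" using max_path_PI[OF xmax_inf] by simp
qed

lemma min_path_C_iff: "min_path C y \<longleftrightarrow> y = PI xmin"
proof
  assume y: "min_path C y"
  then have yi: "y \<in> inf_paths C" by (simp add: min_path_def)
  have "min_path B (unblock y)" using min_path_PI[OF unblock_inf[OF yi]] PI_unblock[OF yi] y by simp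
  then have "unblock y = xmin" by simp
  then show "y = PI xmin" using PI_unblock[OF yi] by simp
next
  assume "y = PI xmin"
  then show "min_path C y" using min_path_PI[OF xmin_inf] by simp
qed

lemma properly_ordered_C: "properly_ordered C"
  unfolding properly_ordered_def max_path_C_iff min_path_C_iff by simp

sublocale C: proper_obd C
  by unfold_locales (rule properly_ordered_C)

lemma C_xmax: "C.xmax = PI xmax"
proof -
  have "max_path C C.xmax" by (rule C.max_path_iff[THEN iffD2]) (rule refl)
  then show ?thesis by (rule max_path_C_iff[THEN iffD1])
qed

lemma C_xmin: "C.xmin = PI xmin"
proof -
  have "min_path C C.xmin" by (rule C.min_path_iff[THEN iffD2]) (rule refl)
  then show ?thesis by (rule min_path_C_iff[THEN iffD1])
qed

text \<open>\<open>orbit_rel\<close> mentions only cofinality and the two extreme paths, and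
  \<open>PI\<close> respects both.\<close>

lemma orbit_rel_PI: "C.orbit_rel (PI x) (PI y) \<longleftrightarrow> orbit_rel x y"
  by (simp add: C.orbit_rel_def orbit_rel_def C_xmax C_xmin tail_eq_PI)

lemma PI_continuous: "continuous_map (path_space B) (path_space C) PI"
proof (rule continuous_map_path_space)
  show "\<exists>m. \<forall>y\<in>inf_paths B. (\<forall>i<m. y i = x i) \<longrightarrow> (\<forall>i<n. PI y i = PI x i)" for x :: "nat \<Rightarrow> 'e" and n
    using PI_agree by (intro exI[of _ "l n"]) blast
qed simp

lemma PI_homeomorphic_map:
  assumes "compact_space (path_space B)"
  shows "homeomorphic_map (path_space B) (path_space C) PI"
  by (rule continuous_imp_homeomorphic_map[OF PI_continuous])
    (use assms PI_bij in \<open>auto simp: bij_betw_def Hausdorff_path_space\<close>)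

lemma compact_C:
  assumes "compact_space (path_space B)"
  shows "compact_space (path_space C)"
  using homeomorphic_map_imp_homeomorphic_space[OF PI_homeomorphic_map[OF assms]]
    homeomorphic_compact_space assms by blast

lemma orbit_equivalence_PI:
  assumes "compact_space (path_space B)"
  shows "orbit_equivalence (path_space B) (vershik B) (path_space C) (vershik C) PI"
  unfolding orbit_equivalence_def
proof (intro conjI ballI)
  show "homeomorphic_map (path_space B) (path_space C) PI" using PI_homeomorphic_map[OF assms] .
  fix x assume "x \<in> topspace (path_space B)"
  then have x: "x \<in> inf_paths B" by simp
  have bB: "bij_betw (vershik B) (topspace (path_space B)) (topspace (path_space B))"
    and bC: "bij_betw (vershik C) (topspace (path_space C)) (topspace (path_space C))"
    using vershik_bij C.vershik_bij by simp_all
  show "PI ` system_orbit (path_space B) (vershik B) x = system_orbit (path_space C) (vershik C) (PI x)"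
  proof (intro equalityI subsetI)
    fix w assume "w \<in> PI ` system_orbit (path_space B) (vershik B) x"
    then obtain y where y: "y \<in> system_orbit (path_space B) (vershik B) x" "w = PI y" by blast
    moreover have "system_orbit (path_space B) (vershik B) x \<subseteq> inf_paths B"
      using system_orbit_subset[OF bB, of x] x by simp
    ultimately have yi: "y \<in> inf_paths B" by blast
    then show "w \<in> system_orbit (path_space C) (vershik C) (PI x)"
      using y orbit_vershik_iff[OF x yi] C.orbit_vershik_iff[of "PI x" "PI y"] x orbit_rel_PI by simp
  next
    fix w assume w: "w \<in> system_orbit (path_space C) (vershik C) (PI x)"
    moreover have "system_orbit (path_space C) (vershik C) (PI x) \<subseteq> inf_paths C"
      using system_orbit_subset[OF bC, of "PI x"] x by simp
    ultimately have wi: "w \<in> inf_paths C" by blast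
    let ?y = "unblock w"
    have "PI ?y = w" using PI_unblock[OF wi] .
    moreover have "?y \<in> system_orbit (path_space B) (vershik B) x"
      using w orbit_vershik_iff[OF x unblock_inf[OF wi]] C.orbit_vershik_iff[of "PI x" w] x wi
        orbit_rel_PI[of x ?y] PI_unblock[OF wi] by simp
    ultimately show "w \<in> PI ` system_orbit (path_space B) (vershik B) x" by force
  qed
qed

text \<open>The maximal path, where both cocycles are \<open>1\<close>, is the only point where they may fail
  to be locally constant.\<close>

definition cocycle_B :: "(nat \<Rightarrow> 'e) \<Rightarrow> int" where
  "cocycle_B x = (if x = xmax then 1 else
     let n = Suc (LEAST i. \<not> max_edge B i (x i)) in
       int (pos C n (PI (vershik B x))) - int (pos C n (PI x)))"

definition cocycle_C :: "(nat \<Rightarrow> 'e) \<Rightarrow> int" where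
  "cocycle_C x = (if x = xmax then 1 else
     let n = Suc (LEAST k. \<not> max_edge C k (PI x k)) in
       int (pos B (l n) (unblock (vershik C (PI x)))) - int (pos B (l n) x))"

lemma int_iterate_1: "int_iterate Y S 1 y = S y"
  by (simp add: int_iterate_def)

lemma PI_vershik_cocycle:
  assumes x: "x \<in> inf_paths B"
  shows "PI (vershik B x) = int_iterate (path_space C) (vershik C) (cocycle_B x) (PI x)"
proof (cases "x = xmax")
  case True
  then show ?thesis using C.vershik_xmax by (simp add: cocycle_B_def int_iterate_1 C_xmax C_xmin)
next
  case False
  define n where "n = Suc (LEAST i. \<not> max_edge B i (x i))"
  have "\<exists>i. \<not> max_edge B i (x i)" using False eq_xmax_iff[OF x] by blast
  then have "\<not> max_edge B (n - 1) (x (n - 1))" unfolding n_def by (simp, rule LeastI_ex)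
  then have "\<exists>i<n. \<not> max_edge B i (x i)" unfolding n_def by (metis diff_Suc_1 lessI)
  then have "\<forall>i\<ge>n. vershik B x i = x i" using vershik_nonmax[OF x] by blast
  \<comment> \<open>Since \<open>n \<le> l n\<close>, agreement beyond entry \<open>n\<close>
    becomes agreement beyond block \<open>n\<close>, and the time between the two points can be
    measured in the reordered towers.\<close>
  then have "\<forall>i\<ge>l n. vershik B x i = x i" using strict_mono_le[OF l_mono, of n] by simp
  then have ag: "\<forall>k\<ge>n. PI (vershik B x) k = PI x k" by (rule PI_agree_tail)
  obtain a b where ab: "(vershik C ^^ a) (PI x) = (vershik C ^^ b) (PI (vershik B x))"
    "int a - int b = int (pos C n (PI (vershik B x))) - int (pos C n (PI x))"
    using C.vershik_funpow_diff[of "PI x" "PI (vershik B x)" n] x ag by auto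
  have "cocycle_B x = int a - int b" using False ab(2) by (simp add: cocycle_B_def n_def Let_def)
  then show ?thesis
    using int_iterate_diff_eq_iff[of "vershik C" "path_space C" "PI x" "PI (vershik B x)" a b]
      C.vershik_bij x ab(1) by simp
qed

lemma vershik_C_cocycle:
  assumes x: "x \<in> inf_paths B"
  shows "int_iterate (path_space B) (vershik B) (cocycle_C x) x = unblock (vershik C (PI x))"
proof (cases "x = xmax")
  case True
  then have "vershik C (PI x) = PI xmin" using C.vershik_xmax by (simp add: C_xmax C_xmin)
  then show ?thesis using True by (simp add: cocycle_C_def int_iterate_1 unblock_PI)
next
  case False
  define n where "n = Suc (LEAST k. \<not> max_edge C k (PI x k))"
  let ?y = "unblock (vershik C (PI x))"
  have ne: "PI x \<noteq> C.xmax" using False C_xmax unblock_PI by metis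
  have "\<exists>i. \<not> max_edge C i (PI x i)" using ne C.eq_xmax_iff[OF PI_inf[OF x]] by blast
  then have "\<not> max_edge C (n - 1) (PI x (n - 1))" unfolding n_def by (simp, rule LeastI_ex)
  then have "\<exists>i<n. \<not> max_edge C i (PI x i)" unfolding n_def by (metis diff_Suc_1 lessI)
  then have "\<forall>i\<ge>n. vershik C (PI x) i = PI x i" using C.vershik_nonmax[OF PI_inf[OF x]] by blast
  then have "\<forall>i\<ge>l n. ?y i = unblock (PI x) i" by (rule unblock_agree_tail)
  then have ag: "\<forall>i\<ge>l n. ?y i = x i" unfolding unblock_PI .
  have yi: "?y \<in> inf_paths B" using x by simp
  obtain a b where ab: "(vershik B ^^ a) x = (vershik B ^^ b) ?y"
    "int a - int b = int (pos B (l n) ?y) - int (pos B (l n) x)"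
    using vershik_funpow_diff[OF x yi, of "l n"] ag by auto
  have "cocycle_C x = int a - int b" using False ab(2) by (simp add: cocycle_C_def n_def Let_def)
  then show ?thesis
    using int_iterate_diff_eq_iff[of "vershik B" "path_space B" x ?y a b] vershik_bij x yi ab(1) by simp
qed

lemma Least_nonmax_cong:
  assumes "\<exists>i. \<not> P i (x i)" and "\<forall>i<Suc (LEAST i. \<not> P i (x i)). y i = x i"
  shows "(LEAST i. \<not> P i (y i)) = (LEAST i. \<not> P i (x i))"
proof (rule Least_equality)
  have "\<not> P (LEAST i. \<not> P i (x i)) (x (LEAST i. \<not> P i (x i)))" using LeastI_ex[OF assms(1)] .
  then show "\<not> P (LEAST i. \<not> P i (x i)) (y (LEAST i. \<not> P i (x i)))" using assms(2) by simp
  fix j assume j: "\<not> P j (y j)"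
  show "(LEAST i. \<not> P i (x i)) \<le> j"
  proof (rule ccontr)
    assume n: "\<not> (LEAST i. \<not> P i (x i)) \<le> j"
    then have "y j = x j" using assms(2) by simp
    then show False using j n Least_le[of "\<lambda>i. \<not> P i (x i)" j] by simp
  qed
qed

text \<open>The first non-maximal edge fixes \<open>n\<close>. The two levels involve only
  \<open>n\<close> blocks, that is \<open>l n\<close> entries, and these entries of the image are
  determined by the same entries of the path.\<close>

lemma cocycle_B_locally:
  assumes x: "x \<in> inf_paths B" and ne: "x \<noteq> xmax"
  shows "\<exists>m. \<forall>y\<in>inf_paths B. (\<forall>i<m. y i = x i) \<longrightarrow> cocycle_B y = cocycle_B x"
proof -
  define n where "n = Suc (LEAST i. \<not> max_edge B i (x i))"
  have ex: "\<exists>i. \<not> max_edge B i (x i)" using ne eq_xmax_iff[OF x] by blast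
  then have "\<not> max_edge B (n - 1) (x (n - 1))" unfolding n_def by (simp, rule LeastI_ex)
  then have exn: "\<exists>i<n. \<not> max_edge B i (x i)" unfolding n_def by (metis diff_Suc_1 lessI)
  have nl: "n \<le> l n" using strict_mono_le[OF l_mono] .
  then have exl: "\<exists>i<l n. \<not> max_edge B i (x i)" using exn by (meson less_le_trans)
  show ?thesis
  proof (intro exI[of _ "l n"] ballI impI)
    fix y assume y: "y \<in> inf_paths B" and a: "\<forall>i<l n. y i = x i"
    have L: "(LEAST i. \<not> max_edge B i (y i)) = (LEAST i. \<not> max_edge B i (x i))"
      by (rule Least_nonmax_cong[where P = "max_edge B" and x = x and y = y, OF ex]) (use a nl in \<open>simp add: n_def\<close>)
    have "\<exists>i. \<not> max_edge B i (y i)" using exl a by metis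
    then have "y \<noteq> xmax" using eq_xmax_iff[OF y] by blast
    moreover have "\<forall>k<n. PI y k = PI x k" using PI_agree[OF a] .
    then have "pos C n (PI y) = pos C n (PI x)" by (intro pos_cong) simp
    moreover have "\<forall>i<l n. vershik B y i = vershik B x i" using vershik_locally[OF x exl y a] .
    then have "\<forall>k<n. PI (vershik B y) k = PI (vershik B x) k" by (rule PI_agree)
    then have "pos C n (PI (vershik B y)) = pos C n (PI (vershik B x))" by (intro pos_cong) simp
    ultimately show "cocycle_B y = cocycle_B x" using ne L by (simp add: cocycle_B_def Let_def n_def)
  qed
qed

lemma cocycle_C_locally:
  assumes x: "x \<in> inf_paths B" and ne: "x \<noteq> xmax"
  shows "\<exists>m. \<forall>y\<in>inf_paths B. (\<forall>i<m. y i = x i) \<longrightarrow> cocycle_C y = cocycle_C x"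
proof -
  define n where "n = Suc (LEAST k. \<not> max_edge C k (PI x k))"
  have ne': "PI x \<noteq> C.xmax" using ne C_xmax unblock_PI by metis
  have ex: "\<exists>i. \<not> max_edge C i (PI x i)" using ne' C.eq_xmax_iff[OF PI_inf[OF x]] by blast
  then have "\<not> max_edge C (n - 1) (PI x (n - 1))" unfolding n_def by (simp, rule LeastI_ex)
  then have exn: "\<exists>i<n. \<not> max_edge C i (PI x i)" unfolding n_def by (metis diff_Suc_1 lessI)
  show ?thesis
  proof (intro exI[of _ "l n"] ballI impI)
    fix y assume y: "y \<in> inf_paths B" and a: "\<forall>i<l n. y i = x i"
    have ag: "\<forall>k<n. PI y k = PI x k" using PI_agree[OF a] .
    have L: "(LEAST k. \<not> max_edge C k (PI y k)) = (LEAST k. \<not> max_edge C k (PI x k))"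
      by (rule Least_nonmax_cong[where P = "max_edge C" and x = "PI x" and y = "PI y", OF ex]) (use ag in \<open>simp add: n_def\<close>)
    have "\<exists>i. \<not> max_edge C i (PI y i)" using exn ag by metis
    then have "PI y \<noteq> C.xmax" using C.eq_xmax_iff[OF PI_inf[OF y]] by blast
    then have "y \<noteq> xmax" using C_xmax by metis
    moreover have "pos B (l n) y = pos B (l n) x" using a by (intro pos_cong) simp
    moreover have "\<forall>k<n. vershik C (PI y) k = vershik C (PI x) k"
      using C.vershik_locally[OF PI_inf[OF x] exn PI_inf[OF y] ag] .
    then have "\<forall>i<l n. unblock (vershik C (PI y)) i = unblock (vershik C (PI x)) i"
      by (rule unblock_agree)
    then have "pos B (l n) (unblock (vershik C (PI y))) = pos B (l n) (unblock (vershik C (PI x)))"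
      by (intro pos_cong) simp
    ultimately show "cocycle_C y = cocycle_C x" using ne L by (simp add: cocycle_C_def Let_def n_def)
  qed
qed

lemma strong_orbit_equivalence_PI:
  assumes cpt: "compact_space (path_space B)" and h: "conjugacy X T (path_space B) (vershik B) h"
    and T: "bij_betw T (topspace X) (topspace X)"
  shows "strong_orbit_equivalence X T (path_space C) (vershik C) (PI \<circ> h)"
proof -
  have hh: "homeomorphic_map X (path_space B) h" and hT: "\<And>x. x \<in> topspace X \<Longrightarrow> h (T x) = vershik B (h x)"
    using h by (auto simp: conjugacy_def)
  have hb: "bij_betw h (topspace X) (inf_paths B)" using homeomorphic_map_bij_betw[OF hh] by simp
  have bB: "bij_betw (vershik B) (topspace (path_space B)) (topspace (path_space B))" using vershik_bij by simp
  have hx: "h x \<in> inf_paths B" if "x \<in> topspace X" for x using bij_betwE[OF hb] that by blast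
  have it: "(T ^^ n) x \<in> topspace X \<and> h ((T ^^ n) x) = (vershik B ^^ n) (h x)" if "x \<in> topspace X" for n x
    using that hT bij_betwE[OF T] by (induction n) auto
  have iter: "h (int_iterate X T k x) = int_iterate (path_space B) (vershik B) k (h x)"
    and iter_in: "int_iterate X T k x \<in> topspace X"
    if x: "x \<in> topspace X" for k x
  proof -
    obtain a b where k: "k = int a - int b" using int_diff_cases .
    have "int_iterate X T k x \<in> system_orbit X T x" by (simp add: system_orbit_def)
    then show y: "int_iterate X T k x \<in> topspace X" using system_orbit_subset[OF T x] by blast
    have "(T ^^ a) x = (T ^^ b) (int_iterate X T k x)"
      using int_iterate_diff_eq_iff[OF T x y, of a b] k by simp
    then have "(vershik B ^^ a) (h x) = (vershik B ^^ b) (h (int_iterate X T k x))"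
      using it[OF x, of a] it[OF y, of b] by simp
    then show "h (int_iterate X T k x) = int_iterate (path_space B) (vershik B) k (h x)"
      using int_iterate_diff_eq_iff[OF bB, of "h x" "h (int_iterate X T k x)" a b] hx x y k by simp
  qed
  have orbh: "h ` system_orbit X T x = system_orbit (path_space B) (vershik B) (h x)" if "x \<in> topspace X" for x
    using iter[OF that] by (simp add: system_orbit_def image_image)
  have oe: "orbit_equivalence X T (path_space C) (vershik C) (PI \<circ> h)"
    unfolding orbit_equivalence_def
  proof (intro conjI ballI)
    show "homeomorphic_map X (path_space C) (PI \<circ> h)"
      using homeomorphic_map_compose[OF hh PI_homeomorphic_map[OF cpt]] .
    fix x assume x: "x \<in> topspace X"
    have "(PI \<circ> h) ` system_orbit X T x = PI ` (h ` system_orbit X T x)" by (simp only: image_comp)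
    also have "\<dots> = system_orbit (path_space C) (vershik C) (PI (h x))"
      using orbit_equivalence_PI[OF cpt] hx[OF x] unfolding orbh[OF x] by (simp add: orbit_equivalence_def)
    finally show "(PI \<circ> h) ` system_orbit X T x = system_orbit (path_space C) (vershik C) ((PI \<circ> h) x)"
      by simp
  qed
  have disc: "at_most_one_discontinuity X (\<lambda>x. c (h x))"
    if c: "\<And>x. x \<in> inf_paths B \<Longrightarrow> x \<noteq> xmax \<Longrightarrow>
      \<exists>m. \<forall>y\<in>inf_paths B. (\<forall>i<m. y i = x i) \<longrightarrow> c y = c x" for c :: "(nat \<Rightarrow> 'e) \<Rightarrow> int"
    unfolding at_most_one_discontinuity_def
  proof (intro exI subsetI)
    fix x assume "x \<in> {x \<in> topspace X. \<not> topcontinuous_at X (discrete_topology UNIV) (\<lambda>x. c (h x)) x}"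
    then have x: "x \<in> topspace X" and nc: "\<not> topcontinuous_at X (discrete_topology UNIV) (\<lambda>x. c (h x)) x"
      by auto
    have "h x = xmax"
    proof (rule ccontr)
      assume "h x \<noteq> xmax"
      then obtain m where m: "\<forall>y\<in>inf_paths B. (\<forall>i<m. y i = h x i) \<longrightarrow> c y = c (h x)"
        using c[OF hx[OF x]] by blast
      let ?U = "{y \<in> topspace X. h y \<in> {z \<in> inf_paths B. \<forall>i<m. z i = h x i}}"
      have "openin (path_space B) {z \<in> inf_paths B. \<forall>i<m. z i = h x i}"
        by (rule openin_cylinder[where n = m]) auto
      then have "openin X ?U"
        using homeomorphic_imp_continuous_map[OF hh] unfolding continuous_map_def by blast
      moreover have "x \<in> ?U" using x hx by simp
      moreover have "\<forall>y\<in>?U. c (h y) = c (h x)" using m by blast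
      ultimately have "topcontinuous_at X (discrete_topology UNIV) (\<lambda>x. c (h x)) x"
        unfolding topcontinuous_at_def
      proof (intro conjI allI impI)
        fix V assume V: "openin (discrete_topology UNIV) V \<and> c (h x) \<in> V"
        have "\<forall>y\<in>?U. c (h y) \<in> V"
        proof
          fix y assume "y \<in> ?U"
          then have "c (h y) = c (h x)" using \<open>\<forall>y\<in>?U. c (h y) = c (h x)\<close> by blast
          then show "c (h y) \<in> V" using V by simp
        qed
        then show "\<exists>U. openin X U \<and> x \<in> U \<and> (\<forall>y\<in>U. c (h y) \<in> V)"
          using \<open>openin X ?U\<close> \<open>x \<in> ?U\<close> by blast
      qed (use x in auto)
      then show False using nc by blast
    qed
    then show "x \<in> {inv_into (topspace X) h xmax}"
      using hb x by (metis bij_betw_inv_into_left singletonI)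
  qed
  have 1: "\<forall>x\<in>topspace X. (PI \<circ> h) (T x) = int_iterate (path_space C) (vershik C) (cocycle_B (h x)) ((PI \<circ> h) x)"
    using hT PI_vershik_cocycle hx by simp
  have 2: "\<forall>x\<in>topspace X. (PI \<circ> h) (int_iterate X T (cocycle_C (h x)) x) = vershik C ((PI \<circ> h) x)"
    using iter vershik_C_cocycle hx PI_unblock by simp
  have 3: "at_most_one_discontinuity X (\<lambda>x. cocycle_B (h x))"
    by (rule disc) (rule cocycle_B_locally)
  have 4: "at_most_one_discontinuity X (\<lambda>x. cocycle_C (h x))"
    by (rule disc) (rule cocycle_C_locally)
  show ?thesis
    unfolding strong_orbit_equivalence_def
    by (intro conjI exI[of _ "\<lambda>x. cocycle_B (h x)"] exI[of _ "\<lambda>x. cocycle_C (h x)"] oe 1 2 3 4)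
qed

end

section \<open>Continuous eigenvalues\<close>

text \<open>An eighth of a turn is the angle \<open>pi / 4\<close>. The real part of the difference
  already exceeds \<open>1 - cos (pi / 4)\<close> or equals it unless the angle is smaller than that
  modulo a full turn.\<close>

lemma cis_near_one:
  fixes t :: real
  assumes "cmod (cis (2 * pi * t) - 1) < 1 - cos (pi / 4)"
  shows "\<exists>j::int. \<bar>t - j\<bar> < 1 / 8"
proof (intro exI)
  define s where "s = t - of_int (round t)"
  have s: "\<bar>s\<bar> \<le> 1 / 2" using of_int_round_abs_le[of t] by (simp add: s_def abs_minus_commute)
  have "cos (2 * pi * t) = cos (2 * pi * s + 2 * pi * of_int (round t))"
    by (simp add: s_def algebra_simps)
  also have "\<dots> = cos (2 * pi * s)"
    using cos_int_2pin[of "round t"] sin_int_2pin[of "round t"] by (simp add: cos_add)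
  finally have c: "cos (2 * pi * t) = cos (2 * pi * \<bar>s\<bar>)" by (cases "0 \<le> s") auto
  have "1 - cos (2 * pi * t) \<le> cmod (cis (2 * pi * t) - 1)"
    using abs_Re_le_cmod[of "cis (2 * pi * t) - 1"] by simp
  then have "cos (pi / 4) < cos (2 * pi * \<bar>s\<bar>)" using assms c by simp
  moreover have "2 * pi * \<bar>s\<bar> \<le> pi" using s mult_left_mono[of "\<bar>s\<bar>" "1/2" "2 * pi"] by simp
  moreover have "cos (2 * pi * \<bar>s\<bar>) \<le> cos (pi / 4)" if "pi / 4 \<le> 2 * pi * \<bar>s\<bar>" "2 * pi * \<bar>s\<bar> \<le> pi"
    using that by (intro cos_monotone_0_pi_le) auto
  ultimately have "2 * pi * \<bar>s\<bar> < pi / 4" by (meson not_less)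
  then have "pi * \<bar>s\<bar> < pi * (1 / 8)" by simp
  then show "\<bar>t - of_int (round t)\<bar> < 1 / 8" unfolding s_def[symmetric] by (simp only: mult_less_cancel_left_pos[OF pi_gt_zero])
qed

text \<open>Continuity in discrete form: from within \<open>1 / 8\<close> of 0, a step shorter than
  \<open>1 / 4\<close> ends below \<open>3 / 8\<close> in absolute value, and the only integer
  within \<open>1 / 8\<close> of such a point is 0.\<close>

lemma near_int_chain:
  fixes x :: "nat \<Rightarrow> real"
  assumes "x 0 = 0" and step: "\<And>i. i < n \<Longrightarrow> \<bar>x (Suc i) - x i\<bar> < 1 / 4"
    and near: "\<And>i. i \<le> n \<Longrightarrow> \<exists>j::int. \<bar>x i - j\<bar> < 1 / 8"
  shows "i \<le> n \<Longrightarrow> \<bar>x i\<bar> < 1 / 8"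
proof (induction i)
  case 0 show ?case using assms(1) by simp
next
  case (Suc i)
  then have "\<bar>x i\<bar> < 1 / 8" "\<bar>x (Suc i) - x i\<bar> < 1 / 4" using step by simp_all
  then have b: "\<bar>x (Suc i)\<bar> < 3 / 8" by linarith
  obtain j :: int where j: "\<bar>x (Suc i) - j\<bar> < 1 / 8" using near[of "Suc i"] Suc.prems by blast
  then have "\<bar>of_int j\<bar> < (1::real)" using b by linarith
  then have "j = 0" by linarith
  then show ?case using j by simp
qed

text \<open>The multiples of \<open>x - P\<close> move in steps below \<open>1 / 8\<close>, so they
  stay near 0 by \<open>near_int_chain\<close>; the last of them bounds \<open>x - P\<close> with a
  gain of the factor \<open>r\<close>.\<close>

lemma near_int_multiples:
  fixes x :: real
  assumes "\<And>i. i \<le> r \<Longrightarrow> \<exists>j::int. \<bar>x * real i - j\<bar> < 1 / 8" and "1 \<le> r"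
  shows "\<exists>P::int. \<bar>x - P\<bar> * real r < 1 / 8"
proof -
  obtain P :: int where P: "\<bar>x - P\<bar> < 1 / 8" using assms(1)[of 1] assms(2) by auto
  have "\<bar>(x - P) * real r\<bar> < 1 / 8"
  proof (rule near_int_chain[of "\<lambda>i. (x - P) * real i" r])
    show "\<bar>(x - P) * real (Suc i) - (x - P) * real i\<bar> < 1 / 4" for i
      using P by (simp add: algebra_simps)
    show "\<exists>j::int. \<bar>(x - P) * real i - j\<bar> < 1 / 8" if i: "i \<le> r" for i
    proof -
      obtain j :: int where j: "\<bar>x * real i - j\<bar> < 1 / 8" using assms(1)[OF i] by blast
      have "(x - P) * real i - of_int (j - P * int i) = x * real i - j" by (simp add: algebra_simps)
      then show ?thesis using j by metis
    qed
  qed simp_all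
  then show ?thesis by (auto simp: abs_mult)
qed

lemma ex_pred_card:
  fixes a :: "'p \<Rightarrow> nat"
  assumes "finite Q" "inj_on a Q" "i < card Q"
  shows "\<exists>p\<in>Q. card {q\<in>Q. a q < a p} = i"
proof -
  obtain p where "p \<in> Q" "card {q\<in>Q. a q < a p} \<le> i" "i < card {q\<in>Q. a q < a p} + 1"
    using key_prefix_sum_cover[OF assms(1,2), of i "\<lambda>_. 1"] assms(3) by auto
  then show ?thesis by (intro bexI[of _ p]) simp_all
qed

lemma Ints_abs_less_1: "x \<in> \<int> \<Longrightarrow> \<bar>x::real\<bar> < 1 \<Longrightarrow> x = 0"
  by (auto elim!: Ints_cases)

section \<open>Growth of the heights and recurrence of the vertices\<close>

locale positive_obd = proper_obd B for B :: "'e ordered_bratteli" +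
  assumes incidence_pos: "1 \<le> n \<Longrightarrow> u \<in> vertices B n \<Longrightarrow> v \<in> vertices B (Suc n) \<Longrightarrow> 0 < incidence B n u v"
    and infinite_paths: "infinite (inf_paths B)"
begin

lemma ex_edge:
  assumes u: "u \<in> vertices B n" and v: "v \<in> vertices B (Suc n)"
  shows "\<exists>e\<in>edges B n. src B n e = u \<and> rng B n e = v"
proof (cases "n = 0")
  case True
  obtain e where e: "e \<in> edges B n" "rng B n e = v" using in_edge[OF v] by blast
  have "src B n e = u" using src_vertex[OF e(1)] u True width_0 by (simp add: vertices_def)
  then show ?thesis using e by blast
next
  case False
  then have "0 < card {e \<in> edges B n. src B n e = u \<and> rng B n e = v}"
    using incidence_pos[OF _ u v] by (simp add: incidence_def)
  then have "{e \<in> edges B n. src B n e = u \<and> rng B n e = v} \<noteq> {}" by (metis card.empty less_irrefl)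
  then show ?thesis by blast
qed

lemma finite_vertices [simp]: "finite (vertices B n)"
  by (simp add: vertices_def)

definition total :: "nat \<Rightarrow> nat" where
  "total n = (\<Sum>u\<in>vertices B n. hgt B n u)"

text \<open>Every vertex of level \<open>n\<close> has an edge to \<open>v\<close>, so the tower
  over \<open>v\<close> contains a copy of each tower of level \<open>n\<close>.\<close>

lemma total_le_hgt:
  assumes v: "v \<in> vertices B (Suc n)"
  shows "total n \<le> hgt B (Suc n) v"
proof -
  have "\<forall>u\<in>vertices B n. \<exists>e. e \<in> edges B n \<and> src B n e = u \<and> rng B n e = v"
    using ex_edge[OF _ v] by blast
  then obtain e where e: "\<And>u. u \<in> vertices B n \<Longrightarrow> e u \<in> edges B n \<and> src B n (e u) = u \<and> rng B n (e u) = v"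
    by metis
  have inj: "inj_on e (vertices B n)" by (rule inj_onI) (metis e)
  have "total n = (\<Sum>u\<in>vertices B n. hgt B n (src B n (e u)))"
    unfolding total_def using e by (intro sum.cong) auto
  also have "\<dots> = (\<Sum>f\<in>e ` vertices B n. hgt B n (src B n f))" using inj by (simp add: sum.reindex)
  also have "\<dots> \<le> hgt B (Suc n) v" using e by (simp, intro sum_mono2) auto
  finally show ?thesis .
qed

lemma hgt_le_total: "v \<in> vertices B n \<Longrightarrow> hgt B n v \<le> total n"
  unfolding total_def by (rule member_le_sum) auto

lemma total_mono: "i \<le> j \<Longrightarrow> total i \<le> total j"
proof (rule lift_Suc_mono_le[of total])
  fix n
  obtain v where v: "v \<in> vertices B (Suc n)" using vertices_nonempty by blast
  show "total n \<le> total (Suc n)" using total_le_hgt[OF v] hgt_le_total[OF v] by simp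
qed

text \<open>\<open>N\<close> different paths have different initial segments of a common length
  \<open>n\<close>, and \<open>total n\<close> counts such segments.\<close>

lemma total_unbounded: "\<exists>n. N \<le> total n"
proof -
  obtain F where F: "finite F" "card F = N" "F \<subseteq> inf_paths B"
    using infinite_arbitrarily_large[OF infinite_paths] by blast
  define d :: "(nat \<Rightarrow> 'e) \<Rightarrow> (nat \<Rightarrow> 'e) \<Rightarrow> nat" where "d x y = (LEAST i. x i \<noteq> y i)" for x y
  define A where "A = insert 0 ((\<lambda>(x, y). d x y) ` (F \<times> F))"
  define n where "n = Suc (Max A)"
  have fA: "finite A" using F(1) by (simp add: A_def)
  have "inj_on (\<lambda>x. (src B n (x n), pos B n x)) F"
  proof (rule inj_onI)
    fix x y assume x: "x \<in> F" and y: "y \<in> F"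
      and e: "(src B n (x n), pos B n x) = (src B n (y n), pos B n y)"
    then have ag: "\<forall>i<n. x i = y i" using pos_inj[of x y n] F(3) by auto
    show "x = y"
    proof (rule ccontr)
      assume "x \<noteq> y"
      then have "\<exists>i. x i \<noteq> y i" by auto
      then have "x (d x y) \<noteq> y (d x y)" unfolding d_def by (rule LeastI_ex)
      moreover have "d x y \<in> A" using x y by (auto simp: A_def)
      then have "d x y < n" using Max_ge[OF fA] by (simp add: n_def less_Suc_eq_le)
      ultimately show False using ag by blast
    qed
  qed
  moreover have "(\<lambda>x. (src B n (x n), pos B n x)) ` F \<subseteq> (SIGMA u:vertices B n. {..<hgt B n u})"
  proof (rule image_subsetI)
    fix x assume "x \<in> F"
    then have x: "x \<in> inf_paths B" using F(3) by blast
    then have "x n \<in> edges B n" by (simp add: inf_paths_def)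
    then show "(src B n (x n), pos B n x) \<in> (SIGMA u:vertices B n. {..<hgt B n u})"
      using src_vertex pos_less[OF x] by simp
  qed
  ultimately have "card F \<le> card (SIGMA u:vertices B n. {..<hgt B n u})"
    by (intro card_inj_on_le) auto
  also have "\<dots> = total n" by (simp add: total_def)
  finally show ?thesis using F(2) by blast
qed

lemma hgt_unbounded: "\<exists>m>n. \<forall>v\<in>vertices B m. N \<le> hgt B m v"
proof -
  obtain j where j: "N \<le> total j" using total_unbounded by blast
  have "N \<le> hgt B (Suc (max n j)) v" if "v \<in> vertices B (Suc (max n j))" for v
    using total_le_hgt[OF that] total_mono[of j "max n j"] j by simp
  then show ?thesis by (intro exI[of _ "Suc (max n j)"]) auto
qed

text \<open>Dominates the heights at levels \<open>n\<close> and \<open>Suc n\<close>: the former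
  bound the length of a copy, the latter the distance to a copy of any prescribed tower
  (\<open>seg_dense\<close>).\<close>

definition gap :: "nat \<Rightarrow> nat" where
  "gap n = max (total n) (total (Suc n))"

text \<open>Has room for \<open>2 * gap n + 1\<close> windows of length \<open>2 * gap n\<close>
  each, as required in \<open>card_run\<close>.\<close>

definition zone :: "nat \<Rightarrow> nat" where
  "zone n = gap n * (4 * gap n + 4)"

lemma hgt_le_gap: "v \<in> vertices B n \<Longrightarrow> hgt B n v \<le> gap n"
  and hgt_Suc_le_gap: "v \<in> vertices B (Suc n) \<Longrightarrow> hgt B (Suc n) v \<le> gap n"
  using hgt_le_total[of v n] hgt_le_total[of v "Suc n"] by (auto simp: gap_def)

lemma gap_pos: "0 < gap n"
proof -
  obtain v where v: "v \<in> vertices B n" using vertices_nonempty by blast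
  show ?thesis using hgt_le_gap[OF v] hgt_pos[OF v] by simp
qed

text \<open>The path at time \<open>t\<close> runs inside a copy of some tower of level
  \<open>Suc n\<close>, over \<open>w\<close> say. As \<open>u\<close> is joined to
  \<open>w\<close>, that copy contains one of the tower over \<open>u\<close>; exchanging a single
  edge reaches it without leaving the copy, whose height is at most \<open>gap n\<close>.\<close>

lemma seg_dense:
  assumes u: "u \<in> vertices B n" and v: "v \<in> vertices B m" and nm: "n < m" and t: "t < hgt B m v"
  shows "\<exists>p\<in>segs n m v. src B n (hd p) = u \<and> \<bar>int (seg_off B n p) - int t\<bar> < int (gap n)"
proof -
  obtain x where x: "x \<in> inf_paths B" "src B m (x m) = v" "pos B m x = t"
    using seg_cover[OF v nm t] by blast
  define w where "w = src B (Suc n) (x (Suc n))"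
  have w: "w \<in> vertices B (Suc n)" using x(1) src_vertex by (auto simp: w_def inf_paths_def)
  obtain e where e: "e \<in> edges B n" "src B n e = u" "rng B n e = w" using ex_edge[OF u w] by blast
  have "tail_path B n (x(n := e))"
    using tail_path_extend[OF inf_paths_tail[OF x(1)]] e by (simp add: w_def)
  then obtain y where y: "y \<in> inf_paths B" "\<forall>i\<ge>n. y i = (x(n := e)) i" "pos B n y = 0"
    using pos_surj[of n "x(n := e)" 0] hgt_pos[OF u] e(2) by auto
  have yx: "\<forall>i\<ge>Suc n. y i = x i" using y(2) by simp
  let ?p = "map y [n..<m]"
  note p = inf_path_seg[OF y(1) nm]
  have "src B m (y m) = v" using yx nm x(2) by simp
  then have "?p \<in> segs n m v" using p by (simp add: segs_def)
  moreover have "src B n (hd ?p) = u" using p(2) y(2) e(2) by simp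
  moreover have "seg_off B n ?p = pos B m y" using pos_seg[of n m B y] y(3) nm by simp
  moreover have "int (pos B m y) - int (pos B m x) = int (pos B (Suc n) y) - int (pos B (Suc n) x)"
    by (rule pos_add_tail) (use nm yx in auto)
  moreover have "pos B (Suc n) y < hgt B (Suc n) w" "pos B (Suc n) x < hgt B (Suc n) w"
    using pos_less[OF y(1), of "Suc n"] pos_less[OF x(1), of "Suc n"] yx by (simp_all add: w_def)
  moreover have "hgt B (Suc n) w \<le> gap n" using hgt_Suc_le_gap[OF w] .
  ultimately show ?thesis using x(3) by (intro bexI[of _ ?p]) auto
qed

end

text \<open>The factor \<open>2 ^ Suc k\<close> makes the measures of the stretches summable and the
  heights exceed all powers of 2. Being at least 2, it leaves half of each tower unsorted even after
  the \<open>4 * gap (l k)\<close> spent on rounding in \<open>eigenvalue_level\<close>.\<close>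

locale fast = positive_obd B for B :: "'e ordered_bratteli" +
  fixes l :: "nat \<Rightarrow> nat"
  assumes fast_mono: "strict_mono l" and fast_0: "l 0 = 0"
    and fast_growth: "v \<in> vertices B (l (Suc k)) \<Longrightarrow>
      2 ^ Suc k * (zone (l k) + 4 * gap (l k)) \<le> hgt B (l (Suc k)) v"
begin

text \<open>The paths starting in the tower at a positive time below \<open>zone (l k)\<close> are sorted by
  their source; all other paths keep their place.\<close>

definition key :: "nat \<Rightarrow> 'e list \<Rightarrow> nat" where
  "key k p = (let n = l k; a = seg_off B n p; t = zone n in
     if a = 0 then 0 else if a < t then 1 + src B n (hd p) * t + a else (width B n + 1) * t + a)"

section \<open>The sorting key and the offsets that it produces\<close>

lemma l_Suc: "l k < l (Suc k)"
  using fast_mono by (simp add: strict_mono_def)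

lemma zone_small:
  assumes "v \<in> vertices B (l (Suc k))"
  shows "2 * (zone (l k) + 4 * gap (l k)) \<le> hgt B (l (Suc k)) v"
proof -
  have "(2::nat) \<le> 2 ^ Suc k" by simp
  then have "2 * (zone (l k) + 4 * gap (l k)) \<le> 2 ^ Suc k * (zone (l k) + 4 * gap (l k))"
    by (rule mult_le_mono1)
  then show ?thesis using fast_growth[OF assms] by linarith
qed

lemma seg_src:
  assumes "p \<in> segs (l k) (l (Suc k)) v"
  shows "src B (l k) (hd p) \<in> vertices B (l k)" and "v \<in> vertices B (l (Suc k))"
  using assms fin_path_ends(1,2)[OF _ l_Suc] by (auto simp: segs_def)

text \<open>A source is at most the width, so the two-digit code of a sorted path stays below the
  keys of all unsorted ones, which exceed this bound.\<close>

lemma key_zone_less: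
  assumes "p \<in> segs (l k) (l (Suc k)) v" "seg_off B (l k) p < zone (l k)"
  shows "key k p \<le> (width B (l k) + 1) * zone (l k)"
proof -
  have "src B (l k) (hd p) \<le> width B (l k)" using seg_src(1)[OF assms(1)] by (simp add: vertices_def)
  then have "src B (l k) (hd p) * zone (l k) \<le> width B (l k) * zone (l k)" by (rule mult_le_mono1)
  moreover have "key k p \<le> 1 + src B (l k) (hd p) * zone (l k) + seg_off B (l k) p"
    using assms(2) by (simp add: key_def Let_def)
  moreover have "(width B (l k) + 1) * zone (l k) = width B (l k) * zone (l k) + zone (l k)"
    by simp
  ultimately show ?thesis using assms(2) by linarith
qed

text \<open>Comparison with an unsorted path is decided by the old start times, whichever part the
  other path belongs to.\<close>

lemma key_rest_iff:
  assumes p: "p \<in> segs (l k) (l (Suc k)) v" and q: "q \<in> segs (l k) (l (Suc k)) v"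
    and r: "zone (l k) \<le> seg_off B (l k) p"
  shows "key k q < key k p \<longleftrightarrow> seg_off B (l k) q < seg_off B (l k) p"
proof -
  have z: "0 < zone (l k)" using gap_pos by (simp add: zone_def)
  have kp: "key k p = (width B (l k) + 1) * zone (l k) + seg_off B (l k) p"
    using r z by (simp add: key_def Let_def)
  show ?thesis
  proof (cases "seg_off B (l k) q < zone (l k)")
    case True
    then show ?thesis using key_zone_less[OF q] kp r z by simp
  next
    case False
    then have "key k q = (width B (l k) + 1) * zone (l k) + seg_off B (l k) q"
      using z by (simp add: key_def Let_def)
    then show ?thesis using kp by simp
  qed
qed

text \<open>Two-digit numbers in base \<open>t\<close> are ordered lexicographically; the digits
  will be source and start time.\<close>

lemma mult_add_less_iff:
  fixes t :: nat
  assumes "a < t" "b < t"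
  shows "i * t + a < j * t + b \<longleftrightarrow> i < j \<or> i = j \<and> a < b"
proof -
  have "i * t + a < j * t + b" if "i < j"
  proof -
    have "Suc i * t \<le> j * t" using that by (intro mult_le_mono1) simp
    then show ?thesis using assms by simp
  qed
  moreover have "j * t + b < i * t + a" if "j < i"
  proof -
    have "Suc j * t \<le> i * t" using that by (intro mult_le_mono1) simp
    then show ?thesis using assms by simp
  qed
  ultimately show ?thesis by (metis add_less_cancel_left less_asym linorder_neqE_nat)
qed

lemma key_zone_iff:
  assumes "0 < seg_off B (l k) p" "seg_off B (l k) p < zone (l k)"
    "0 < seg_off B (l k) q" "seg_off B (l k) q < zone (l k)"
  shows "key k q < key k p \<longleftrightarrow> src B (l k) (hd q) < src B (l k) (hd p) \<or>
    src B (l k) (hd q) = src B (l k) (hd p) \<and> seg_off B (l k) q < seg_off B (l k) p"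
  using assms mult_add_less_iff[OF assms(4,2)] by (simp add: key_def Let_def)

sublocale contracted B l key
proof
  show "strict_mono l" "l 0 = 0" using fast_mono fast_0 .
next
  fix k v
  show "inj_on (key k) (segs (l k) (l (Suc k)) v)"
  proof (rule inj_onI)
    fix p q assume p: "p \<in> segs (l k) (l (Suc k)) v" and q: "q \<in> segs (l k) (l (Suc k)) v"
      and e: "key k p = key k q"
    have z: "0 < zone (l k)" using gap_pos by (simp add: zone_def)
    have "seg_off B (l k) p = seg_off B (l k) q"
    \<comment> \<open>If one path is unsorted, equality of keys makes both unsorted; there, and for
      two sorted paths, the key determines the start time.\<close>
    proof (cases "zone (l k) \<le> seg_off B (l k) p \<or> zone (l k) \<le> seg_off B (l k) q")
      case True
      then show ?thesis
      proof
        assume r: "zone (l k) \<le> seg_off B (l k) p"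
        have "\<not> seg_off B (l k) q < seg_off B (l k) p" using key_rest_iff[OF p q r] e by simp
        then have "zone (l k) \<le> seg_off B (l k) q" using r by simp
        then show ?thesis using key_rest_iff[OF q p] key_rest_iff[OF p q r] e by simp
      next
        assume r: "zone (l k) \<le> seg_off B (l k) q"
        have "\<not> seg_off B (l k) p < seg_off B (l k) q" using key_rest_iff[OF q p r] e by simp
        then have "zone (l k) \<le> seg_off B (l k) p" using r by simp
        then show ?thesis using key_rest_iff[OF p q] key_rest_iff[OF q p r] e by simp
      qed
    next
      case False
      show ?thesis
      proof (cases "seg_off B (l k) p = 0 \<or> seg_off B (l k) q = 0")
        case True
        then show ?thesis using e False z by (auto simp: key_def Let_def split: if_splits)
      next
        case nz: False
        then have "\<not> key k q < key k p" "\<not> key k p < key k q" using e by simp_all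
        then show ?thesis
          using key_zone_iff[of k p q] key_zone_iff[of k q p] nz False by auto
      qed
    qed
    then show "p = q" using seg_off_inj[OF p q l_Suc] by simp
  qed
next
  fix p k v q
  assume p: "p \<in> segs (l k) (l (Suc k)) v" and q: "q \<in> segs (l k) (l (Suc k)) v"
  show "key k p \<le> key k q" if "seg_off B (l k) p = 0" using that by (simp add: key_def Let_def)
  assume t: "seg_off B (l k) p + hgt B (l k) (src B (l k) (hd p)) = hgt B (l (Suc k)) v"
  have s: "hgt B (l k) (src B (l k) (hd p)) \<le> gap (l k)" using hgt_le_gap seg_src(1)[OF p] .
  \<comment> \<open>The last path starts at most \<open>gap (l k)\<close> before the end of a tower
    more than twice as long as the stretch, so it is not sorted and keeps its place.\<close>
  then have r: "zone (l k) \<le> seg_off B (l k) p" using zone_small[OF seg_src(2)[OF p]] t by simp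
  have hq: "0 < hgt B (l k) (src B (l k) (hd q))" using hgt_pos[OF seg_src(1)[OF q]] .
  have topq: "seg_off B (l k) q + hgt B (l k) (src B (l k) (hd q)) \<le> hgt B (l (Suc k)) v"
    using seg_top[OF _ l_Suc, of q k] q by (simp add: segs_def)
  have "seg_off B (l k) q \<le> seg_off B (l k) p"
  proof (rule ccontr)
    assume n: "\<not> seg_off B (l k) q \<le> seg_off B (l k) p"
    have "p = q"
      using seg_unique[OF _ _ l_Suc, of p k q "seg_off B (l k) q"] p q n hq topq t by (simp add: segs_def)
    then show False using n by simp
  qed
  then show "key k q \<le> key k p"
    using key_rest_iff[OF q p] key_rest_iff[OF p q r] r by (metis le_trans not_less order_le_less)
qed

text \<open>The segments before \<open>p\<close> form the same set in both orders; they are merely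
  permuted among themselves, and their total height is unchanged.\<close>

lemma off_C_rest:
  assumes p: "p \<in> segs (l k) (l (Suc k)) v" and r: "zone (l k) \<le> seg_off B (l k) p"
  shows "off C k p = seg_off B (l k) p"
proof -
  have "{q\<in>segs (l k) (l (Suc k)) v. key k q < key k p} =
    {q\<in>segs (l k) (l (Suc k)) v. seg_off B (l k) q < seg_off B (l k) p}"
    using key_rest_iff[OF p _ r] by blast
  then show ?thesis using off_C[OF p] seg_tiling(2)[OF seg_src(2)[OF p] l_Suc p] by simp
qed

text \<open>In the new order these segments are consecutive, so copies of the tower over
  \<open>u\<close> follow each other without interruption.\<close>

definition run :: "nat \<Rightarrow> nat \<Rightarrow> nat \<Rightarrow> 'e list set" where
  "run k u v = {q\<in>segs (l k) (l (Suc k)) v. src B (l k) (hd q) = u \<and>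
     0 < seg_off B (l k) q \<and> seg_off B (l k) q < zone (l k)}"

text \<open>\<open>?A\<close> is what precedes the whole run: the first segment and the sorted
  segments with smaller source. Its height is the constant, and inside the run every predecessor
  contributes the same height.\<close>

lemma off_C_run:
  "\<exists>c. \<forall>p\<in>run k u v. off C k p =
     c + hgt B (l k) u * card {q\<in>run k u v. seg_off B (l k) q < seg_off B (l k) p}"
proof (intro exI ballI)
  let ?w = "\<lambda>q. hgt B (l k) (src B (l k) (hd q))"
  let ?A = "{q\<in>segs (l k) (l (Suc k)) v. seg_off B (l k) q = 0 \<or>
     seg_off B (l k) q < zone (l k) \<and> src B (l k) (hd q) < u}"
  fix p assume p: "p \<in> run k u v"
  then have ps: "p \<in> segs (l k) (l (Suc k)) v" and pu: "src B (l k) (hd p) = u"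
    and pz: "0 < seg_off B (l k) p" "seg_off B (l k) p < zone (l k)" by (auto simp: run_def)
  let ?R = "{q\<in>run k u v. seg_off B (l k) q < seg_off B (l k) p}"
  have "{q\<in>segs (l k) (l (Suc k)) v. key k q < key k p} = ?A \<union> ?R"
  proof (intro set_eqI)
    fix q
    show "q \<in> {q\<in>segs (l k) (l (Suc k)) v. key k q < key k p} \<longleftrightarrow> q \<in> ?A \<union> ?R"
    proof (cases "q \<in> segs (l k) (l (Suc k)) v")
      case qs: True
      consider "seg_off B (l k) q = 0" | "0 < seg_off B (l k) q" "seg_off B (l k) q < zone (l k)"
        | "zone (l k) \<le> seg_off B (l k) q" by linarith
      then show ?thesis
      proof cases
        case 1
        then have "key k q = 0" "0 < key k p" using pz by (simp_all add: key_def Let_def)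
        then show ?thesis using 1 qs by simp
      next
        case 2
        then show ?thesis using key_zone_iff[OF pz 2] qs pu by (auto simp: run_def)
      next
        case 3
        then have "key k p < key k q" using key_rest_iff[OF qs ps 3] pz by simp
        then show ?thesis using 3 pz by (auto simp: run_def)
      qed
    qed (auto simp: run_def)
  qed
  then have "off C k p = (\<Sum>q\<in>?A \<union> ?R. ?w q)" using off_C[OF ps] by simp
  also have "\<dots> = (\<Sum>q\<in>?A. ?w q) + (\<Sum>q\<in>?R. ?w q)"
    by (rule sum.union_disjoint) (auto simp: run_def)
  also have "(\<Sum>q\<in>?R. ?w q) = (\<Sum>q\<in>?R. hgt B (l k) u)" by (rule sum.cong) (auto simp: run_def)
  finally show "off C k p = (\<Sum>q\<in>?A. ?w q) + hgt B (l k) u * card ?R" by simp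
qed

text \<open>One segment is found near each of \<open>2 * gap + 1\<close> target times by density.
  The targets are \<open>2 * gap\<close> apart and each error is below \<open>gap\<close>, so the
  segments are distinct.\<close>

lemma card_run:
  assumes u: "u \<in> vertices B (l k)" and v: "v \<in> vertices B (l (Suc k))"
  shows "2 * gap (l k) < card (run k u v)"
proof -
  let ?G = "gap (l k)"
  \<comment> \<open>Odd multiples of the gap: the centres of adjacent windows, the first of which
    excludes time 0.\<close>
  define T where "T i = ?G * (2 * i + 1)" for i
  have G: "0 < ?G" by (rule gap_pos)
  have Tb: "T i + ?G \<le> zone (l k)" if "i \<le> 2 * ?G" for i
  proof -
    have "T i + ?G = ?G * (2 * i + 2)" by (simp add: T_def)
    also have "\<dots> \<le> zone (l k)" unfolding zone_def using that by (intro mult_le_mono2) simp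
    finally show ?thesis .
  qed
  have "\<exists>p\<in>segs (l k) (l (Suc k)) v. src B (l k) (hd p) = u \<and> \<bar>int (seg_off B (l k) p) - int (T i)\<bar> < int ?G"
    if "i \<le> 2 * ?G" for i
  proof (rule seg_dense[OF u v l_Suc])
    show "T i < hgt B (l (Suc k)) v" using Tb[OF that] zone_small[OF v] G by simp
  qed
  then have "\<forall>i. \<exists>p. i \<le> 2 * ?G \<longrightarrow> p \<in> segs (l k) (l (Suc k)) v \<and> src B (l k) (hd p) = u \<and>
    \<bar>int (seg_off B (l k) p) - int (T i)\<bar> < int ?G" by blast
  then obtain p where p: "\<And>i. i \<le> 2 * ?G \<Longrightarrow> p i \<in> segs (l k) (l (Suc k)) v \<and> src B (l k) (hd (p i)) = u \<and>
    \<bar>int (seg_off B (l k) (p i)) - int (T i)\<bar> < int ?G" by metis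
  have "p i \<in> run k u v" if i: "i \<le> 2 * ?G" for i
  proof -
    have "?G \<le> T i" by (simp add: T_def)
    then show ?thesis using p[OF i] Tb[OF i] by (auto simp: run_def)
  qed
  then have sub: "p ` {..2 * ?G} \<subseteq> run k u v" by auto
  have lt: "seg_off B (l k) (p i) < seg_off B (l k) (p j)" if "i < j" "j \<le> 2 * ?G" for i j
  proof -
    have "?G * (2 * i + 1 + 2) \<le> ?G * (2 * j + 1)" using that by (intro mult_le_mono2) simp
    then have "T i + 2 * ?G \<le> T j" by (simp add: T_def algebra_simps)
    then have "int (T i) + 2 * int ?G \<le> int (T j)" by (metis of_nat_add of_nat_le_iff of_nat_mult of_nat_numeral)
    moreover have "\<bar>int (seg_off B (l k) (p i)) - int (T i)\<bar> < int ?G"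
      "\<bar>int (seg_off B (l k) (p j)) - int (T j)\<bar> < int ?G"
      using p[of i] p[of j] that by simp_all
    ultimately have "int (seg_off B (l k) (p i)) < int (seg_off B (l k) (p j))" by linarith
    then show ?thesis by simp
  qed
  have "inj_on p {..2 * ?G}"
  proof (rule inj_onI)
    fix i j assume "i \<in> {..2 * ?G}" "j \<in> {..2 * ?G}" "p i = p j"
    then show "i = j" using lt[of i j] lt[of j i] by (metis atMost_iff less_irrefl linorder_neqE_nat)
  qed
  then have "card (p ` {..2 * ?G}) = Suc (2 * ?G)" by (simp add: card_image)
  moreover have "finite (run k u v)" by (simp add: run_def)
  ultimately show ?thesis using card_mono[OF _ sub] by simp
qed

text \<open>Two paths at the bottom of the same tower of level \<open>k\<close> that then follow
  \<open>p\<close> and \<open>q\<close> into a common tail agree in \<open>k\<close> entries, so the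
  eigenfunction hardly distinguishes them. They differ in time by the difference of the
  offsets.\<close>

lemma eigenvalue_return:
  assumes cpt: "compact_space (path_space B)"
    and min: "minimal_cantor_system (path_space C) (vershik C)"
    and ev: "continuous_eigenvalue (path_space C) (vershik C) (cis (2 * pi * \<alpha>))"
  shows "\<exists>N. \<forall>k\<ge>N. \<forall>v. \<forall>p\<in>segs (l k) (l (Suc k)) v. \<forall>q\<in>segs (l k) (l (Suc k)) v.
    src B (l k) (hd p) = src B (l k) (hd q) \<longrightarrow>
    (\<exists>j::int. \<bar>\<alpha> * (real (off C k p) - real (off C k q)) - j\<bar> < 1 / 8)"
proof -
  let ?z = "cis (2 * pi * \<alpha>)"
  obtain f where f: "continuous_eigenfunction (path_space C) (vershik C) ?z f"
    using ev unfolding continuous_eigenvalue_def by blast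
  obtain c where c: "0 < c" "\<And>x. x \<in> inf_paths C \<Longrightarrow> cmod (f x) = c"
    using minimal_eigenfunction(2)[OF min f] by auto
  have fv: "f (vershik C x) = ?z * f x" if "x \<in> inf_paths C" for x
    using f that by (simp add: continuous_eigenfunction_def)
  have inp: "(vershik C ^^ d) x \<in> inf_paths C" if "x \<in> inf_paths C" for d x
    using that by (induction d) auto
  have fd: "f ((vershik C ^^ d) x) = ?z ^ d * f x" if "x \<in> inf_paths C" for d x
    using that by (induction d) (simp_all add: fv inp)
  \<comment> \<open>The threshold of \<open>cis_near_one\<close>; it is scaled by the constant
    modulus \<open>c\<close> of the eigenfunction.\<close>
  define \<epsilon> where "\<epsilon> = 1 - cos (pi / 4)"
  have "cos (pi / 4) < cos (0::real)" by (rule cos_monotone_0_pi) auto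
  then have e0: "0 < \<epsilon>" by (simp add: \<epsilon>_def)
  obtain N where N: "\<forall>x\<in>inf_paths C. \<forall>y\<in>inf_paths C. (\<forall>i<N. x i = y i) \<longrightarrow> dist (f x) (f y) < c * \<epsilon>"
    using uniformly_continuous_path_space[OF compact_C[OF cpt], of f "c * \<epsilon>"] f c(1) e0
    by (auto simp: continuous_eigenfunction_def)
  have le: "\<exists>j::int. \<bar>\<alpha> * (real (off C k p) - real (off C k q)) - j\<bar> < 1 / 8"
    if k: "N \<le> k" and p: "p \<in> segs (l k) (l (Suc k)) v" and q: "q \<in> segs (l k) (l (Suc k)) v"
      and s: "src B (l k) (hd p) = src B (l k) (hd q)" and pq: "off C k q \<le> off C k p" for k v p q
  proof -
    have v: "v \<in> vertices C (Suc k)" using seg_src(2)[OF p] by simp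
    obtain y where y: "tail_path C (Suc k) y" "src C (Suc k) (y (Suc k)) = v"
      using C.ex_tail_path[OF v] by blast
    \<comment> \<open>All these paths share the tail \<open>y\<close> and start at time 0, so that
      only the edge at level \<open>k\<close> separates them in time.\<close>
    have ext: "\<exists>x\<in>inf_paths C. (\<forall>i\<ge>Suc k. x i = y i) \<and> x k = g \<and> pos C k x = 0"
      if g: "g \<in> segs (l k) (l (Suc k)) v" for g
    proof -
      have "tail_path C k (y(k := g))"
        by (rule tail_path_extend[OF y(1)]) (use g y(2) in \<open>auto simp: segs_def\<close>)
      moreover have "src C k ((y(k := g)) k) \<in> vertices C k" using seg_src(1)[OF g] by simp
      ultimately obtain x where "x \<in> inf_paths C" "\<forall>i\<ge>k. x i = (y(k := g)) i" "pos C k x = 0"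
        using C.pos_surj[OF _ C.hgt_pos, of k "y(k := g)"] by blast
      then show ?thesis by (intro bexI[of _ x]) auto
    qed
    obtain xp where xp: "xp \<in> inf_paths C" "\<forall>i\<ge>Suc k. xp i = y i" "xp k = p" "pos C k xp = 0"
      using ext[OF p] by blast
    obtain xq where xq: "xq \<in> inf_paths C" "\<forall>i\<ge>Suc k. xq i = y i" "xq k = q" "pos C k xq = 0"
      using ext[OF q] by blast
    \<comment> \<open>Equal sources and equal times force equal initial segments.\<close>
    have "\<forall>i<k. xp i = xq i" using C.pos_inj[OF xp(1) xq(1), of k] xp xq s by simp
    then have "dist (f xp) (f xq) < c * \<epsilon>" using N xp(1) xq(1) k by auto
    define d where "d = off C k p - off C k q"
    have "(vershik C ^^ d) xq = xp"
      by (rule C.vershik_funpow[OF xq(1) xp(1), of "Suc k"]) (use xp xq pq in \<open>auto simp: d_def\<close>)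
    then have "f xp = ?z ^ d * f xq" using fd[OF xq(1), of d] by simp
    then have "f xp - f xq = (?z ^ d - 1) * f xq" by (simp add: algebra_simps)
    then have "cmod (?z ^ d - 1) * c < c * \<epsilon>"
      using \<open>dist (f xp) (f xq) < c * \<epsilon>\<close> c(2)[OF xq(1)] by (simp add: dist_norm norm_mult)
    then have "cmod (?z ^ d - 1) < \<epsilon>" using c(1) by (simp add: mult.commute)
    moreover have "?z ^ d = cis (2 * pi * (\<alpha> * real d))"
    proof -
      have "?z ^ d = cis (real d * (2 * pi * \<alpha>))" by (rule Complex.DeMoivre)
      also have "real d * (2 * pi * \<alpha>) = 2 * pi * (\<alpha> * real d)" by (simp only: mult_ac)
      finally show ?thesis .
    qed
    ultimately have "\<exists>j::int. \<bar>\<alpha> * real d - j\<bar> < 1 / 8"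
      using cis_near_one[of "\<alpha> * real d"] by (simp add: \<epsilon>_def)
    then show ?thesis using pq by (simp add: d_def of_nat_diff)
  qed
  show ?thesis
  proof (intro exI[of _ N] allI impI ballI)
    fix k v p q
    assume a: "N \<le> k" "p \<in> segs (l k) (l (Suc k)) v" "q \<in> segs (l k) (l (Suc k)) v"
      "src B (l k) (hd p) = src B (l k) (hd q)"
    show "\<exists>j::int. \<bar>\<alpha> * (real (off C k p) - real (off C k q)) - j\<bar> < 1 / 8"
    proof (cases "off C k q \<le> off C k p")
      case True then show ?thesis using le a by blast
    next
      case False
      then obtain j :: int where "\<bar>\<alpha> * (real (off C k q) - real (off C k p)) - j\<bar> < 1 / 8"
        using le[OF a(1,3,2)] a(4) by auto
      moreover have "\<alpha> * (real (off C k p) - real (off C k q)) - of_int (- j) =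
        - (\<alpha> * (real (off C k q) - real (off C k p)) - of_int j)" by (simp add: algebra_simps)
      ultimately show ?thesis by (metis abs_minus_cancel)
    qed
  qed
qed

text \<open>One level of the argument: the sorted runs force \<open>\<alpha>\<close> close to a single fraction \<open>\<beta>\<close> with
  \<open>\<beta> * hgt B (l k) u\<close> integral, and the unsorted part, in which every vertex recurs with
  gaps at most \<open>3 * gap (l k)\<close>, keeps \<open>\<alpha>\<close> and \<open>\<beta>\<close> together up to the next level.\<close>

lemma eigenvalue_level:
  assumes ret: "\<And>v p q. p \<in> segs (l k) (l (Suc k)) v \<Longrightarrow> q \<in> segs (l k) (l (Suc k)) v \<Longrightarrow>
    src B (l k) (hd p) = src B (l k) (hd q) \<Longrightarrow>
    \<exists>j::int. \<bar>\<alpha> * (real (off C k p) - real (off C k q)) - j\<bar> < 1 / 8"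
  shows "\<exists>\<beta>::real. (\<forall>u\<in>vertices B (l k). \<beta> * hgt B (l k) u \<in> \<int> \<and> \<bar>\<alpha> - \<beta>\<bar> * hgt B (l k) u < 1 / 8) \<and>
    (\<forall>v\<in>vertices B (l (Suc k)). \<beta> * hgt B (l (Suc k)) v \<in> \<int> \<and> \<bar>\<alpha> - \<beta>\<bar> * hgt B (l (Suc k)) v < 1 / 4)"
proof -
  define G where "G = gap (l k)"
  have G: "0 < G" using gap_pos by (simp add: G_def)
  obtain v0 where v0: "v0 \<in> vertices B (l (Suc k))" using vertices_nonempty by blast
  \<comment> \<open>The segments of rank \<open>i\<close> and rank 0 in a run differ in offset by
    \<open>i\<close> heights, so the multiples of \<open>\<alpha> * hgt B (l k) u\<close> up to
    \<open>2 * G\<close> are all near integers.\<close>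
  have run_dense: "\<exists>P::int. \<bar>\<alpha> * hgt B (l k) u - P\<bar> * real (2 * G) < 1 / 8"
    if u: "u \<in> vertices B (l k)" for u
  proof (rule near_int_multiples)
    show "1 \<le> 2 * G" using G by simp
    fix i assume i: "i \<le> 2 * G"
    let ?Q = "run k u v0"
    let ?c = "\<lambda>p. card {q\<in>?Q. seg_off B (l k) q < seg_off B (l k) p}"
    have fQ: "finite ?Q" by (simp add: run_def)
    have inj: "inj_on (seg_off B (l k)) ?Q"
      by (rule inj_onI) (use seg_off_inj[OF _ _ l_Suc] in \<open>auto simp: run_def\<close>)
    have cQ: "2 * G < card ?Q" using card_run[OF u v0] by (simp add: G_def)
    obtain p where p: "p \<in> ?Q" "?c p = i" using ex_pred_card[OF fQ inj, of i] cQ i by auto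
    obtain q where q: "q \<in> ?Q" "?c q = 0" using ex_pred_card[OF fQ inj, of 0] cQ by auto
    obtain c where c: "\<forall>p\<in>?Q. off C k p = c + hgt B (l k) u * ?c p" using off_C_run by blast
    have "real (off C k p) - real (off C k q) = real (hgt B (l k) u) * real i"
      using bspec[OF c p(1)] bspec[OF c q(1)] unfolding p(2) q(2) by simp
    moreover have "\<exists>j::int. \<bar>\<alpha> * (real (off C k p) - real (off C k q)) - j\<bar> < 1 / 8"
      by (rule ret[of p v0 q]) (use p(1) q(1) in \<open>auto simp: run_def\<close>)
    ultimately show "\<exists>j::int. \<bar>\<alpha> * real (hgt B (l k) u) * real i - j\<bar> < 1 / 8"
      by (simp add: mult.assoc)
  qed
  then obtain P :: "nat \<Rightarrow> int" where
    P: "\<And>u. u \<in> vertices B (l k) \<Longrightarrow> \<bar>\<alpha> * hgt B (l k) u - P u\<bar> * real (2 * G) < 1 / 8" by metis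
  have hG: "hgt B (l k) u \<le> G" "0 < hgt B (l k) u" if "u \<in> vertices B (l k)" for u
    using hgt_le_gap[OF that] hgt_pos[OF that] by (auto simp: G_def)
  \<comment> \<open>The difference is an integer. With errors below \<open>1 / (16 * G)\<close> and
    heights at most \<open>G\<close> it is smaller than 1 in absolute value, hence 0.\<close>
  have cross: "P u * int (hgt B (l k) w) = P w * int (hgt B (l k) u)"
    if u: "u \<in> vertices B (l k)" and w: "w \<in> vertices B (l k)" for u w
  proof -
    define a b x y where "a = real (hgt B (l k) u)" and "b = real (hgt B (l k) w)"
      and "x = \<alpha> * a - P u" and "y = \<alpha> * b - P w"
    have bd: "0 \<le> a" "a \<le> G" "0 \<le> b" "b \<le> G" using hG[OF u] hG[OF w] by (auto simp: a_def b_def)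
    have xy: "\<bar>x\<bar> * (2 * real G) < 1 / 8" "\<bar>y\<bar> * (2 * real G) < 1 / 8"
      using P[OF u] P[OF w] by (auto simp: x_def y_def a_def b_def)
    have "P u * b - P w * a = y * a - x * b" by (simp add: x_def y_def algebra_simps)
    moreover have "\<bar>y * a - x * b\<bar> \<le> \<bar>y\<bar> * a + \<bar>x\<bar> * b"
      using abs_triangle_ineq4[of "y * a" "x * b"] bd by (simp add: abs_mult)
    moreover have "\<bar>y\<bar> * a \<le> \<bar>y\<bar> * G" "\<bar>x\<bar> * b \<le> \<bar>x\<bar> * G" using bd by (simp_all add: mult_left_mono)
    ultimately have "\<bar>P u * b - P w * a\<bar> < 1" using xy by linarith
    then have "\<bar>of_int (P u * int (hgt B (l k) w) - P w * int (hgt B (l k) u))\<bar> < (1::real)"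
      by (simp add: a_def b_def)
    then show ?thesis by linarith
  qed
  obtain u0 where u0: "u0 \<in> vertices B (l k)" using vertices_nonempty by blast
  \<comment> \<open>By \<open>cross\<close> the quotient is the same for all vertices, so the choice
    of \<open>u0\<close> does not matter.\<close>
  define \<beta> where "\<beta> = P u0 / hgt B (l k) u0"
  have \<beta>P: "\<beta> * hgt B (l k) u = P u" if u: "u \<in> vertices B (l k)" for u
  proof -
    have "real_of_int (P u0) * real (hgt B (l k) u) = real_of_int (P u) * real (hgt B (l k) u0)"
      using cross[OF u0 u] by (metis of_int_mult of_int_of_nat_eq)
    then show ?thesis using hG(2)[OF u0] by (simp add: \<beta>_def field_simps)
  qed
  have near: "\<bar>\<alpha> - \<beta>\<bar> * hgt B (l k) u * (2 * real G) < 1 / 8" if u: "u \<in> vertices B (l k)" for u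
  proof -
    have "\<bar>\<alpha> - \<beta>\<bar> * hgt B (l k) u = \<bar>(\<alpha> - \<beta>) * hgt B (l k) u\<bar>" by (simp add: abs_mult)
    also have "(\<alpha> - \<beta>) * hgt B (l k) u = \<alpha> * hgt B (l k) u - P u"
      using \<beta>P[OF u] by (simp add: algebra_simps)
    finally show ?thesis using P[OF u] by simp
  qed
  \<comment> \<open>Heights are at least 1, so the bound on the product with a height also bounds
    the difference itself.\<close>
  have dG: "\<bar>\<alpha> - \<beta>\<bar> * (2 * real G) < 1 / 8"
  proof -
    have "\<bar>\<alpha> - \<beta>\<bar> * 1 \<le> \<bar>\<alpha> - \<beta>\<bar> * hgt B (l k) u0" using hG(2)[OF u0] by (intro mult_left_mono) auto
    then have "\<bar>\<alpha> - \<beta>\<bar> * (2 * real G) \<le> \<bar>\<alpha> - \<beta>\<bar> * hgt B (l k) u0 * (2 * real G)"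
      by (intro mult_right_mono) auto
    then show ?thesis using near[OF u0] by linarith
  qed
  have sum_int: "\<beta> * (\<Sum>q\<in>S. hgt B (l k) (src B (l k) (hd q))) \<in> \<int>"
    if "S \<subseteq> segs (l k) (l (Suc k)) v" for S v
  proof -
    have "\<beta> * (\<Sum>q\<in>S. hgt B (l k) (src B (l k) (hd q))) = (\<Sum>q\<in>S. \<beta> * hgt B (l k) (src B (l k) (hd q)))"
      by (simp add: sum_distrib_left)
    also have "\<dots> \<in> \<int>"
      by (rule Ints_sum) (use \<beta>P[OF seg_src(1)] that in auto)
    finally show ?thesis .
  qed
  have off_int: "\<beta> * seg_off B (l k) p \<in> \<int>" if p: "p \<in> segs (l k) (l (Suc k)) v" for p v
    using sum_int[of "{q\<in>segs (l k) (l (Suc k)) v. seg_off B (l k) q < seg_off B (l k) p}" v]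
      seg_tiling(2)[OF seg_src(2)[OF p] l_Suc p] by auto
  have next_int: "\<beta> * hgt B (l (Suc k)) v \<in> \<int>" if v: "v \<in> vertices B (l (Suc k))" for v
    using sum_int[of "segs (l k) (l (Suc k)) v" v] seg_tiling(1)[OF v l_Suc] by simp
  have next_near: "\<bar>\<alpha> - \<beta>\<bar> * hgt B (l (Suc k)) v < 1 / 4" if v: "v \<in> vertices B (l (Suc k))" for v
  proof -
    define H where "H = hgt B (l (Suc k)) v"
    define Z where "Z = zone (l k)"
    \<comment> \<open>Sampling times spaced by \<open>G\<close>, beginning \<open>G\<close> after
      the stretch so that the nearby copies of the tower over \<open>u0\<close> start outside
      it.\<close>
    define T where "T j = Z + G + j * G" for j
    have Hbig: "2 * (Z + 4 * G) \<le> H" using zone_small[OF v] by (simp add: H_def Z_def G_def)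
    \<comment> \<open>The last index for which the sampling time is still inside the tower.\<close>
    define J where "J = (H - 1 - Z - G) div G"
    have Jle: "J * G \<le> H - 1 - Z - G" by (simp add: J_def)
    have Jgt: "H - 1 - Z - G < J * G + G"
      using mod_less_divisor[OF G, of "H - 1 - Z - G"] div_mult_mod_eq[of "H - 1 - Z - G" G]
      unfolding J_def by linarith
    have TJ: "T j < H" if "j \<le> J" for j
    proof -
      have "j * G \<le> J * G" using that by simp
      then have "j * G \<le> H - 1 - Z - G" using Jle by linarith
      moreover have "H - 1 - Z - G + (1 + Z + G) = H" using Hbig G by simp
      ultimately show ?thesis unfolding T_def by linarith
    qed
    have "\<exists>p\<in>segs (l k) (l (Suc k)) v. src B (l k) (hd p) = u0 \<and> \<bar>int (seg_off B (l k) p) - int (T j)\<bar> < int G"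
      if "j \<le> J" for j
      unfolding G_def by (rule seg_dense[OF u0 v l_Suc]) (use TJ[OF that] in \<open>simp add: H_def\<close>)
    then have "\<forall>j. \<exists>p. j \<le> J \<longrightarrow> p \<in> segs (l k) (l (Suc k)) v \<and> src B (l k) (hd p) = u0 \<and>
      \<bar>int (seg_off B (l k) p) - int (T j)\<bar> < int G" by blast
    then obtain p where p: "\<And>j. j \<le> J \<Longrightarrow> p j \<in> segs (l k) (l (Suc k)) v \<and> src B (l k) (hd (p j)) = u0 \<and>
      \<bar>int (seg_off B (l k) (p j)) - int (T j)\<bar> < int G" by metis
    define a where "a j = real (seg_off B (l k) (p j))" for j
    have aT: "\<bar>a j - real (T j)\<bar> < real G" if j: "j \<le> J" for j
    proof -
      have "real_of_int \<bar>int (seg_off B (l k) (p j)) - int (T j)\<bar> < real_of_int (int G)"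
        using p[OF j] by (simp only: of_int_less_iff)
      then show ?thesis by (simp add: a_def)
    qed
    have rT: "real (T j) = real Z + real G + real j * real G" for j by (simp add: T_def)
    have offp: "real (off C k (p j)) = a j" if j: "j \<le> J" for j
    proof -
      have "real Z < a j" using aT[OF j] rT[of j] by (simp, smt (verit) mult_nonneg_nonneg of_nat_0_le_iff)
      then have "zone (l k) \<le> seg_off B (l k) (p j)" by (simp add: a_def Z_def)
      then show ?thesis using off_C_rest[of "p j" k v] p[OF j] by (simp add: a_def)
    qed
    have chain: "\<bar>(\<alpha> - \<beta>) * (a J - a 0)\<bar> < 1 / 8"
    proof (rule near_int_chain[of "\<lambda>j. (\<alpha> - \<beta>) * (a j - a 0)" J])
      show "\<bar>(\<alpha> - \<beta>) * (a (Suc j) - a 0) - (\<alpha> - \<beta>) * (a j - a 0)\<bar> < 1 / 4" if j: "j < J" for j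
      proof -
        have "\<bar>a (Suc j) - real (T (Suc j))\<bar> < real G" "\<bar>a j - real (T j)\<bar> < real G"
          using aT[of j] aT[of "Suc j"] j by simp_all
        moreover have "real (T (Suc j)) - real (T j) = real G" by (simp add: rT algebra_simps)
        \<comment> \<open>One spacing plus two errors below \<open>G\<close>. Together with
          \<open>dG\<close>, each step of the chain is below \<open>3 / 16\<close>.\<close>
        ultimately have "\<bar>a (Suc j) - a j\<bar> \<le> 3 * real G" by linarith
        then have "\<bar>\<alpha> - \<beta>\<bar> * \<bar>a (Suc j) - a j\<bar> \<le> \<bar>\<alpha> - \<beta>\<bar> * (3 * real G)"
          by (rule mult_left_mono) simp
        moreover have "\<bar>(\<alpha> - \<beta>) * (a (Suc j) - a 0) - (\<alpha> - \<beta>) * (a j - a 0)\<bar> = \<bar>\<alpha> - \<beta>\<bar> * \<bar>a (Suc j) - a j\<bar>"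
          by (simp add: algebra_simps flip: abs_mult)
        ultimately show ?thesis using dG by linarith
      qed
      show "\<exists>i::int. \<bar>(\<alpha> - \<beta>) * (a j - a 0) - i\<bar> < 1 / 8" if j: "j \<le> J" for j
      proof -
        obtain i :: int where i: "\<bar>\<alpha> * (real (off C k (p j)) - real (off C k (p 0))) - i\<bar> < 1 / 8"
          using ret[of "p j" v "p 0"] p[OF j] p[of 0] by auto
        have "\<beta> * a j \<in> \<int>" "\<beta> * a 0 \<in> \<int>"
          using off_int[of "p j" v] off_int[of "p 0" v] p[OF j] p[of 0] by (simp_all add: a_def)
        then have "\<beta> * a j - \<beta> * a 0 \<in> \<int>" by (rule Ints_diff)
        then obtain i' :: int where i': "\<beta> * a j - \<beta> * a 0 = of_int i'" by (rule Ints_cases)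
        \<comment> \<open>The products of \<open>\<beta>\<close> with start times are integers, so
          nearness to an integer passes from \<open>\<alpha>\<close> to
          \<open>\<alpha> - \<beta>\<close>.\<close>
        have "(\<alpha> - \<beta>) * (a j - a 0) - of_int (i - i') =
          \<alpha> * (real (off C k (p j)) - real (off C k (p 0))) - i"
          using i' offp[OF j] offp[of 0] by (simp add: algebra_simps)
        then show ?thesis using i by metis
      qed
    qed simp_all
    have "Suc (H - 1 - Z - G) \<le> J * G + G" using Jgt by simp
    then have "real (H - 1 - Z - G) + 1 \<le> real J * real G + real G"
      by (metis of_nat_Suc of_nat_add of_nat_le_iff of_nat_mult add.commute)
    moreover have "real (H - 1 - Z - G) = real H - 1 - real Z - real G" using Hbig G by (simp add: of_nat_diff)
    moreover have "real H - 1 \<ge> real H - real G" using G by simp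
    moreover have "\<bar>a J - real (T J)\<bar> < real G" "\<bar>a 0 - real (T 0)\<bar> < real G" using aT by simp_all
    moreover have "real (2 * (Z + 4 * G)) \<le> real H" using Hbig by (simp only: of_nat_le_iff)
    \<comment> \<open>The samples span all of the tower but the stretch and at most
      \<open>4 * G\<close>: two spacings are lost in the choice of \<open>T\<close> and
      \<open>J\<close>, two in the errors at the ends. At least half of the height remains.\<close>
    ultimately have "real H \<le> 2 * (a J - a 0)" using rT[of J] rT[of 0] by simp
    also have "2 * (a J - a 0) \<le> 2 * \<bar>a J - a 0\<bar>" by (intro mult_left_mono) simp_all
    finally have "real H \<le> 2 * \<bar>a J - a 0\<bar>" .
    then have "\<bar>\<alpha> - \<beta>\<bar> * real H \<le> \<bar>\<alpha> - \<beta>\<bar> * (2 * \<bar>a J - a 0\<bar>)" by (rule mult_left_mono) simp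
    also have "\<dots> = 2 * \<bar>(\<alpha> - \<beta>) * (a J - a 0)\<bar>" by (simp add: abs_mult)
    also have "\<dots> < 1 / 4" using chain by simp
    finally show ?thesis by (simp add: H_def)
  qed
  have here: "\<bar>\<alpha> - \<beta>\<bar> * hgt B (l k) u < 1 / 8" if u: "u \<in> vertices B (l k)" for u
  proof -
    have "real (hgt B (l k) u) \<le> 2 * real G" using hG(1)[OF u] by simp
    then have "\<bar>\<alpha> - \<beta>\<bar> * hgt B (l k) u \<le> \<bar>\<alpha> - \<beta>\<bar> * (2 * real G)" by (rule mult_left_mono) simp
    then show ?thesis using dG by linarith
  qed
  show ?thesis using \<beta>P here next_int next_near by (intro exI[of _ \<beta>]) auto
qed

text \<open>Integrality with all heights of one level says more than rationality: it makes the power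
  of the eigenvalue to the level a continuous eigenfunction of the original map
  (\<open>weakly_mixing\<close>).\<close>

theorem continuous_eigenvalue_integral:
  assumes cpt: "compact_space (path_space B)"
    and min: "minimal_cantor_system (path_space C) (vershik C)"
    and ev: "continuous_eigenvalue (path_space C) (vershik C) (cis (2 * pi * \<alpha>))"
  shows "\<exists>k. \<forall>u\<in>vertices B (l k). \<alpha> * hgt B (l k) u \<in> \<int>"
proof -
  obtain N where N: "\<forall>k\<ge>N. \<forall>v. \<forall>p\<in>segs (l k) (l (Suc k)) v. \<forall>q\<in>segs (l k) (l (Suc k)) v.
    src B (l k) (hd p) = src B (l k) (hd q) \<longrightarrow>
    (\<exists>j::int. \<bar>\<alpha> * (real (off C k p) - real (off C k q)) - j\<bar> < 1 / 8)"
    using eigenvalue_return[OF assms] by blast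
  have "\<exists>\<beta>::real. (\<forall>u\<in>vertices B (l k). \<beta> * hgt B (l k) u \<in> \<int> \<and> \<bar>\<alpha> - \<beta>\<bar> * hgt B (l k) u < 1 / 8) \<and>
    (\<forall>v\<in>vertices B (l (Suc k)). \<beta> * hgt B (l (Suc k)) v \<in> \<int> \<and> \<bar>\<alpha> - \<beta>\<bar> * hgt B (l (Suc k)) v < 1 / 4)"
    if "N \<le> k" for k
    by (rule eigenvalue_level) (use N that in blast)
  then obtain \<beta> :: "nat \<Rightarrow> real" where
    b1: "\<And>k u. N \<le> k \<Longrightarrow> u \<in> vertices B (l k) \<Longrightarrow> \<beta> k * hgt B (l k) u \<in> \<int> \<and> \<bar>\<alpha> - \<beta> k\<bar> * hgt B (l k) u < 1 / 8"
    and b2: "\<And>k v. N \<le> k \<Longrightarrow> v \<in> vertices B (l (Suc k)) \<Longrightarrow>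
      \<beta> k * hgt B (l (Suc k)) v \<in> \<int> \<and> \<bar>\<alpha> - \<beta> k\<bar> * hgt B (l (Suc k)) v < 1 / 4"
    by metis
  have step: "\<beta> (Suc k) = \<beta> k" if k: "N \<le> k" for k
  proof -
    \<comment> \<open>Level \<open>l (Suc k)\<close> is the upper level for \<open>\<beta> k\<close>
      and the lower one for \<open>\<beta> (Suc k)\<close>. Both products with its height
      \<open>H\<close> are integers within \<open>1 / 4\<close> and \<open>1 / 8\<close> of
      \<open>\<alpha> * H\<close>, so they coincide.\<close>
    obtain v where v: "v \<in> vertices B (l (Suc k))" using vertices_nonempty by blast
    define H where "H = real (hgt B (l (Suc k)) v)"
    have H: "0 < H" using hgt_pos[OF v] by (simp add: H_def)
    have i: "\<beta> (Suc k) * H \<in> \<int>" "\<bar>\<alpha> - \<beta> (Suc k)\<bar> * H < 1 / 8" "\<beta> k * H \<in> \<int>" "\<bar>\<alpha> - \<beta> k\<bar> * H < 1 / 4"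
      using b1[of "Suc k" v] b2[OF k v] k v by (auto simp: H_def)
    have "\<bar>\<beta> (Suc k) - \<beta> k\<bar> * H \<le> (\<bar>\<alpha> - \<beta> (Suc k)\<bar> + \<bar>\<alpha> - \<beta> k\<bar>) * H"
      using H by (intro mult_right_mono) auto
    then have "\<bar>(\<beta> (Suc k) - \<beta> k) * H\<bar> < 1" using i H by (simp add: abs_mult distrib_right)
    moreover have "(\<beta> (Suc k) - \<beta> k) * H \<in> \<int>" using i by (simp add: left_diff_distrib)
    ultimately have "(\<beta> (Suc k) - \<beta> k) * H = 0" using Ints_abs_less_1 by blast
    then show ?thesis using H by simp
  qed
  have const: "\<beta> (N + i) = \<beta> N" for i by (induction i) (use step in auto)
  \<comment> \<open>The same fraction serves all later levels, whose heights grow at least like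
    powers of 2.\<close>
  have "\<bar>\<alpha> - \<beta> N\<bar> * 2 ^ i < 1" for i
  proof -
    obtain v where v: "v \<in> vertices B (l (Suc (N + i)))" using vertices_nonempty by blast
    have "2 ^ Suc (N + i) * 1 \<le> 2 ^ Suc (N + i) * (zone (l (N + i)) + 4 * gap (l (N + i)))"
      using gap_pos[of "l (N + i)"] by (intro mult_le_mono2) simp
    then have "2 ^ Suc (N + i) \<le> hgt B (l (Suc (N + i))) v" using fast_growth[OF v] by linarith
    moreover have "(2::nat) ^ i \<le> 2 ^ Suc (N + i)" by (rule power_increasing) auto
    ultimately have "2 ^ i \<le> hgt B (l (Suc (N + i))) v" by linarith
    then have "(2::real) ^ i \<le> real (hgt B (l (Suc (N + i))) v)"
      by (metis of_nat_le_iff of_nat_numeral of_nat_power)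
    then have "\<bar>\<alpha> - \<beta> N\<bar> * 2 ^ i \<le> \<bar>\<alpha> - \<beta> N\<bar> * real (hgt B (l (Suc (N + i))) v)"
      by (rule mult_left_mono) simp
    also have "\<dots> < 1 / 4" using b2[of "N + i" v] v const[of i] by simp
    finally show ?thesis by simp
  qed
  note small = this
  have "\<alpha> = \<beta> N"
  proof (rule ccontr)
    assume "\<alpha> \<noteq> \<beta> N"
    then have p: "0 < \<bar>\<alpha> - \<beta> N\<bar>" by simp
    obtain i where "1 / \<bar>\<alpha> - \<beta> N\<bar> < 2 ^ i" using real_arch_pow[of 2 "1 / \<bar>\<alpha> - \<beta> N\<bar>"] by auto
    then have "1 < \<bar>\<alpha> - \<beta> N\<bar> * 2 ^ i" using p by (simp add: field_simps)
    then show False using small[of i] by simp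
  qed
  then show ?thesis using b1[of N] by auto
qed

end

section \<open>Invariant measures and measurable eigenvalues\<close>

lemma sets_borel_on: "sets (borel_on X) = sigma_sets (topspace X) {U. openin X U}"
  unfolding borel_on_def by (rule sets_measure_of) (auto dest: openin_subset)

lemma space_borel_on [simp]: "space (borel_on X) = topspace X"
  unfolding borel_on_def by (rule space_measure_of) (auto dest: openin_subset)

lemma openin_borel_on: "openin X U \<Longrightarrow> U \<in> sets (borel_on X)"
  unfolding sets_borel_on by (rule sigma_sets.Basic) simp

lemma closedin_borel_on:
  assumes "closedin X U" shows "U \<in> sets (borel_on X)"
proof -
  have "topspace X - U \<in> sets (borel_on X)" using assms by (intro openin_borel_on) (simp add: closedin_def)
  then have "space (borel_on X) - (topspace X - U) \<in> sets (borel_on X)" by (rule sets.compl_sets[of _ "borel_on X"])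
  then show ?thesis using closedin_subset[OF assms] by (simp add: double_diff)
qed

lemma measurable_borel_on:
  assumes "continuous_map X Y f"
  shows "f \<in> measurable (borel_on X) (borel_on Y)"
  unfolding borel_on_def[of Y]
proof (rule measurable_measure_of)
  show "{U. openin Y U} \<subseteq> Pow (topspace Y)" by (auto dest: openin_subset)
  show "f \<in> space (borel_on X) \<rightarrow> topspace Y" using assms by (simp add: continuous_map_def)
  fix U assume "U \<in> {U. openin Y U}"
  then have "openin X {x \<in> topspace X. f x \<in> U}" using assms by (simp add: continuous_map_def)
  moreover have "f -` U \<inter> space (borel_on X) = {x \<in> topspace X. f x \<in> U}" by auto
  ultimately show "f -` U \<inter> space (borel_on X) \<in> sets (borel_on X)" using openin_borel_on by metis
qed

lemma invariant_probabilityD: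
  assumes "invariant_probability X T \<mu>"
  shows "prob_space \<mu>" "space \<mu> = topspace X" "sets \<mu> = sets (borel_on X)"
    "T \<in> measurable \<mu> \<mu>" "distr \<mu> \<mu> T = \<mu>"
  using assms by (simp_all add: invariant_probability_def)

lemma measurable_cong_sets_on:
  assumes "f \<in> measurable (borel_on X) N" "sets \<mu> = sets (borel_on X)"
  shows "f \<in> measurable \<mu> N"
  using assms measurable_cong_sets[OF assms(2) refl] by blast

lemma invariant_probability_push:
  assumes inv: "invariant_probability X T \<mu>" and g: "g \<in> measurable (borel_on X) (borel_on Y)"
    and S: "S \<in> measurable (borel_on Y) (borel_on Y)"
    and eq: "\<And>x. x \<in> topspace X \<Longrightarrow> g (T x) = S (g x)"
  shows "invariant_probability Y S (distr \<mu> (borel_on Y) g)"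
proof -
  note \<mu> = invariant_probabilityD[OF inv]
  have g': "g \<in> measurable \<mu> (borel_on Y)" using measurable_cong_sets_on[OF g \<mu>(3)] .
  let ?\<nu> = "distr \<mu> (borel_on Y) g"
  have S': "S \<in> measurable ?\<nu> ?\<nu>" using S by simp
  have "distr ?\<nu> ?\<nu> S = distr ?\<nu> (borel_on Y) S" by (rule distr_cong) simp_all
  also have "\<dots> = distr \<mu> (borel_on Y) (S \<circ> g)" by (rule distr_distr[OF S g'])
  also have "\<dots> = distr \<mu> (borel_on Y) (g \<circ> T)" by (rule distr_cong) (simp_all add: eq \<mu>(2))
  also have "\<dots> = distr (distr \<mu> \<mu> T) (borel_on Y) g" by (rule distr_distr[OF g' \<mu>(4), symmetric])
  also have "\<dots> = ?\<nu>" by (simp add: \<mu>(5))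
  finally show ?thesis
    unfolding invariant_probability_def using S' prob_space.prob_space_distr[OF \<mu>(1) g'] by simp
qed

lemma measure_eigenvalue_pull:
  assumes g: "g \<in> measurable \<mu> N" and sp: "space \<mu> = A"
    and eq: "\<And>x. x \<in> A \<Longrightarrow> g (T x) = S (g x)"
    and ev: "measure_eigenvalue S (distr \<mu> N g) z"
  shows "measure_eigenvalue T \<mu> z"
proof -
  obtain f where f: "f \<in> borel_measurable N" and fi: "integrable (distr \<mu> N g) (\<lambda>y. (cmod (f y))\<^sup>2)"
    and nz: "\<not> (AE y in distr \<mu> N g. f y = 0)" and e: "AE y in distr \<mu> N g. f (S y) = z * f y"
    using ev unfolding measure_eigenvalue_def by auto
  have n: "(\<lambda>y. (cmod (f y))\<^sup>2) \<in> borel_measurable N" using f by measurable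
  show ?thesis
    unfolding measure_eigenvalue_def
  proof (intro exI[of _ "\<lambda>x. f (g x)"] conjI)
    show "(\<lambda>x. f (g x)) \<in> borel_measurable \<mu>" using measurable_compose[OF g f] .
    show "integrable \<mu> (\<lambda>x. (cmod (f (g x)))\<^sup>2)" using fi integrable_distr_eq[OF g n] by simp
    have "{y \<in> space N. f y = 0} \<in> sets N" using f by measurable
    then show "\<not> (AE x in \<mu>. f (g x) = 0)" using nz AE_distr_iff[OF g, of "\<lambda>y. f y = 0"] by simp
    have "AE x in \<mu>. f (S (g x)) = z * f (g x)" using AE_distrD[OF g e] .
    then show "AE x in \<mu>. f (g (T x)) = z * f (g x)"
      using AE_space by eventually_elim (simp add: eq sp)
  qed
qed

lemma conjugacy_inverse:
  assumes "conjugacy X T Y S h" and T: "T ` topspace X \<subseteq> topspace X"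
  shows "\<exists>g. conjugacy Y S X T g \<and> (\<forall>x\<in>topspace X. g (h x) = x)"
proof -
  have hh: "homeomorphic_map X Y h" and hT: "\<And>x. x \<in> topspace X \<Longrightarrow> h (T x) = S (h x)"
    using assms by (auto simp: conjugacy_def)
  obtain g where g: "homeomorphic_maps X Y h g" using hh homeomorphic_map_maps by blast
  then have "homeomorphic_map Y X g" using homeomorphic_maps_map by blast
  moreover have gh: "\<forall>x\<in>topspace X. g (h x) = x" and hg: "\<forall>y\<in>topspace Y. h (g y) = y \<and> g y \<in> topspace X"
    using g by (auto simp: homeomorphic_maps_def continuous_map_def)
  moreover have "g (S y) = T (g y)" if "y \<in> topspace Y" for y
  proof -
    have "S y = h (T (g y))" using hT[of "g y"] hg that by simp
    then show ?thesis using gh hg T that by auto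
  qed
  ultimately show ?thesis unfolding conjugacy_def by blast
qed

text \<open>An eigenfunction is pulled back along \<open>h\<close> in one direction and along its
  inverse in the other, where pushing the image measure back returns the original one.\<close>

lemma measure_eigenvalue_conjugacy:
  assumes c: "conjugacy X T Y S h" and T: "T ` topspace X \<subseteq> topspace X"
    and \<mu>: "space \<mu> = topspace X" "sets \<mu> = sets (borel_on X)"
  shows "measure_eigenvalue S (distr \<mu> (borel_on Y) h) z \<longleftrightarrow> measure_eigenvalue T \<mu> z"
proof -
  have h: "continuous_map X Y h" "\<And>x. x \<in> topspace X \<Longrightarrow> h (T x) = S (h x)"
    using c homeomorphic_imp_continuous_map by (auto simp: conjugacy_def)
  have h': "h \<in> measurable \<mu> (borel_on Y)" using measurable_cong_sets_on[OF measurable_borel_on[OF h(1)] \<mu>(2)] .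
  obtain g where g: "conjugacy Y S X T g" "\<And>x. x \<in> topspace X \<Longrightarrow> g (h x) = x"
    using conjugacy_inverse[OF c T] by blast
  have g': "continuous_map Y X g" "\<And>y. y \<in> topspace Y \<Longrightarrow> g (S y) = T (g y)"
    using g(1) homeomorphic_imp_continuous_map by (auto simp: conjugacy_def)
  let ?\<nu> = "distr \<mu> (borel_on Y) h"
  have gm: "g \<in> measurable (borel_on Y) (borel_on X)" using measurable_borel_on[OF g'(1)] .
  have "distr ?\<nu> (borel_on X) g = distr \<mu> (borel_on X) (g \<circ> h)" by (rule distr_distr[OF gm h'])
  also have "\<dots> = distr \<mu> (borel_on X) (\<lambda>x. x)" by (rule distr_cong) (simp_all add: g(2) \<mu>(1))
  also have "\<dots> = \<mu>" by (rule distr_id2) (simp add: \<mu>(2))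
  finally have pull: "distr ?\<nu> (borel_on X) g = \<mu>" .
  show ?thesis
  proof
    assume "measure_eigenvalue S ?\<nu> z"
    then show "measure_eigenvalue T \<mu> z"
      using measure_eigenvalue_pull[of h \<mu> "borel_on Y" "topspace X" T S z] h' \<mu>(1) h(2) by blast
  next
    assume "measure_eigenvalue T \<mu> z"
    then have "measure_eigenvalue T (distr ?\<nu> (borel_on X) g) z" by (simp add: pull)
    moreover have "g \<in> measurable ?\<nu> (borel_on X)" using gm by simp
    ultimately show "measure_eigenvalue S ?\<nu> z"
      using measure_eigenvalue_pull[of g ?\<nu> "borel_on X" "topspace Y" S T z] g'(2) by simp
  qed
qed

text \<open>On each piece \<open>T'\<close> inverts a measure-preserving map \<open>J k\<close>, and
  as \<open>T'\<close> is bijective the images of the pieces are again disjoint. Stated with the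
  maps \<open>J k\<close> so that these images are preimages, hence measurable.\<close>

lemma distr_piecewise:
  fixes \<kappa> :: "'x \<Rightarrow> int" and J :: "int \<Rightarrow> 'x \<Rightarrow> 'x"
  assumes T': "T' \<in> measurable M M" "bij_betw T' (space M) (space M)"
    and \<kappa>: "\<And>k. {x \<in> space M. \<kappa> x = k} \<in> sets M"
    and J: "\<And>k. J k \<in> measurable M M" "\<And>k. distr M M (J k) = M"
    and inv: "\<And>x. x \<in> space M \<Longrightarrow> J (\<kappa> x) (T' x) = x"
    and Jinj: "\<And>k. inj_on (J k) (space M)"
  shows "distr M M T' = M"
proof (rule measure_eqI)
  fix A assume "A \<in> sets (distr M M T')"
  then have A: "A \<in> sets M" by simp
  define P where "P k = {x \<in> space M. \<kappa> x = k} \<inter> (T' -` A \<inter> space M)" for k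
  define Q where "Q k = J k -` P k \<inter> space M" for k
  have P: "P k \<in> sets M" for k unfolding P_def using \<kappa> measurable_sets[OF T'(1) A] by blast
  have Q: "Q k \<in> sets M" for k unfolding Q_def using measurable_sets[OF J(1) P] .
  have PQ: "emeasure M (P k) = emeasure M (Q k)" for k
  proof -
    have "emeasure M (P k) = emeasure (distr M M (J k)) (P k)" by (simp add: J(2))
    also have "\<dots> = emeasure M (Q k)" unfolding Q_def by (rule emeasure_distr[OF J(1) P])
    finally show ?thesis .
  qed
  have sp: "T' x \<in> space M" if "x \<in> space M" for x using T'(2) that bij_betwE by blast
  \<comment> \<open>\<open>Q k\<close> was defined as a preimage under \<open>J k\<close>; it is
    also the image of the piece \<open>P k\<close>.\<close>
  have Qim: "Q k = T' ` P k" for k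
  proof (intro equalityI subsetI)
    fix y assume y: "y \<in> Q k"
    then have "J k y \<in> P k" "y \<in> space M" by (auto simp: Q_def)
    then have x: "J k y \<in> space M" "\<kappa> (J k y) = k" by (auto simp: P_def)
    then have "J k (T' (J k y)) = J k y" using inv by metis
    then have "T' (J k y) = y" using inj_onD[OF Jinj] sp[OF x(1)] \<open>y \<in> space M\<close> by metis
    then show "y \<in> T' ` P k" using \<open>J k y \<in> P k\<close> by (metis imageI)
  next
    fix y assume "y \<in> T' ` P k"
    then obtain x where x: "x \<in> P k" "y = T' x" by blast
    then have "x \<in> space M" "\<kappa> x = k" by (auto simp: P_def)
    then show "y \<in> Q k" using x inv sp by (auto simp: Q_def)
  qed
  have UP: "(\<Union>k. P k) = T' -` A \<inter> space M" by (auto simp: P_def)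
  have UQ: "(\<Union>k. Q k) = A"
  proof -
    have "(\<Union>k. Q k) = T' ` (\<Union>k. P k)" by (simp add: Qim image_UN)
    also have "\<dots> = T' ` (T' -` A \<inter> space M)" unfolding UP ..
    also have "\<dots> = A"
    proof (intro equalityI subsetI)
      fix y assume y: "y \<in> A"
      then have "y \<in> T' ` space M"
        using bij_betw_imp_surj_on[OF T'(2)] sets.sets_into_space[OF A] by blast
      then obtain x where "x \<in> space M" "y = T' x" by blast
      then show "y \<in> T' ` (T' -` A \<inter> space M)" using y by blast
    qed blast
    finally show ?thesis .
  qed
  have dP: "disjoint_family_on P UNIV" by (auto simp: disjoint_family_on_def P_def)
  have dQ: "disjoint_family_on Q UNIV"
    unfolding disjoint_family_on_def
  proof (intro ballI impI)
    fix i j :: int assume "i \<noteq> j"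
    have "T' ` (P i \<inter> P j) = T' ` P i \<inter> T' ` P j"
      by (rule inj_on_image_Int[OF bij_betw_imp_inj_on[OF T'(2)]]) (auto simp: P_def)
    moreover have "P i \<inter> P j = {}" using \<open>i \<noteq> j\<close> by (auto simp: P_def)
    ultimately show "Q i \<inter> Q j = {}" by (simp add: Qim)
  qed
  have "emeasure (distr M M T') A = emeasure M (\<Union>k. P k)" unfolding UP by (rule emeasure_distr[OF T'(1) A])
  also have "\<dots> = (\<integral>\<^sup>+k. emeasure M (P k) \<partial>count_space UNIV)"
    by (rule emeasure_UN_countable[OF P _ dP]) simp
  also have "\<dots> = (\<integral>\<^sup>+k. emeasure M (Q k) \<partial>count_space UNIV)" by (simp add: PQ)
  also have "\<dots> = emeasure M (\<Union>k. Q k)"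
    by (rule emeasure_UN_countable[OF Q _ dQ, symmetric]) simp
  also have "\<dots> = emeasure M A" unfolding UQ ..
  finally show "emeasure (distr M M T') A = emeasure M A" .
qed simp

lemma distr_funpow:
  assumes T: "T \<in> measurable M M" "distr M M T = M"
  shows "T ^^ n \<in> measurable M M \<and> distr M M (T ^^ n) = M"
proof (induction n)
  case 0
  have "distr M M (\<lambda>x. x) = M" by (rule distr_id2) simp
  then show ?case by (simp add: id_def)
next
  case (Suc n)
  then have m: "T ^^ n \<in> measurable M M" and d: "distr M M (T ^^ n) = M" by auto
  have "distr M M (T \<circ> T ^^ n) = distr (distr M M (T ^^ n)) M T"
    by (rule distr_distr[OF T(1) m, symmetric])
  then show ?case using measurable_comp[OF m T(1)] by (simp only: d T(2) funpow.simps simp_thms)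
qed

text \<open>Think of \<open>p k x\<close> and \<open>p' k x\<close> as the levels of \<open>x\<close> in towers for \<open>T\<close> and
  \<open>T'\<close>; the limit of \<open>z powi (p' k x - p k x)\<close> is a transfer function between the two
  eigenvalue equations.\<close>

lemma measure_eigenvalue_transfer:
  fixes p p' :: "nat \<Rightarrow> 'x \<Rightarrow> int"
  assumes "prob_space M"
    and T: "T \<in> measurable M M" "distr M M T = M"
    and T': "T' \<in> measurable M M" "distr M M T' = M"
    and p: "\<And>k. p k \<in> measurable M (count_space UNIV)" and p': "\<And>k. p' k \<in> measurable M (count_space UNIV)"
    and step: "AE x in M. \<forall>\<^sub>F k in sequentially. p' k (T' x) = p' k x + 1"
    and coc: "AE x in M. \<forall>\<^sub>F k in sequentially. \<exists>a b. (T ^^ a) (T' x) = (T ^^ b) x \<and>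
        int b - int a = p k (T' x) - p k x"
    and const: "AE x in M. \<exists>c. \<forall>\<^sub>F k in sequentially. p' k x - p k x = c"
    and ev: "measure_eigenvalue T M z"
  shows "measure_eigenvalue T' M z"
proof -
  interpret prob_space M by fact
  obtain f where f: "f \<in> borel_measurable M" and fi: "integrable M (\<lambda>x. (cmod (f x))\<^sup>2)"
    and nz: "\<not> (AE x in M. f x = 0)" and e: "AE x in M. f (T x) = z * f x"
    using ev unfolding measure_eigenvalue_def by blast
  have n: "(\<lambda>x. (cmod (f x))\<^sup>2) \<in> borel_measurable M" using f by measurable
  let ?I = "integral\<^sup>L M (\<lambda>x. (cmod (f x))\<^sup>2)"
  \<comment> \<open>The squared norm is invariant under \<open>T\<close> and positive, so the
    eigenvalue has modulus 1. Then the factors of the transfer function have modulus 1 as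
    well.\<close>
  have "?I \<noteq> 0" using integral_nonneg_eq_0_iff_AE[OF fi] nz by simp
  have "?I = integral\<^sup>L (distr M M T) (\<lambda>x. (cmod (f x))\<^sup>2)" by (simp add: T(2))
  also have "\<dots> = integral\<^sup>L M (\<lambda>x. (cmod (f (T x)))\<^sup>2)" by (rule integral_distr[OF T(1) n])
  also have "\<dots> = integral\<^sup>L M (\<lambda>x. (cmod z)\<^sup>2 * (cmod (f x))\<^sup>2)"
  proof (rule integral_cong_AE)
    show "(\<lambda>x. (cmod (f (T x)))\<^sup>2) \<in> borel_measurable M" using measurable_compose[OF T(1) n] .
    show "AE x in M. (cmod (f (T x)))\<^sup>2 = (cmod z)\<^sup>2 * (cmod (f x))\<^sup>2"
      using e by eventually_elim (simp add: norm_mult power_mult_distrib)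
  qed (use n in simp)
  also have "\<dots> = (cmod z)\<^sup>2 * ?I" by simp
  finally have "(cmod z)\<^sup>2 = 1" using \<open>?I \<noteq> 0\<close> by simp
  then have z1: "cmod z = 1" by (metis norm_ge_zero one_power2 power2_eq_imp_eq zero_le_one)
  then have z0: "z \<noteq> 0" by auto
  \<comment> \<open>The eigenvalue equation is needed along the whole forward orbit, since the
    number of steps separating \<open>x\<close> from \<open>T' x\<close> varies with the
    point.\<close>
  define Q where "Q x \<longleftrightarrow> (\<forall>n. f ((T ^^ n) x) = z ^ n * f x)" for x
  have "AE x in M. \<forall>n. f (T ((T ^^ n) x)) = z * f ((T ^^ n) x)"
  proof (rule AE_all_countable[THEN iffD2], rule allI)
    fix n
    have m: "T ^^ n \<in> measurable M M" and d: "distr M M (T ^^ n) = M" using distr_funpow[OF T] by auto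
    have "AE x in distr M M (T ^^ n). f (T x) = z * f x" unfolding d by (rule e)
    then show "AE x in M. f (T ((T ^^ n) x)) = z * f ((T ^^ n) x)" by (rule AE_distrD[OF m])
  qed
  then have AQ: "AE x in M. Q x"
  proof eventually_elim
    case (elim x)
    have "f ((T ^^ n) x) = z ^ n * f x" for n by (induction n) (use elim in simp_all)
    then show "Q x" by (simp add: Q_def)
  qed
  have AQ': "AE x in M. Q (T' x)" 
    by (rule AE_distrD[OF T'(1)], unfold T'(2), rule AQ)
  define cst where "cst x \<longleftrightarrow> (\<exists>c. \<forall>\<^sub>F k in sequentially. p' k x - p k x = c)" for x
  have cst: "AE x in M. cst x" using const by (simp add: cst_def)
  have cst': "AE x in M. cst (T' x)" 
    by (rule AE_distrD[OF T'(1)], unfold T'(2), rule cst)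
  define F where "F k x = z powi (p' k x - p k x) * f x" for k x
  \<comment> \<open>The sequence is eventually constant at almost every point, but the constant
    varies; writing it as a limit gives measurability.\<close>
  define L where "L x = lim (\<lambda>k. F k x)" for x
  have Fm: "F k \<in> borel_measurable M" for k
  proof -
    have "(\<lambda>x. (p' k x, p k x)) \<in> measurable M (count_space UNIV \<Otimes>\<^sub>M count_space UNIV)"
      using p p' by (intro measurable_Pair)
    then have "(\<lambda>x. (p' k x, p k x)) \<in> measurable M (count_space UNIV)"
      by (simp add: pair_measure_countable)
    then have "(\<lambda>x. z powi (p' k x - p k x)) \<in> borel_measurable M"
      using measurable_compose[of "\<lambda>x. (p' k x, p k x)" M "count_space UNIV" "\<lambda>(a, b). z powi (a - b)" borel]
      by simp
    then show ?thesis unfolding F_def using f by (intro borel_measurable_times)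
  qed
  have Lm: "L \<in> borel_measurable M" unfolding L_def using Fm by (rule borel_measurable_lim_metric)
  have Lc: "L x = z powi c * f x" if "\<forall>\<^sub>F k in sequentially. p' k x - p k x = c" for x c
  proof -
    have "(\<lambda>k. F k x) \<longlonglongrightarrow> z powi c * f x"
      by (rule tendsto_eventually) (use that in eventually_elim, simp add: F_def)
    then show ?thesis unfolding L_def by (rule limI)
  qed
  have nL: "AE x in M. cmod (L x) = cmod (f x)"
    using cst
  proof eventually_elim
    case (elim x)
    then obtain c where "\<forall>\<^sub>F k in sequentially. p' k x - p k x = c" by (auto simp: cst_def)
    then show ?case using Lc z1 by (simp add: norm_mult norm_power_int)
  qed
  have LT: "AE x in M. L (T' x) = z * L x"
    using AQ AQ' cst cst' step coc
  proof eventually_elim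
    case (elim x)
    obtain c where c: "\<forall>\<^sub>F k in sequentially. p' k x - p k x = c" using elim by (auto simp: cst_def)
    obtain c' where c': "\<forall>\<^sub>F k in sequentially. p' k (T' x) - p k (T' x) = c'" using elim by (auto simp: cst_def)
    have "\<forall>\<^sub>F k in sequentially. p' k x - p k x = c \<and> p' k (T' x) - p k (T' x) = c' \<and>
      p' k (T' x) = p' k x + 1 \<and> (\<exists>a b. (T ^^ a) (T' x) = (T ^^ b) x \<and>
        int b - int a = p k (T' x) - p k x)"
      using c c' elim by (intro eventually_conj) auto
    \<comment> \<open>A single large level at which all the eventual statements hold for
      \<open>x\<close> and \<open>T' x\<close>.\<close>
    then obtain k a b where k: "p' k x - p k x = c" "p' k (T' x) - p k (T' x) = c'"
      "p' k (T' x) = p' k x + 1" "(T ^^ a) (T' x) = (T ^^ b) x" "int b - int a = p k (T' x) - p k x"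
      using eventually_happens'[OF sequentially_bot] by blast
    have "z ^ a * f (T' x) = z ^ b * f x" using elim k(4) by (metis Q_def)
    then have "f (T' x) = z powi (int b - int a) * f x"
      using z0 by (simp add: power_int_diff field_simps)
    then have "L (T' x) = z powi c' * (z powi (int b - int a) * f x)" using Lc[OF c'] by simp
    also have "\<dots> = z powi (c' + (int b - int a)) * f x" using z0 by (simp add: power_int_add)
    \<comment> \<open>The old level of \<open>T' x\<close> cancels, which leaves the new level of
      \<open>T' x\<close> minus the old level of \<open>x\<close>; the former is one more than the
      new level of \<open>x\<close>.\<close>
    also have "c' + (int b - int a) = 1 + c" using k by simp
    also have "z powi (1 + c) * f x = z * L x" using z0 Lc[OF c] by (simp add: power_int_add)
    finally show ?case .
  qed
  show ?thesis
    unfolding measure_eigenvalue_def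
  proof (intro exI[of _ L] conjI Lm LT)
    have nLm: "(\<lambda>x. (cmod (L x))\<^sup>2) \<in> borel_measurable M" using Lm by measurable
    have "AE x in M. (cmod (L x))\<^sup>2 = (cmod (f x))\<^sup>2" using nL by eventually_elim simp
    then show "integrable M (\<lambda>x. (cmod (L x))\<^sup>2)" using integrable_cong_AE[OF nLm n] fi by blast
    show "\<not> (AE x in M. L x = 0)"
    proof
      assume "AE x in M. L x = 0"
      then have "AE x in M. f x = 0" using nL by eventually_elim (metis norm_eq_zero)
      then show False using nz by blast
    qed
  qed
qed

section \<open>Invariance under integer iterates and the mass of the lowest floors\<close>

lemma int_iterate_in:
  assumes T: "bij_betw T (topspace X) (topspace X)" and x: "x \<in> topspace X"
  shows "int_iterate X T k x \<in> topspace X"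
proof -
  have "int_iterate X T k x \<in> system_orbit X T x" by (simp add: system_orbit_def)
  then show ?thesis using system_orbit_subset[OF T x] by blast
qed

lemma int_iterate_neg:
  assumes T: "bij_betw T (topspace X) (topspace X)" and x: "x \<in> topspace X"
  shows "int_iterate X T (- k) (int_iterate X T k x) = x"
proof -
  obtain a b where k: "k = int a - int b" using int_diff_cases .
  let ?y = "int_iterate X T k x"
  have y: "?y \<in> topspace X" using int_iterate_in[OF T x] .
  have "(T ^^ a) x = (T ^^ b) ?y" using int_iterate_diff_eq_iff[OF T x y, of a b] k by simp
  then have "int_iterate X T (int b - int a) ?y = x" using int_iterate_diff_eq_iff[OF T y x, of b a] by simp
  then show ?thesis using k by simp
qed

lemma int_iterate_invariant:
  assumes hom: "homeomorphic_map X X T" and inv: "invariant_probability X T \<nu>"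
  shows "int_iterate X T k \<in> measurable \<nu> \<nu> \<and> distr \<nu> \<nu> (int_iterate X T k) = \<nu>"
proof -
  note \<nu> = invariant_probabilityD[OF inv]
  let ?I = "inv_into (topspace X) T"
  have bij: "bij_betw T (topspace X) (topspace X)" using homeomorphic_map_bij_betw[OF hom] .
  obtain g where g: "homeomorphic_maps X X T g" using hom homeomorphic_map_maps by blast
  have "continuous_map X X g" using g by (simp add: homeomorphic_maps_def)
  then have gm: "g \<in> measurable \<nu> \<nu>"
    using measurable_borel_on measurable_cong_sets[OF \<nu>(3) \<nu>(3)] by blast
  have Ig: "?I y = g y" if "y \<in> space \<nu>" for y
  proof -
    have gy: "g y \<in> topspace X" "T (g y) = y"
      using g that \<nu>(2) by (auto simp: homeomorphic_maps_def continuous_map_def)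
    have "?I (T (g y)) = g y" by (rule bij_betw_inv_into_left[OF bij gy(1)])
    then show ?thesis using gy(2) by simp
  qed
  have Im: "?I \<in> measurable \<nu> \<nu>" using gm measurable_cong[of \<nu> ?I g \<nu>] Ig by blast
  have "distr \<nu> \<nu> ?I = distr (distr \<nu> \<nu> T) \<nu> ?I" by (simp add: \<nu>(5))
  also have "\<dots> = distr \<nu> \<nu> (?I \<circ> T)" by (rule distr_distr[OF Im \<nu>(4)])
  also have "\<dots> = distr \<nu> \<nu> (\<lambda>x. x)"
    by (rule distr_cong) (simp_all add: bij_betw_inv_into_left[OF bij] \<nu>(2))
  also have "\<dots> = \<nu>" by (rule distr_id2) simp
  finally have Id: "distr \<nu> \<nu> ?I = \<nu>" .
  show ?thesis
  proof (cases "0 \<le> k")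
    case True
    then have "int_iterate X T k = T ^^ nat k" by (simp add: int_iterate_def fun_eq_iff)
    then show ?thesis using distr_funpow[OF \<nu>(4,5), of "nat k"] by simp
  next
    case False
    then have "int_iterate X T k = ?I ^^ nat (- k)" by (simp add: int_iterate_def fun_eq_iff)
    then show ?thesis using distr_funpow[OF Im Id, of "nat (- k)"] by simp
  qed
qed

lemma cylinder_sets:
  assumes "\<And>x y. x \<in> inf_paths D \<Longrightarrow> y \<in> inf_paths D \<Longrightarrow> (\<forall>i<n. y i = x i) \<Longrightarrow> P x \<Longrightarrow> P y"
  shows "{x \<in> inf_paths D. P x} \<in> sets (borel_on (path_space D))"
proof (rule openin_borel_on, rule openin_cylinder(1)[where n = n])
  fix x y assume "x \<in> {x \<in> inf_paths D. P x}" "y \<in> inf_paths D" "\<forall>i<n. y i = x i"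
  then show "y \<in> {x \<in> inf_paths D. P x}" using assms by blast
qed blast

context proper_obd
begin

lemma pos_funpow:
  assumes x: "x \<in> inf_paths D" and d: "pos D m x + d < hgt D m (src D m (x m))"
  shows "pos D m ((vershik D ^^ d) x) = pos D m x + d"
proof -
  obtain y where y: "y \<in> inf_paths D" "\<forall>i\<ge>m. y i = x i" "pos D m y = pos D m x + d"
    using pos_surj[OF inf_paths_tail[OF x] d] by blast
  have "(vershik D ^^ d) x = y" by (rule vershik_funpow[OF x y(1)]) (use y in auto)
  then show ?thesis using y(3) by simp
qed

text \<open>The towers contain at least \<open>K\<close> disjoint layers of thickness
  \<open>J\<close>. Iterates of the map carry the lowest layer into each of them, so its mass is at
  most a \<open>K\<close>-th part of the whole.\<close>

lemma measure_pos_less: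
  assumes inv: "invariant_probability (path_space D) (vershik D) \<nu>"
    and big: "\<And>v. v \<in> vertices D m \<Longrightarrow> J * K \<le> hgt D m v" and K: "0 < K"
  shows "measure \<nu> {x \<in> inf_paths D. pos D m x < J} \<le> 1 / real K"
proof -
  note \<nu> = invariant_probabilityD[OF inv]
  interpret prob_space \<nu> by (rule \<nu>(1))
  have sp: "space \<nu> = inf_paths D" using \<nu>(2) by simp
  define E where "E i = {x \<in> inf_paths D. i * J \<le> pos D m x \<and> pos D m x < Suc i * J}" for i
  have E: "E i \<in> sets \<nu>" for i
  proof -
    have "E i \<in> sets (borel_on (path_space D))"
      unfolding E_def
    proof (rule cylinder_sets[where n = m])
      fix x y assume "\<forall>j<m. y j = x j" "i * J \<le> pos D m x \<and> pos D m x < Suc i * J"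
      moreover from this have "pos D m y = pos D m x" by (intro pos_cong) simp
      ultimately show "i * J \<le> pos D m y \<and> pos D m y < Suc i * J" by simp
    qed
    then show ?thesis using \<nu>(3) by simp
  qed
  have le: "measure \<nu> (E 0) \<le> measure \<nu> (E i)" if i: "i < K" for i
  proof -
    let ?V = "vershik D ^^ (i * J)"
    have m: "?V \<in> measurable \<nu> \<nu>" and d: "distr \<nu> \<nu> ?V = \<nu>" using distr_funpow[OF \<nu>(4,5)] by auto
    \<comment> \<open>No point of the lowest layer reaches the top of its tower within
      \<open>i * J\<close> steps.\<close>
    have "E 0 \<subseteq> ?V -` E i \<inter> space \<nu>"
    proof
      fix x assume x: "x \<in> E 0"
      then have xi: "x \<in> inf_paths D" "pos D m x < J" by (auto simp: E_def)
      have "src D m (x m) \<in> vertices D m" using xi(1) src_vertex by (auto simp: inf_paths_def)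
      then have "J * K \<le> hgt D m (src D m (x m))" by (rule big)
      moreover have "Suc i * J \<le> K * J" using i by (intro mult_le_mono1) simp
      ultimately have "pos D m x + i * J < hgt D m (src D m (x m))" using xi(2) by (simp add: mult.commute)
      then have "pos D m (?V x) = pos D m x + i * J" by (rule pos_funpow[OF xi(1)])
      moreover have "?V x \<in> inf_paths D" using measurable_space[OF m] xi(1) sp by simp
      ultimately show "x \<in> ?V -` E i \<inter> space \<nu>" using xi sp by (simp add: E_def)
    qed
    then have "measure \<nu> (E 0) \<le> measure \<nu> (?V -` E i \<inter> space \<nu>)"
      by (rule finite_measure_mono) (rule measurable_sets[OF m E])
    also have "\<dots> = measure (distr \<nu> \<nu> ?V) (E i)" by (rule measure_distr[OF m E, symmetric])
    also have "\<dots> = measure \<nu> (E i)" by (simp add: d)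
    finally show ?thesis .
  qed
  have disj: "disjoint_family_on E {..<K}"
    unfolding disjoint_family_on_def
  proof (intro ballI impI)
    fix i j :: nat assume "i \<noteq> j"
    have *: "E i \<inter> E j = {}" if "i < j" for i j
    proof -
      have "Suc i * J \<le> j * J" using that by (intro mult_le_mono1) simp
      then show ?thesis by (auto simp: E_def)
    qed
    show "E i \<inter> E j = {}" using *[of i j] *[of j i] \<open>i \<noteq> j\<close> by (cases "i < j") auto
  qed
  have "real K * measure \<nu> (E 0) = (\<Sum>i<K. measure \<nu> (E 0))" by simp
  also have "\<dots> \<le> (\<Sum>i<K. measure \<nu> (E i))" by (rule sum_mono) (use le in simp)
  also have "\<dots> = measure \<nu> (\<Union>i<K. E i)"
    by (rule finite_measure_finite_Union[symmetric]) (use E disj in auto)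
  also have "\<dots> \<le> 1" by simp
  finally have "measure \<nu> (E 0) \<le> 1 / real K" using K by (simp add: field_simps)
  then show ?thesis by (simp add: E_def)
qed

end

context positive_obd
begin

text \<open>\<open>xmin\<close> lies on the lowest floor of every tower, and the heights are
  unbounded, so its mass is 0; \<open>xmax\<close> is its preimage.\<close>

lemma AE_neq_xmax:
  assumes inv: "invariant_probability (path_space B) (vershik B) \<nu>"
  shows "AE x in \<nu>. x \<noteq> xmax"
proof -
  note \<nu> = invariant_probabilityD[OF inv]
  interpret prob_space \<nu> by (rule \<nu>(1))
  have sp: "space \<nu> = inf_paths B" using \<nu>(2) by simp
  have "closedin (path_space B) {xmin}"
    using Hausdorff_path_space[of B] closedin_Hausdorff_sing_eq by (metis topspace_path_space xmin_inf)
  then have s: "{xmin} \<in> sets \<nu>" using closedin_borel_on \<nu>(3) by blast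
  have le: "measure \<nu> {xmin} \<le> 1 / real K" if K: "0 < K" for K
  proof -
    obtain m where m: "\<forall>v\<in>vertices B m. K \<le> hgt B m v" using hgt_unbounded[of 0 K] by blast
    have "{x \<in> inf_paths B. pos B m x < 1} \<in> sets (borel_on (path_space B))"
    proof (rule cylinder_sets[where n = m])
      fix x y :: "nat \<Rightarrow> 'e" assume "\<forall>j<m. y j = x j" "pos B m x < 1"
      moreover from this have "pos B m y = pos B m x" by (intro pos_cong) simp
      ultimately show "pos B m y < 1" by simp
    qed
    then have "{x \<in> inf_paths B. pos B m x < 1} \<in> sets \<nu>" using \<nu>(3) by simp
    then have "measure \<nu> {xmin} \<le> measure \<nu> {x \<in> inf_paths B. pos B m x < 1}"
      by (intro finite_measure_mono) (auto simp: pos_xmin)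
    also have "\<dots> \<le> 1 / real K" by (rule measure_pos_less[OF inv _ K]) (use m in auto)
    finally show ?thesis .
  qed
  have "measure \<nu> {xmin} = 0"
  proof (rule ccontr)
    assume "measure \<nu> {xmin} \<noteq> 0"
    then have "0 < measure \<nu> {xmin}" by (simp add: zero_less_measure_iff)
    then obtain n where "inverse (real (Suc n)) < measure \<nu> {xmin}" using reals_Archimedean by blast
    then show False using le[of "Suc n"] by (simp add: inverse_eq_divide)
  qed
  have "vershik B -` {xmin} \<inter> space \<nu> = {xmax}"
    using vershik_neq_xmin vershik_xmax xmax_inf sp by auto
  then have "measure \<nu> {xmax} = measure (distr \<nu> \<nu> (vershik B)) {xmin}"
    using measure_distr[OF \<nu>(4) s] by simp
  also have "\<dots> = 0" using \<open>measure \<nu> {xmin} = 0\<close> by (simp add: \<nu>(5))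
  finally have "emeasure \<nu> {xmax} = 0" by (simp add: emeasure_eq_measure)
  moreover have "{xmax} \<in> sets \<nu>"
    using measurable_sets[OF \<nu>(4) s] \<open>vershik B -` {xmin} \<inter> space \<nu> = {xmax}\<close> by simp
  ultimately have "{xmax} \<in> null_sets \<nu>" by blast
  from AE_not_in[OF this] show ?thesis by simp
qed

end

section \<open>The reordered map on the paths of the original diagram\<close>

context fast
begin

text \<open>Transported to the original path space, so that both maps can be compared on one measure
  space.\<close>

definition altered :: "(nat \<Rightarrow> 'e) \<Rightarrow> nat \<Rightarrow> 'e" where
  "altered x = unblock (vershik C (PI x))"

lemma altered_inf [simp]: "x \<in> inf_paths B \<Longrightarrow> altered x \<in> inf_paths B"
  by (simp add: altered_def)

lemma PI_altered: "x \<in> inf_paths B \<Longrightarrow> PI (altered x) = vershik C (PI x)"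
  by (simp add: altered_def PI_unblock)

lemma altered_funpow:
  assumes "x \<in> inf_paths B"
  shows "(altered ^^ n) x = unblock ((vershik C ^^ n) (PI x))"
proof (induction n)
  case 0 show ?case by (simp add: unblock_PI)
next
  case (Suc n)
  have "(vershik C ^^ n) (PI x) \<in> inf_paths C" by (induction n) (use assms in auto)
  then show ?case using Suc by (simp add: altered_def PI_unblock)
qed

lemma altered_bij: "bij_betw altered (inf_paths B) (inf_paths B)"
proof -
  have "bij_betw unblock (inf_paths C) (inf_paths B)"
    by (rule bij_betw_byWitness[where f' = PI]) (auto simp: unblock_PI PI_unblock)
  from bij_betw_trans[OF bij_betw_trans[OF PI_bij C.vershik_bij] this]
  show ?thesis by (simp add: altered_def[abs_def] comp_def)
qed

lemma unblock_continuous: "continuous_map (path_space C) (path_space B) unblock"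
proof (rule continuous_map_path_space)
  show "\<exists>m. \<forall>y\<in>inf_paths C. (\<forall>i<m. y i = x i) \<longrightarrow> (\<forall>i<n. unblock y i = unblock x i)"
    for x :: "nat \<Rightarrow> 'e list" and n
  proof (intro exI[of _ n] ballI impI)
    fix y assume "\<forall>i<n. y i = x i"
    then have "\<forall>i<l n. unblock y i = unblock x i" by (rule unblock_agree)
    then show "\<forall>i<n. unblock y i = unblock x i" using strict_mono_le[OF l_mono, of n] by simp
  qed
qed simp

lemma altered_continuous:
  assumes "compact_space (path_space B)"
  shows "continuous_map (path_space B) (path_space B) altered"
proof -
  have "continuous_map (path_space B) (path_space B) (unblock \<circ> (vershik C \<circ> PI))"
    by (intro continuous_map_compose[OF continuous_map_compose[OF PI_continuous
          C.vershik_continuous[OF compact_C[OF assms]]] unblock_continuous])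
  then show ?thesis by (simp add: altered_def[abs_def] comp_def)
qed

lemma altered_conjugacy:
  assumes "compact_space (path_space B)"
  shows "conjugacy (path_space B) altered (path_space C) (vershik C) PI"
  unfolding conjugacy_def using PI_homeomorphic_map[OF assms] PI_altered by simp

text \<open>\<open>altered\<close> moves each point along its own orbit by the integer time
  \<open>cocycle_C\<close>, so on each of countably many Borel pieces it is a power of the Vershik
  map.\<close>

lemma altered_invariant:
  assumes cpt: "compact_space (path_space B)"
    and inv: "invariant_probability (path_space B) (vershik B) \<nu>"
  shows "invariant_probability (path_space B) altered \<nu>"
proof -
  note \<nu> = invariant_probabilityD[OF inv]
  have sp: "space \<nu> = inf_paths B" using \<nu>(2) by simp
  have bij: "bij_betw (vershik B) (topspace (path_space B)) (topspace (path_space B))" using vershik_bij by simp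
  let ?I = "\<lambda>k. int_iterate (path_space B) (vershik B) (- k)"
  have am: "altered \<in> measurable \<nu> \<nu>"
    using measurable_borel_on[OF altered_continuous[OF cpt]] measurable_cong_sets[OF \<nu>(3) \<nu>(3)] by blast
  have "distr \<nu> \<nu> altered = \<nu>"
  proof (rule distr_piecewise[where \<kappa> = cocycle_C and J = ?I])
    show "altered \<in> measurable \<nu> \<nu>" by (rule am)
    show "bij_betw altered (space \<nu>) (space \<nu>)" using altered_bij sp by simp
    show "{x \<in> space \<nu>. cocycle_C x = k} \<in> sets \<nu>" for k
    proof -
      \<comment> \<open>The cocycle is locally constant away from \<open>xmax\<close>, so the piece
        without that point is open; the point itself is a closed set and is restored
        afterwards.\<close>
      let ?A = "{x \<in> inf_paths B. cocycle_C x = k} - {xmax}"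
      have cl: "closedin (path_space B) {xmax}"
        using Hausdorff_path_space[of B] closedin_Hausdorff_sing_eq by (metis topspace_path_space xmax_inf)
      have "\<exists>n. \<forall>y\<in>inf_paths B. (\<forall>i<n. y i = x i) \<longrightarrow> y \<in> {x \<in> inf_paths B. cocycle_C x = k} - {xmax}"
        if "x \<in> ?A" for x
      proof -
        have x: "x \<in> inf_paths B" "x \<noteq> xmax" "cocycle_C x = k" using that by auto
        obtain m where m: "\<forall>y\<in>inf_paths B. (\<forall>i<m. y i = x i) \<longrightarrow> cocycle_C y = cocycle_C x"
          using cocycle_C_locally[OF x(1,2)] by blast
        obtain j where j: "x j \<noteq> xmax j" using x(2) by auto
        have "y \<in> ?A" if y: "y \<in> inf_paths B" "\<forall>i<max m (Suc j). y i = x i" for y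
        proof -
          have "y j = x j" using y(2) by simp
          then have "y \<noteq> xmax" using j by auto
          then show ?thesis using m y x(3) by simp
        qed
        then show ?thesis by blast
      qed
      then have "openin (path_space B) ?A" unfolding openin_path_space_iff by blast
      then have 1: "?A \<in> sets \<nu>" using openin_borel_on \<nu>(3) by blast
      have 2: "{xmax} \<in> sets \<nu>" using closedin_borel_on[OF cl] \<nu>(3) by simp
      show ?thesis
      proof (cases "cocycle_C xmax = k")
        case True
        then have "{x \<in> inf_paths B. cocycle_C x = k} = ?A \<union> {xmax}" using xmax_inf by blast
        then show ?thesis using sets.Un[OF 1 2] unfolding sp by metis
      next
        case False
        then have "{x \<in> inf_paths B. cocycle_C x = k} = ?A" by blast
        then show ?thesis using 1 unfolding sp by metis
      qed
    qed
    show "?I k \<in> measurable \<nu> \<nu>" "distr \<nu> \<nu> (?I k) = \<nu>" for k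
      using int_iterate_invariant[OF vershik_homeomorphic_map[OF cpt] inv] by blast+
    show "?I (cocycle_C x) (altered x) = x" if "x \<in> space \<nu>" for x
    proof -
      have x: "x \<in> inf_paths B" using that sp by simp
      have "altered x = int_iterate (path_space B) (vershik B) (cocycle_C x) x"
        unfolding altered_def by (rule vershik_C_cocycle[OF x, symmetric])
      then show ?thesis using int_iterate_neg[OF bij, of x] x by simp
    qed
    show "inj_on (?I k) (space \<nu>)" for k
    proof (rule inj_on_inverseI)
      fix x assume "x \<in> space \<nu>"
      then show "int_iterate (path_space B) (vershik B) (- (- k)) (?I k x) = x"
        using sp by (intro int_iterate_neg[OF bij]) simp
    qed
  qed
  then show ?thesis unfolding invariant_probability_def using \<nu> am by simp
qed

text \<open>From one level to the next, the old level grows by \<open>seg_off\<close> and the new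
  one by \<open>off C\<close>. By \<open>off_C_rest\<close> the two increments agree once the point
  avoids the exceptional sets \<open>A k\<close>, whose measures are bounded by a geometric
  series.\<close>

lemma AE_levels:
  assumes inv: "invariant_probability (path_space B) (vershik B) \<nu>"
  shows "AE x in \<nu>. \<exists>c. \<forall>\<^sub>F k in sequentially. int (pos C k (PI x)) - int (pos B (l k) x) = c"
proof -
  note \<nu> = invariant_probabilityD[OF inv]
  interpret prob_space \<nu> by (rule \<nu>(1))
  have sp: "space \<nu> = inf_paths B" using \<nu>(2) by simp
  \<comment> \<open>Besides the length of the stretch, the threshold absorbs the level in the lower
    tower, which is below \<open>gap (l k)\<close>; a path outside \<open>A k\<close> thus follows
    an unsorted segment.\<close>
  define A where "A k = {x \<in> inf_paths B. pos B (l (Suc k)) x < zone (l k) + 4 * gap (l k)}" for k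
  have A: "A k \<in> sets \<nu>" for k
  proof -
    have "A k \<in> sets (borel_on (path_space B))"
      unfolding A_def
    proof (rule cylinder_sets[where n = "l (Suc k)"])
      fix x y :: "nat \<Rightarrow> 'e" assume "\<forall>j<l (Suc k). y j = x j" "pos B (l (Suc k)) x < zone (l k) + 4 * gap (l k)"
      moreover from this have "pos B (l (Suc k)) y = pos B (l (Suc k)) x" by (intro pos_cong) simp
      ultimately show "pos B (l (Suc k)) y < zone (l k) + 4 * gap (l k)" by simp
    qed
    then show ?thesis using \<nu>(3) by simp
  qed
  have mA: "measure \<nu> (A k) \<le> (1 / 2) ^ Suc k" for k
  proof -
    have "measure \<nu> (A k) \<le> 1 / real (2 ^ Suc k)"
      unfolding A_def by (rule measure_pos_less[OF inv]) (use fast_growth in \<open>auto simp: mult_ac\<close>)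
    then show ?thesis by (simp add: power_one_over)
  qed
  have "summable (\<lambda>k. measure \<nu> (A k))"
  proof (rule summable_comparison_test')
    show "summable (\<lambda>k. (1 / 2 :: real) ^ Suc k)" by (subst summable_Suc_iff) (rule summable_geometric, simp)
    show "norm (measure \<nu> (A k)) \<le> (1 / 2) ^ Suc k" if "k \<ge> 0" for k using mA by simp
  qed
  then have "AE x in \<nu>. \<forall>\<^sub>F k in sequentially. x \<in> space \<nu> - A k"
    using A by (intro borel_cantelli_AE1) (auto simp: emeasure_eq_measure)
  then show ?thesis
  proof eventually_elim
    case (elim x)
    then obtain N where N: "\<And>k. N \<le> k \<Longrightarrow> x \<in> space \<nu> - A k" by (auto simp: eventually_sequentially)
    have x: "x \<in> inf_paths B" using N[of N] sp by simp
    define d where "d k = int (pos C k (PI x)) - int (pos B (l k) x)" for k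
    have step: "d (Suc k) = d k" if k: "N \<le> k" for k
    proof -
      let ?p = "map x [l k..<l (Suc k)]"
      note p = inf_path_seg[OF x l_less[of k]]
      have ps: "pos B (l (Suc k)) x = pos B (l k) x + seg_off B (l k) ?p" 
        by (rule pos_seg[OF less_imp_le[OF l_less]])
      have "zone (l k) + 4 * gap (l k) \<le> pos B (l (Suc k)) x" using N[OF k] x sp by (auto simp: A_def)
      moreover have "src B (l k) (x (l k)) \<in> vertices B (l k)" using x src_vertex by (auto simp: inf_paths_def)
      then have "pos B (l k) x < gap (l k)" using pos_less[OF x, of "l k"] hgt_le_gap by (meson less_le_trans)
      ultimately have "zone (l k) \<le> seg_off B (l k) ?p" using ps by simp
      then have "off C k ?p = seg_off B (l k) ?p"
        using p by (intro off_C_rest[of ?p k "src B (l (Suc k)) (x (l (Suc k)))"]) (auto simp: segs_def)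
      then have "pos C (Suc k) (PI x) = pos C k (PI x) + seg_off B (l k) ?p"
        by (simp add: path_identification_def)
      then show ?thesis using ps by (simp add: d_def)
    qed
    have "d (N + i) = d N" for i by (induction i) (use step in auto)
    then have "\<forall>k\<ge>N. d k = d N" using le_Suc_ex by metis
    then show ?case unfolding d_def[symmetric] by (auto simp: eventually_sequentially)
  qed
qed

lemma altered_eventually:
  assumes x: "x \<in> inf_paths B" "x \<noteq> xmax"
  shows "\<forall>\<^sub>F k in sequentially. pos C k (PI (altered x)) = Suc (pos C k (PI x)) \<and> (\<forall>i\<ge>l k. altered x i = x i)"
proof -
  have "PI x \<noteq> C.xmax" using x(2) C_xmax unblock_PI by metis
  then obtain n where n: "\<forall>k\<ge>n. (\<forall>i\<ge>k. vershik C (PI x) i = PI x i) \<and>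
      pos C k (vershik C (PI x)) = Suc (pos C k (PI x))"
    using C.vershik_eventually[OF PI_inf[OF x(1)]] by blast
  have "\<forall>i\<ge>l k. altered x i = x i" if "n \<le> k" for k
  proof -
    have "\<forall>i\<ge>k. vershik C (PI x) i = PI x i" using n that by blast
    from unblock_agree_tail[OF this] show ?thesis unfolding unblock_PI altered_def .
  qed
  moreover have "pos C k (PI (altered x)) = Suc (pos C k (PI x))" if "n \<le> k" for k
    using n that PI_altered[OF x(1)] by simp
  ultimately show ?thesis unfolding eventually_sequentially by blast
qed

lemma vershik_eventually_l:
  assumes x: "x \<in> inf_paths B" "x \<noteq> xmax"
  shows "\<forall>\<^sub>F k in sequentially. pos B (l k) (vershik B x) = Suc (pos B (l k) x) \<and> (\<forall>i\<ge>k. PI (vershik B x) i = PI x i)"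
proof -
  obtain n where n: "\<forall>k\<ge>n. (\<forall>i\<ge>k. vershik B x i = x i) \<and> pos B k (vershik B x) = Suc (pos B k x)"
    using vershik_eventually[OF x] by blast
  have ln: "n \<le> l k" if "n \<le> k" for k using strict_mono_le[OF l_mono, of k] that by simp
  have "\<forall>i\<ge>k. PI (vershik B x) i = PI x i" if "n \<le> k" for k
    by (rule PI_agree_tail) (use n ln[OF that] in auto)
  moreover have "pos B (l k) (vershik B x) = Suc (pos B (l k) x)" if "n \<le> k" for k
    using n ln[OF that] by blast
  ultimately show ?thesis unfolding eventually_sequentially by blast
qed

text \<open>The transfer is used in both directions with the two level functions exchanged; the
  eventual constant merely changes its sign.\<close>

theorem measure_eigenvalue_altered:
  assumes cpt: "compact_space (path_space B)"
    and inv: "invariant_probability (path_space B) (vershik B) \<nu>"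
  shows "measure_eigenvalue altered \<nu> z \<longleftrightarrow> measure_eigenvalue (vershik B) \<nu> z"
proof -
  note \<nu> = invariant_probabilityD[OF inv] and \<nu>' = invariant_probabilityD[OF altered_invariant[OF cpt inv]]
  have sp: "space \<nu> = inf_paths B" using \<nu>(2) by simp
  let ?p = "\<lambda>k x. int (pos B (l k) x)" and ?q = "\<lambda>k x. int (pos C k (PI x))"
  have meas: "f \<in> measurable \<nu> (count_space UNIV)"
    if f: "\<And>x y. \<forall>i<n. y i = x i \<Longrightarrow> f y = f x" for f :: "(nat \<Rightarrow> 'e) \<Rightarrow> int" and n
  proof -
    have "f -` {a} \<inter> space \<nu> \<in> sets \<nu>" for a
    proof -
      have "{x \<in> inf_paths B. f x = a} \<in> sets (borel_on (path_space B))"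
        by (rule cylinder_sets[where n = n]) (use f in metis)
      moreover have "f -` {a} \<inter> space \<nu> = {x \<in> inf_paths B. f x = a}" using sp by auto
      ultimately show ?thesis using \<nu>(3) by simp
    qed
    then show ?thesis by (subst measurable_count_space_eq2_countable) auto
  qed
  have pm: "?p k \<in> measurable \<nu> (count_space UNIV)" for k
  proof (rule meas[of "l k" "?p k"])
    fix x y :: "nat \<Rightarrow> 'e" assume "\<forall>i<l k. y i = x i"
    then have "pos B (l k) y = pos B (l k) x" by (intro pos_cong) simp
    then show "?p k y = ?p k x" by simp
  qed
  have qm: "?q k \<in> measurable \<nu> (count_space UNIV)" for k
  proof (rule meas[of "l k" "?q k"])
    fix x y :: "nat \<Rightarrow> 'e" assume "\<forall>i<l k. y i = x i"
    then have "\<forall>i<k. PI y i = PI x i" by (rule PI_agree)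
    then have "pos C k (PI y) = pos C k (PI x)" by (intro pos_cong) simp
    then show "?q k y = ?q k x" by simp
  qed
  have good: "AE x in \<nu>. x \<in> inf_paths B \<and> x \<noteq> xmax"
    using AE_neq_xmax[OF inv] AE_space by eventually_elim (simp add: sp)
  show ?thesis
  proof
    assume ev: "measure_eigenvalue (vershik B) \<nu> z"
    show "measure_eigenvalue altered \<nu> z"
    proof (rule measure_eigenvalue_transfer[where p = ?p and p' = ?q and T = "vershik B" and T' = altered,
          OF \<nu>(1) \<nu>(4,5) \<nu>'(4,5) pm qm _ _ AE_levels[OF inv] ev])
      show "AE x in \<nu>. \<forall>\<^sub>F k in sequentially. ?q k (altered x) = ?q k x + 1"
        using good
      proof eventually_elim
        case (elim x)
        then have "\<forall>\<^sub>F k in sequentially. pos C k (PI (altered x)) = Suc (pos C k (PI x)) \<and> (\<forall>i\<ge>l k. altered x i = x i)"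
          using altered_eventually by blast
        then show ?case by eventually_elim simp
      qed
      show "AE x in \<nu>. \<forall>\<^sub>F k in sequentially. \<exists>a b. (vershik B ^^ a) (altered x) = (vershik B ^^ b) x \<and>
        int b - int a = ?p k (altered x) - ?p k x"
        using good
      proof eventually_elim
        case (elim x)
        then have "\<forall>\<^sub>F k in sequentially. pos C k (PI (altered x)) = Suc (pos C k (PI x)) \<and> (\<forall>i\<ge>l k. altered x i = x i)"
          using altered_eventually by blast
        then show ?case
        proof eventually_elim
          case (elim k)
          then obtain a b where "(vershik B ^^ a) x = (vershik B ^^ b) (altered x)"
            "int a - int b = ?p k (altered x) - ?p k x"
            using vershik_funpow_diff[of x "altered x" "l k"] \<open>x \<in> inf_paths B \<and> x \<noteq> xmax\<close> by auto
          then show ?case by metis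
        qed
      qed
    qed
  next
    assume ev: "measure_eigenvalue altered \<nu> z"
    show "measure_eigenvalue (vershik B) \<nu> z"
    proof (rule measure_eigenvalue_transfer[where p = ?q and p' = ?p and T = altered and T' = "vershik B",
          OF \<nu>(1) \<nu>'(4,5) \<nu>(4,5) qm pm _ _ _ ev])
      show "AE x in \<nu>. \<forall>\<^sub>F k in sequentially. ?p k (vershik B x) = ?p k x + 1"
        using good
      proof eventually_elim
        case (elim x)
        then have "\<forall>\<^sub>F k in sequentially. pos B (l k) (vershik B x) = Suc (pos B (l k) x) \<and> (\<forall>i\<ge>k. PI (vershik B x) i = PI x i)"
          using vershik_eventually_l by blast
        then show ?case by eventually_elim simp
      qed
      show "AE x in \<nu>. \<forall>\<^sub>F k in sequentially. \<exists>a b. (altered ^^ a) (vershik B x) = (altered ^^ b) x \<and>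
        int b - int a = ?q k (vershik B x) - ?q k x"
        using good
      proof eventually_elim
        case (elim x)
        then have "\<forall>\<^sub>F k in sequentially. pos B (l k) (vershik B x) = Suc (pos B (l k) x) \<and> (\<forall>i\<ge>k. PI (vershik B x) i = PI x i)"
          using vershik_eventually_l by blast
        then show ?case
        proof eventually_elim
          case (elim k)
          have x: "x \<in> inf_paths B" using \<open>x \<in> inf_paths B \<and> x \<noteq> xmax\<close> by simp
          obtain a b where ab: "(vershik C ^^ a) (PI x) = (vershik C ^^ b) (PI (vershik B x))"
            "int a - int b = ?q k (vershik B x) - ?q k x"
            using C.vershik_funpow_diff[of "PI x" "PI (vershik B x)" k] elim x by auto
          have "(altered ^^ b) (vershik B x) = (altered ^^ a) x"
            using altered_funpow[OF x, of a] altered_funpow[OF vershik_inf[OF x], of b] ab(1) by simp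
          then show ?case using ab(2) by blast
        qed
      qed
      show "AE x in \<nu>. \<exists>c. \<forall>\<^sub>F k in sequentially. ?p k x - ?q k x = c"
        using AE_levels[OF inv]
      proof eventually_elim
        case (elim x)
        then obtain c where "\<forall>\<^sub>F k in sequentially. ?q k x - ?p k x = c" by blast
        then have "\<forall>\<^sub>F k in sequentially. ?p k x - ?q k x = - c" by eventually_elim simp
        then show ?case by blast
      qed
    qed
  qed
qed

end

section \<open>Simplicity, weak mixing and the choice of the contraction\<close>

context positive_obd
begin

text \<open>The bound for level \<open>l (Suc k)\<close> involves only \<open>l k\<close>, and
  heights are eventually as large as desired, so the levels can be chosen recursively.\<close>

lemma ex_fast: "\<exists>l. fast B l"
proof -
  define good where "good k n m \<longleftrightarrow> n < m \<and>
    (\<forall>v\<in>vertices B m. 2 ^ Suc k * (zone n + 4 * gap n) \<le> hgt B m v)" for k n m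
  define l where "l = rec_nat (0::nat) (\<lambda>k n. SOME m. good k n m)"
  have l: "good k (l k) (l (Suc k))" for k
  proof -
    have "\<exists>m. good k (l k) m" using hgt_unbounded unfolding good_def by blast
    then have "good k (l k) (SOME m. good k (l k) m)" by (rule someI_ex)
    then show ?thesis by (simp add: l_def)
  qed
  have "fast B l"
  proof
    show "strict_mono l" using l by (intro strict_monoI_Suc) (simp add: good_def)
    show "l 0 = 0" by (simp add: l_def)
    show "2 ^ Suc k * (zone (l k) + 4 * gap (l k)) \<le> hgt B (l (Suc k)) v"
      if "v \<in> vertices B (l (Suc k))" for v k
      using l[of k] that by (simp add: good_def)
  qed
  then show ?thesis by blast
qed

end

context fast
begin

text \<open>By \<open>seg_dense\<close> any two vertices of consecutive levels are already joined,
  so one step is enough.\<close>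

lemma simple_C: "simple_diagram C"
  unfolding simple_diagram_def
proof (intro allI impI)
  fix m :: nat
  have "0 < incidence_prod C m (Suc m - m) u v" if u: "u \<in> vertices C m" and v: "v \<in> vertices C (Suc m)" for u v
  proof -
    have u': "u \<in> vertices B (l m)" and v': "v \<in> vertices B (l (Suc m))" using u v by simp_all
    obtain p where "p \<in> segs (l m) (l (Suc m)) v" "src B (l m) (hd p) = u"
      using seg_dense[OF u' v' l_Suc hgt_pos[OF v']] by blast
    then have "{e \<in> edges C m. src C m e = u \<and> rng C m e = v} \<noteq> {}" by (auto simp: segs_def)
    then have "0 < incidence C m u v" unfolding incidence_def by (simp add: card_gt_0_iff)
    moreover have "incidence_prod C m (Suc m - m) u v = incidence C m u v"
    proof -
      have "incidence_prod C m (Suc m - m) u v =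
        (\<Sum>w\<in>vertices B (l m). (if u = w then 1 else 0) * incidence C m w v)"
        by (simp add: Suc_diff_le)
      also have "\<dots> = (\<Sum>w\<in>vertices B (l m). if w = u then incidence C m w v else 0)"
        by (rule sum.cong) auto
      also have "\<dots> = incidence C m u v" using u' by simp
      finally show ?thesis .
    qed
    ultimately show ?thesis by simp
  qed
  then show "\<exists>n>m. \<forall>u\<in>vertices C m. \<forall>v\<in>vertices C n. 0 < incidence_prod C m (n - m) u v"
    by (intro exI[of _ "Suc m"]) blast
qed

lemma BV_C: "BV_representation C (path_space C) (vershik C)"
proof -
  have "conjugacy (path_space C) (vershik C) (path_space C) (vershik C) id"
    by (simp add: conjugacy_def)
  then show ?thesis
    unfolding BV_representation_def using ordered_C properly_ordered_C simple_C by blast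
qed

lemma no_irrational_eigenvalue:
  assumes cpt: "compact_space (path_space B)"
    and min: "minimal_cantor_system (path_space C) (vershik C)"
    and z: "irrational_phase z"
  shows "\<not> continuous_eigenvalue (path_space C) (vershik C) z"
proof
  assume ev: "continuous_eigenvalue (path_space C) (vershik C) z"
  obtain \<alpha> :: real where \<alpha>: "\<alpha> \<notin> \<rat>" "z = exp (2 * \<i> * of_real pi * of_real \<alpha>)"
    using z unfolding irrational_phase_def by blast
  have "z = cis (2 * pi * \<alpha>)" unfolding \<alpha>(2) cis_conv_exp by (simp add: mult_ac)
  then obtain k where k: "\<forall>u\<in>vertices B (l k). \<alpha> * hgt B (l k) u \<in> \<int>"
    using continuous_eigenvalue_integral[OF cpt min] ev by blast
  obtain u where u: "u \<in> vertices B (l k)" using vertices_nonempty by blast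
  have "\<alpha> * hgt B (l k) u \<in> \<rat>" using k u Ints_subset_Rats by blast
  then have "\<alpha> * hgt B (l k) u / hgt B (l k) u \<in> \<rat>" by (rule Rats_divide) simp
  then show False using \<alpha>(1) hgt_pos[OF u] by simp
qed

text \<open>At some level all powers of an eigenvalue \<open>z\<close> to a height are 1. Then
  \<open>z\<close> to the power of the level is a continuous eigenfunction of the original system,
  since passing from the top of a tower to the bottom of another costs nothing. So \<open>z\<close>
  is a root of unity and an eigenvalue there, which leaves \<open>z = 1\<close>.\<close>

lemma weakly_mixing:
  assumes cpt: "compact_space (path_space B)"
    and min: "minimal_cantor_system (path_space C) (vershik C)"
    and h: "conjugacy X T (path_space B) (vershik B) h"
    and X: "\<And>z. z \<noteq> 1 \<Longrightarrow> \<exists>k>0. z ^ k = 1 \<Longrightarrow> \<not> continuous_eigenvalue X T z"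
  shows "topologically_weakly_mixing (path_space C) (vershik C)"
  unfolding topologically_weakly_mixing_def
proof (intro allI impI)
  fix z f assume f: "continuous_eigenfunction (path_space C) (vershik C) z f"
  have "z = 1"
  proof (rule ccontr)
    assume z1: "z \<noteq> 1"
    define \<alpha> where "\<alpha> = Arg z / (2 * pi)"
    have nz: "cmod z = 1" using minimal_eigenfunction(1)[OF min f] .
    then have z0: "z \<noteq> 0" by auto
    have "cis (Arg z) = z" using cis_Arg[OF z0] nz by (simp add: sgn_div_norm)
    then have z: "cis (2 * pi * \<alpha>) = z" by (simp add: \<alpha>_def)
    then have "continuous_eigenvalue (path_space C) (vershik C) (cis (2 * pi * \<alpha>))"
      using f unfolding continuous_eigenvalue_def by auto
    then obtain k where k: "\<forall>u\<in>vertices B (l k). \<alpha> * hgt B (l k) u \<in> \<int>"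
      using continuous_eigenvalue_integral[OF cpt min] by blast
    have root: "z ^ hgt B (l k) u = 1" if u: "u \<in> vertices B (l k)" for u
    proof -
      have "z ^ hgt B (l k) u = cis (real (hgt B (l k) u) * (2 * pi * \<alpha>))"
        unfolding z[symmetric] by (rule Complex.DeMoivre)
      also have "real (hgt B (l k) u) * (2 * pi * \<alpha>) = 2 * pi * (\<alpha> * hgt B (l k) u)" by (simp only: mult_ac)
      also have "cis \<dots> = 1" using k u by (intro cis_multiple_2pi) blast
      finally show ?thesis .
    qed
    let ?F = "\<lambda>x. z ^ pos B (l k) x"
    have "continuous_map (path_space B) euclidean ?F"
    proof (rule continuous_map_locally_constant)
      show "\<exists>m. \<forall>y\<in>inf_paths B. (\<forall>i<m. y i = x i) \<longrightarrow> ?F y = ?F x" for x :: "nat \<Rightarrow> 'e"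
      proof (intro exI[of _ "l k"] ballI impI)
        fix y assume "\<forall>i<l k. y i = x i"
        then have "pos B (l k) y = pos B (l k) x" by (intro pos_cong) simp
        then show "?F y = ?F x" by simp
      qed
    qed simp
    moreover have hc: "continuous_map X (path_space B) h" and hT: "\<And>x. x \<in> topspace X \<Longrightarrow> h (T x) = vershik B (h x)"
      using h homeomorphic_imp_continuous_map by (auto simp: conjugacy_def)
    ultimately have "continuous_map X euclidean (?F \<circ> h)" using continuous_map_compose by blast
    moreover have "?F (h (T x)) = z * ?F (h x)" if x: "x \<in> topspace X" for x
    proof -
      have hx: "h x \<in> inf_paths B" using hc x by (auto simp: continuous_map_def)
      show ?thesis
      proof (cases "\<forall>i<l k. max_edge B i (h x i)")
        case True
        have "src B (l k) (h x (l k)) \<in> vertices B (l k)" using hx src_vertex by (auto simp: inf_paths_def)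
        \<comment> \<open>At the top of a tower one more step would complete the height; the image
          is at time 0, where the function is 1.\<close>
        then have "z ^ Suc (pos B (l k) (h x)) = 1" using pos_max_iff[OF hx, of "l k"] True root by metis
        then show ?thesis using pos_vershik_top[OF hx True] hT[OF x] by simp
      next
        case False
        then have "pos B (l k) (vershik B (h x)) = Suc (pos B (l k) (h x))"
          using vershik_nonmax[OF hx, of "l k"] by blast
        then show ?thesis using hT[OF x] by simp
      qed
    qed
    moreover have "\<exists>x\<in>topspace X. ?F (h x) \<noteq> 0"
    proof -
      have "h ` topspace X = inf_paths B"
        using h homeomorphic_imp_surjective_map by (fastforce simp: conjugacy_def)
      then obtain x where "x \<in> topspace X" using xmax_inf by blast
      moreover have "?F (h x) \<noteq> 0" using z0 by simp
      ultimately show ?thesis by blast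
    qed
    ultimately have "continuous_eigenvalue X T z"
      unfolding continuous_eigenvalue_def continuous_eigenfunction_def
      by (intro exI[of _ "?F \<circ> h"]) simp
    moreover obtain u where u: "u \<in> vertices B (l k)" using vertices_nonempty by blast
    then have "\<exists>k>0. z ^ k = 1" using root[OF u] hgt_pos[OF u] by blast
    ultimately show False using X z1 by blast
  qed
  then have inv: "f (vershik C x) = f x" if "x \<in> topspace (path_space C)" for x
    using f that by (simp add: continuous_eigenfunction_def)
  have fc: "continuous_map (path_space C) euclidean f" using f by (simp add: continuous_eigenfunction_def)
  show "\<exists>c. \<forall>x\<in>topspace (path_space C). f x = c"
  proof (intro exI ballI)
    fix x assume x: "x \<in> topspace (path_space C)"
    show "f x = f C.xmax"
      by (rule minimal_invariant_const[where g = f, OF min fc inv x]) simp_all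
  qed
qed

theorem contracted_system:
  assumes X: "minimal_cantor_system X T"
    and h: "conjugacy X T (path_space B) (vershik B) h"
  shows "contraction_modification B l C \<and>
     BV_representation C (path_space C) (vershik C) \<and>
     minimal_cantor_system (path_space C) (vershik C) \<and>
     (\<exists>\<phi>. strong_orbit_equivalence X T (path_space C) (vershik C) \<phi> \<and>
        (\<forall>\<mu>. invariant_probability X T \<mu> \<longrightarrow>
           distr \<mu> (borel_on (path_space C)) \<phi> = transported_measure l C h \<mu> \<and>
           invariant_probability (path_space C) (vershik C) (transported_measure l C h \<mu>))) \<and>
     (\<forall>z. irrational_phase z \<longrightarrow> \<not> continuous_eigenvalue (path_space C) (vershik C) z) \<and>
     (\<forall>\<mu>. ergodic_probability X T \<mu> \<longrightarrow>
        (\<forall>z. measure_eigenvalue T \<mu> z \<longleftrightarrow>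
             measure_eigenvalue (vershik C) (transported_measure l C h \<mu>) z)) \<and>
     ((\<forall>z. z \<noteq> 1 \<and> (\<exists>k>0. z ^ k = 1) \<longrightarrow> \<not> continuous_eigenvalue X T z) \<longrightarrow>
        topologically_weakly_mixing (path_space C) (vershik C))"
proof -
  have hh: "homeomorphic_map X (path_space B) h" and hT: "\<And>x. x \<in> topspace X \<Longrightarrow> h (T x) = vershik B (h x)"
    using h by (auto simp: conjugacy_def)
  have "compact_space X" using X cantor_space_compact by (auto simp: minimal_cantor_system_def)
  then have cpt: "compact_space (path_space B)"
    using homeomorphic_compact_space[OF homeomorphic_map_imp_homeomorphic_space[OF hh]] by blast
  have Tb: "bij_betw T (topspace X) (topspace X)" using minimal_cantor_bij[OF X] .
  have soe: "strong_orbit_equivalence X T (path_space C) (vershik C) (PI \<circ> h)"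
    by (rule strong_orbit_equivalence_PI[OF cpt h Tb])
  have homC: "homeomorphic_map (path_space C) (path_space C) (vershik C)"
    using C.vershik_homeomorphic_map[OF compact_C[OF cpt]] .
  have min: "minimal_cantor_system (path_space C) (vershik C)"
    using orbit_equivalence_minimal[OF X _ homC] soe by (auto simp: strong_orbit_equivalence_def)
  have hm: "h \<in> measurable (borel_on X) (borel_on (path_space B))"
    using measurable_borel_on[OF homeomorphic_imp_continuous_map[OF hh]] .
  have Pm: "PI \<in> measurable (borel_on (path_space B)) (borel_on (path_space C))"
    using measurable_borel_on[OF PI_continuous] .
  have Vm: "vershik B \<in> measurable (borel_on (path_space B)) (borel_on (path_space B))"
    using measurable_borel_on[OF vershik_continuous[OF cpt]] .
  have Sm: "vershik C \<in> measurable (borel_on (path_space C)) (borel_on (path_space C))"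
    using measurable_borel_on[OF C.vershik_continuous[OF compact_C[OF cpt]]] .
  define push where "push \<mu> = distr \<mu> (borel_on (path_space B)) h" for \<mu>
  have push_inv: "invariant_probability (path_space B) (vershik B) (push \<mu>)"
    if "invariant_probability X T \<mu>" for \<mu>
    unfolding push_def by (rule invariant_probability_push[OF that hm Vm hT])
  have trans: "transported_measure l C h \<mu> = distr (push \<mu>) (borel_on (path_space C)) PI"
    if "invariant_probability X T \<mu>" for \<mu>
  proof -
    have "h \<in> measurable \<mu> (borel_on (path_space B))"
      using measurable_cong_sets_on[OF hm] invariant_probabilityD(3)[OF that] .
    then show ?thesis
      unfolding push_def transported_measure_def by (simp add: distr_distr[OF Pm] comp_def)
  qed
  have trans_inv: "invariant_probability (path_space C) (vershik C) (transported_measure l C h \<mu>)"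
    if "invariant_probability X T \<mu>" for \<mu>
    unfolding trans[OF that]
    by (rule invariant_probability_push[OF altered_invariant[OF cpt push_inv[OF that]] Pm Sm])
      (simp add: PI_altered)
  \<comment> \<open>Three comparisons: along \<open>h\<close>, then between the two maps on the path
    space of \<open>B\<close>, then along \<open>PI\<close>.\<close>
  have "measure_eigenvalue T \<mu> z \<longleftrightarrow> measure_eigenvalue (vershik C) (transported_measure l C h \<mu>) z"
    if "invariant_probability X T \<mu>" for \<mu> z
  proof -
    note \<mu> = invariant_probabilityD[OF that] and \<nu> = invariant_probabilityD[OF push_inv[OF that]]
    have "measure_eigenvalue T \<mu> z \<longleftrightarrow> measure_eigenvalue (vershik B) (push \<mu>) z"
      unfolding push_def
      by (rule measure_eigenvalue_conjugacy[OF h _ \<mu>(2,3), symmetric]) (use Tb in \<open>auto simp: bij_betw_def\<close>)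
    also have "\<dots> \<longleftrightarrow> measure_eigenvalue altered (push \<mu>) z"
      by (rule measure_eigenvalue_altered[OF cpt push_inv[OF that], symmetric])
    also have "\<dots> \<longleftrightarrow> measure_eigenvalue (vershik C) (distr (push \<mu>) (borel_on (path_space C)) PI) z"
      by (rule measure_eigenvalue_conjugacy[OF altered_conjugacy[OF cpt] _ \<nu>(2,3), symmetric])
        (use altered_inf in auto)
    finally show ?thesis unfolding trans[OF that] .
  qed
  note eig = this
  show ?thesis
  proof (intro conjI)
    show "contraction_modification B l C"
      unfolding contraction_modification_def using l_mono l_0 order_modification_C by blast
    show "BV_representation C (path_space C) (vershik C)" by (rule BV_C)
    show "minimal_cantor_system (path_space C) (vershik C)" by (rule min)
    show "\<exists>\<phi>. strong_orbit_equivalence X T (path_space C) (vershik C) \<phi> \<and>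
        (\<forall>\<mu>. invariant_probability X T \<mu> \<longrightarrow>
           distr \<mu> (borel_on (path_space C)) \<phi> = transported_measure l C h \<mu> \<and>
           invariant_probability (path_space C) (vershik C) (transported_measure l C h \<mu>))"
    proof (intro exI[of _ "PI \<circ> h"] conjI allI impI soe trans_inv)
      show "distr \<mu> (borel_on (path_space C)) (PI \<circ> h) = transported_measure l C h \<mu>" for \<mu>
        by (simp add: transported_measure_def comp_def)
    qed
    show "\<forall>z. irrational_phase z \<longrightarrow> \<not> continuous_eigenvalue (path_space C) (vershik C) z"
      using no_irrational_eigenvalue[OF cpt min] by blast
    show "\<forall>\<mu>. ergodic_probability X T \<mu> \<longrightarrow>
        (\<forall>z. measure_eigenvalue T \<mu> z \<longleftrightarrow>
             measure_eigenvalue (vershik C) (transported_measure l C h \<mu>) z)"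
      using eig unfolding ergodic_probability_def by blast
    show "(\<forall>z. z \<noteq> 1 \<and> (\<exists>k>0. z ^ k = 1) \<longrightarrow> \<not> continuous_eigenvalue X T z) \<longrightarrow>
        topologically_weakly_mixing (path_space C) (vershik C)"
      using weakly_mixing[OF cpt min h] by blast
  qed
qed

end

theorem corollary23:
  fixes X :: "'x topology" and T :: "'x \<Rightarrow> 'x"
    and B :: "'e ordered_bratteli" and h :: "'x \<Rightarrow> nat \<Rightarrow> 'e"
  assumes "minimal_cantor_system X T"
    and "proper_BV_representation B X T"
    and "conjugacy X T (path_space B) (vershik B) h"
  shows "\<exists>l C.
     contraction_modification B l C \<and>
     BV_representation C (path_space C) (vershik C) \<and>
     minimal_cantor_system (path_space C) (vershik C) \<and>
     (\<exists>\<phi>. strong_orbit_equivalence X T (path_space C) (vershik C) \<phi> \<and>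
        (\<forall>\<mu>. invariant_probability X T \<mu> \<longrightarrow>
           distr \<mu> (borel_on (path_space C)) \<phi> = transported_measure l C h \<mu> \<and>
           invariant_probability (path_space C) (vershik C) (transported_measure l C h \<mu>))) \<and>
     (\<forall>z. irrational_phase z \<longrightarrow> \<not> continuous_eigenvalue (path_space C) (vershik C) z) \<and>
     (\<forall>\<mu>. ergodic_probability X T \<mu> \<longrightarrow>
        (\<forall>z. measure_eigenvalue T \<mu> z \<longleftrightarrow>
             measure_eigenvalue (vershik C) (transported_measure l C h \<mu>) z)) \<and>
     ((\<forall>z. z \<noteq> 1 \<and> (\<exists>k>0. z ^ k = 1) \<longrightarrow> \<not> continuous_eigenvalue X T z) \<longrightarrow>
        topologically_weakly_mixing (path_space C) (vershik C))"
proof -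
  have hh: "homeomorphic_map X (path_space B) h" using assms(3) by (simp add: conjugacy_def)
  \<comment> \<open>Infinitely many paths are what forces the heights to grow.\<close>
  have "infinite (topspace X)" using assms(1) cantor_space_infinite by (auto simp: minimal_cantor_system_def)
  moreover have "bij_betw h (topspace X) (inf_paths B)" using homeomorphic_map_bij_betw[OF hh] by simp
  ultimately have inf: "infinite (inf_paths B)" using bij_betw_finite by blast
  interpret positive_obd B
  proof
    show "ordered_bratteli_diagram B" "properly_ordered B"
      using assms(2) by (simp_all add: proper_BV_representation_def BV_representation_def)
    show "0 < incidence B n u v" if "1 \<le> n" "u \<in> vertices B n" "v \<in> vertices B (Suc n)" for n u v
      using assms(2) that by (simp add: proper_BV_representation_def)
    show "infinite (inf_paths B)" by (rule inf)
  qed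
  obtain l where "fast B l" using ex_fast by blast
  then interpret F: fast B l .
  show ?thesis using F.contracted_system[OF assms(1,3)] by blast
qed

end
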